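(* Let $X$ be a compact metrizable space, and let $S\subset C(X)$ be a function system that separates the points of $X$. Let $\mu,\nu$ be Borel probability measures on $X$. Then the following are equivalent: (1) $\mu\preceq_{\mathrm C}\nu$, that is, $\int_X f\,d\mu\le\int_X f\,d\nu$ for all $f\in\mathcal C_S$; (2) $\mu\preceq_{\mathrm S}\nu$; (3) $\mu\preceq_{\mathrm{ISD}}\nu$; (4) there exists a $\mu$-measurable field of probability measures $x\mapsto\lambda_x\in\operatorname{Prob}(X)$ such that for $\mu$-almost every $x\in X$ one has $\lambda_x(s)=s(x)$ for all $s\in S$, and $$\int_X f\,d\nu=\int_X\lambda_x(f)\,d\mu(x),\qquad f\in C(X).$$
   Context: A function system in $C(X)$ (complex continuous functions) is a unital self-adjoint linear subspace; $S_{\mathrm{sa}}$ is its set of real-valued elements. $\operatorname{Prob}(X)$ is the set of Borel probability measures on $X$, and for $\lambda\in\operatorname{Prob}(X)$ we write $\lambda(f)=\int_X f\,d\lambda$, thereby identifying $\lambda$ with a state of $A:=C(X)$. Since $S$ separates points, $C^*(S)=A$. A field $x\mapsto\lambda_x$ is $\mu$-measurable if $x\mapsto\lambda_x(f)$ is $\mu$-measurable (measurable with respect to the $\mu$-completion of the Borel $\sigma$-algebra) for every $f\in C(X)$. UCP means unital completely positive; $\mathcal E(A)$ is the state space of $A$ with the weak-$*$ topology; $(\pi_\varphi,H_\varphi,\xi_\varphi)$ is the GNS representation of $\varphi\in\mathcal E(A)$. All relations are associated with the pair $(S,A)$. $\mathcal C_S\subset C(X)_{\mathrm{sa}}$ is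 the uniformly closed max-stable cone generated by $S_{\mathrm{sa}}$, i.e. the norm-closed cone generated by the functions $\max\{s_1,\dots,s_n\}$, $n\ge1$, $s_1,\dots,s_n\in S_{\mathrm{sa}}$. Dilation order: for states $\varphi,\psi$ of $A$, $\varphi\preceq_{\mathrm D}\psi$ if there is a UCP map $\Phi:A\to B(H_\varphi)$ with $\Phi(s)=\pi_\varphi(s)$ for all $s\in S$ and $\psi(a)=\langle\Phi(a)\xi_\varphi,\xi_\varphi\rangle$ for all $a\in A$. Strong dilation relation: $\varphi\preceq_{\mathrm S}\psi$ if there is such a $\Phi$ with range contained in the bicommutant $\pi_\varphi(A)''$. Barycenter: for a Borel probability measure $m$ on $\mathcal E(A)$, $\mathfrak b(m)(a)=\int_{\mathcal E(A)}\alpha(a)\,dm(\alpha)$, $a\in A$; $\bar m$ denotes the completion of $m$. Integral subdivision relation: $\varphi\preceq_{\mathrm{ISD}}\psi$ if for every Borel probability measure $m$ on $\mathcal E(A)$ with $\mathfrak b(m)=\varphi$ there is a family of states $\alpha\mapsto\psi_\alpha\in\mathcal E(A)$ ($\alpha\in\mathcal E(A)$) such that $\alpha\mapsto\psi_\alpha(a)$ is $\bar m$-measurable for every $a\in A$, $\alpha\preceq_{\mathrm D}\psi_\alpha$ for $\bar m$-almost every $\alpha$, and $\psi(a)=\int_{\mathcal E(A)}\psi_\alpha(a)\,d\bar m(\alpha)$ for all $a\in A$. *)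

theory Defs
  imports "HOL-Probability.Probability"
begin

section \<open>The C*-algebra of continuous functions\<close>

unbundle bcontfun.lifting

text \<open>
  The space \<open>X\<close> is the universe of a type \<open>'a\<close>. When it is compact, every continuous function is
  bounded, so \<open>'a \<Rightarrow>\<^sub>C complex\<close> with its sup norm is \<open>A = C(X)\<close>, and \<open>'a \<Rightarrow>\<^sub>C real\<close> is its
  self-adjoint part. The library provides the real Banach space structure of these types; the
  operations below add the rest of the *-algebra structure. A metrizable \<open>X\<close> is rendered by
  the class \<open>metric_space\<close>, i.e. with a compatible metric chosen; nothing depends on the choice.
\<close>

lift_definition cmult :: "('a::topological_space \<Rightarrow>\<^sub>C complex) \<Rightarrow> ('a \<Rightarrow>\<^sub>C complex) \<Rightarrow> ('a \<Rightarrow>\<^sub>C complex)"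
  is "\<lambda>f g x. f x * g x"
proof -
  fix f g :: "'a \<Rightarrow> complex"
  assume fg: "f \<in> bcontfun" "g \<in> bcontfun"
  then obtain K L where "\<And>x. norm (f x) \<le> K" "\<And>x. norm (g x) \<le> L"
    by (auto simp: bcontfun_def bounded_iff)
  then have "norm (f x * g x) \<le> K * L" for x
    unfolding norm_mult by (meson mult_mono norm_ge_zero order_trans)
  with fg show "(\<lambda>x. f x * g x) \<in> bcontfun"
    by (auto simp: bcontfun_def bounded_iff intro!: continuous_intros)
qed

lift_definition const_mult :: "complex \<Rightarrow> ('a::topological_space \<Rightarrow>\<^sub>C complex) \<Rightarrow> ('a \<Rightarrow>\<^sub>C complex)"
  is "\<lambda>c f x. c * f x"
proof -
  fix c and f :: "'a \<Rightarrow> complex"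
  assume f: "f \<in> bcontfun"
  then obtain K where "\<And>x. norm (f x) \<le> K"
    by (auto simp: bcontfun_def bounded_iff)
  then have "norm (c * f x) \<le> norm c * K" for x
    unfolding norm_mult by (simp add: mult_left_mono)
  with f show "(\<lambda>x. c * f x) \<in> bcontfun"
    by (auto simp: bcontfun_def bounded_iff intro!: continuous_intros)
qed

lift_definition conj_fun :: "('a::topological_space \<Rightarrow>\<^sub>C complex) \<Rightarrow> ('a \<Rightarrow>\<^sub>C complex)"
  is "\<lambda>f x. cnj (f x)"
  by (auto simp: bcontfun_def bounded_iff intro!: continuous_intros)

lift_definition of_real_fun :: "('a::topological_space \<Rightarrow>\<^sub>C real) \<Rightarrow> ('a \<Rightarrow>\<^sub>C complex)"
  is "\<lambda>f x. complex_of_real (f x)"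
  by (auto simp: bcontfun_def bounded_iff intro!: continuous_intros)

definition function_system :: "('a::topological_space \<Rightarrow>\<^sub>C complex) set \<Rightarrow> bool" where
  "function_system S \<longleftrightarrow>
     const_bcontfun 1 \<in> S \<and>
     (\<forall>f\<in>S. \<forall>g\<in>S. f + g \<in> S) \<and>
     (\<forall>c. \<forall>f\<in>S. const_mult c f \<in> S) \<and>
     (\<forall>f\<in>S. conj_fun f \<in> S)"

definition separates_points :: "('a::topological_space \<Rightarrow>\<^sub>C complex) set \<Rightarrow> bool" where
  "separates_points S \<longleftrightarrow> (\<forall>x y. x \<noteq> y \<longrightarrow> (\<exists>s\<in>S. apply_bcontfun s x \<noteq> apply_bcontfun s y))"

definition self_adjoint_part :: "('a::topological_space \<Rightarrow>\<^sub>C complex) set \<Rightarrow> ('a \<Rightarrow>\<^sub>C real) set" where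
  "self_adjoint_part S = {s. of_real_fun s \<in> S}"

definition max_stable_cone :: "('a::topological_space \<Rightarrow>\<^sub>C complex) set \<Rightarrow> ('a \<Rightarrow>\<^sub>C real) set" where
  "max_stable_cone S =
     closure (convex_cone hull
       {f. \<exists>F. finite F \<and> F \<noteq> {} \<and> F \<subseteq> self_adjoint_part S \<and>
               (\<forall>x. apply_bcontfun f x = Max ((\<lambda>s. apply_bcontfun s x) ` F))})"

definition Prob :: "'a::topological_space measure set" where
  "Prob = {M. prob_space M \<and> sets M = sets borel}"

definition choquet_le ::
  "('a::topological_space \<Rightarrow>\<^sub>C complex) set \<Rightarrow> 'a measure \<Rightarrow> 'a measure \<Rightarrow> bool" where
  "choquet_le S \<mu> \<nu> \<longleftrightarrow>
     (\<forall>f\<in>max_stable_cone S. (\<integral>x. apply_bcontfun f x \<partial>\<mu>) \<le> (\<integral>x. apply_bcontfun f x \<partial>\<nu>))"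


section \<open>States\<close>

type_synonym 'a functional = "('a \<Rightarrow>\<^sub>C complex) \<Rightarrow> complex"

definition states :: "'a::topological_space functional set" where
  "states = {\<phi>. (\<forall>f g. \<phi> (f + g) = \<phi> f + \<phi> g) \<and>
                (\<forall>c f. \<phi> (const_mult c f) = c * \<phi> f) \<and>
                (\<forall>f. \<phi> (cmult (conj_fun f) f) \<in> \<real>\<^sub>\<ge>\<^sub>0) \<and>
                \<phi> (const_bcontfun 1) = 1}"

definition state_of :: "'a::topological_space measure \<Rightarrow> 'a functional" where
  "state_of \<mu> = (\<lambda>f. \<integral>x. apply_bcontfun f x \<partial>\<mu>)"

text \<open>
  The topology of a function type is the product topology, i.e. pointwise convergence, so the
  weak-* topology of the state space is the subspace topology inherited from \<open>'a functional\<close>.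
  The Borel sets of a subspace are the traces of the Borel sets of the ambient space.
\<close>

definition state_borel :: "'a::topological_space functional measure" where
  "state_borel = restrict_space borel states"


section \<open>Bounded operators and completely positive maps\<close>

text \<open>A complex inner product space on a subset of \<open>'h\<close>; the inner product is linear in its first
  argument.\<close>

record 'h inner_space =
  hcarrier :: "'h set"
  hadd :: "'h \<Rightarrow> 'h \<Rightarrow> 'h"
  hscale :: "complex \<Rightarrow> 'h \<Rightarrow> 'h"
  hinner :: "'h \<Rightarrow> 'h \<Rightarrow> complex"

definition hnorm :: "'h inner_space \<Rightarrow> 'h \<Rightarrow> real" where
  "hnorm H h = sqrt (Re (hinner H h h))"

text \<open>Operators are \<open>extensional\<close>, so that equality of operators is equality on the carrier; their
  product is \<open>compose (hcarrier H)\<close>.\<close>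

definition bounded_operators :: "'h inner_space \<Rightarrow> ('h \<Rightarrow> 'h) set" where
  "bounded_operators H =
     {T \<in> hcarrier H \<rightarrow>\<^sub>E hcarrier H.
        (\<forall>h\<in>hcarrier H. \<forall>k\<in>hcarrier H. T (hadd H h k) = hadd H (T h) (T k)) \<and>
        (\<forall>c. \<forall>h\<in>hcarrier H. T (hscale H c h) = hscale H c (T h)) \<and>
        (\<exists>K. \<forall>h\<in>hcarrier H. hnorm H (T h) \<le> K * hnorm H h)}"

definition commutant :: "'h inner_space \<Rightarrow> ('h \<Rightarrow> 'h) set \<Rightarrow> ('h \<Rightarrow> 'h) set" where
  "commutant H M =
     {T \<in> bounded_operators H. \<forall>R\<in>M. compose (hcarrier H) T R = compose (hcarrier H) R T}"

text \<open>Matrices of size \<open>n\<close> are functions of two indices below \<open>n\<close>. A matrix over \<open>C(X)\<close> is positive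
  if it is of the form \<open>b* b\<close>; a matrix over \<open>B(H)\<close> is positive if it is a positive operator on
  \<open>H\<^sup>n\<close>.\<close>

definition positive_fun_matrix ::
  "nat \<Rightarrow> (nat \<Rightarrow> nat \<Rightarrow> 'a::topological_space \<Rightarrow>\<^sub>C complex) \<Rightarrow> bool" where
  "positive_fun_matrix n a \<longleftrightarrow>
     (\<exists>b. \<forall>i<n. \<forall>j<n. a i j = (\<Sum>k<n. cmult (conj_fun (b k i)) (b k j)))"

definition positive_op_matrix :: "'h inner_space \<Rightarrow> nat \<Rightarrow> (nat \<Rightarrow> nat \<Rightarrow> 'h \<Rightarrow> 'h) \<Rightarrow> bool" where
  "positive_op_matrix H n T \<longleftrightarrow>
     (\<forall>h. (\<forall>i<n. h i \<in> hcarrier H) \<longrightarrow>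
          (\<Sum>i<n. \<Sum>j<n. hinner H (T i j (h j)) (h i)) \<in> \<real>\<^sub>\<ge>\<^sub>0)"

definition ucp_map ::
  "'h inner_space \<Rightarrow> (('a::topological_space \<Rightarrow>\<^sub>C complex) \<Rightarrow> 'h \<Rightarrow> 'h) \<Rightarrow> bool" where
  "ucp_map H \<Phi> \<longleftrightarrow>
     (\<forall>f. \<Phi> f \<in> bounded_operators H) \<and>
     (\<forall>f g. \<forall>h\<in>hcarrier H. \<Phi> (f + g) h = hadd H (\<Phi> f h) (\<Phi> g h)) \<and>
     (\<forall>c f. \<forall>h\<in>hcarrier H. \<Phi> (const_mult c f) h = hscale H c (\<Phi> f h)) \<and>
     (\<forall>h\<in>hcarrier H. \<Phi> (const_bcontfun 1) h = h) \<and>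
     (\<forall>n a. positive_fun_matrix n a \<longrightarrow> positive_op_matrix H n (\<lambda>i j. \<Phi> (a i j)))"


section \<open>The GNS representation\<close>

text \<open>
  The GNS Hilbert space of \<open>\<phi>\<close> is the completion of \<open>A\<close> modulo the null space of the seminorm
  \<open>f \<mapsto> \<phi>(f* f)\<^sup>1\<^sup>/\<^sup>2\<close>. Both steps are performed at once: its vectors are the classes of Cauchy
  sequences for this seminorm modulo null sequences.
\<close>

definition gns_seminorm :: "'a::topological_space functional \<Rightarrow> ('a \<Rightarrow>\<^sub>C complex) \<Rightarrow> real" where
  "gns_seminorm \<phi> f = sqrt (Re (\<phi> (cmult (conj_fun f) f)))"

definition gns_cauchy :: "'a::topological_space functional \<Rightarrow> (nat \<Rightarrow> 'a \<Rightarrow>\<^sub>C complex) set" where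
  "gns_cauchy \<phi> = {u. \<forall>e>0. \<exists>N. \<forall>m\<ge>N. \<forall>n\<ge>N. gns_seminorm \<phi> (u m - u n) < e}"

definition gns_rel ::
  "'a::topological_space functional \<Rightarrow> ((nat \<Rightarrow> 'a \<Rightarrow>\<^sub>C complex) \<times> (nat \<Rightarrow> 'a \<Rightarrow>\<^sub>C complex)) set" where
  "gns_rel \<phi> = {(u, v). u \<in> gns_cauchy \<phi> \<and> v \<in> gns_cauchy \<phi> \<and>
                        (\<lambda>n. gns_seminorm \<phi> (u n - v n)) \<longlonglongrightarrow> 0}"

type_synonym 'a gns_vector = "(nat \<Rightarrow> 'a \<Rightarrow>\<^sub>C complex) set"

definition gns_class ::
  "'a::topological_space functional \<Rightarrow> (nat \<Rightarrow> 'a \<Rightarrow>\<^sub>C complex) \<Rightarrow> 'a gns_vector" where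
  "gns_class \<phi> u = gns_rel \<phi> `` {u}"

text \<open>The operations below are defined through an arbitrary representing Cauchy sequence; for a
  state \<open>\<phi>\<close> they do not depend on this choice.\<close>

definition gns_rep :: "'a::topological_space gns_vector \<Rightarrow> nat \<Rightarrow> 'a \<Rightarrow>\<^sub>C complex" where
  "gns_rep P = (SOME u. u \<in> P)"

definition gns_space :: "'a::topological_space functional \<Rightarrow> 'a gns_vector inner_space" where
  "gns_space \<phi> =
     \<lparr>hcarrier = gns_cauchy \<phi> // gns_rel \<phi>,
      hadd = (\<lambda>P Q. gns_class \<phi> (\<lambda>n. gns_rep P n + gns_rep Q n)),
      hscale = (\<lambda>c P. gns_class \<phi> (\<lambda>n. const_mult c (gns_rep P n))),
      hinner = (\<lambda>P Q. lim (\<lambda>n. \<phi> (cmult (conj_fun (gns_rep Q n)) (gns_rep P n))))\<rparr>"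

definition gns_rep_map ::
  "'a::topological_space functional \<Rightarrow> ('a \<Rightarrow>\<^sub>C complex) \<Rightarrow> 'a gns_vector \<Rightarrow> 'a gns_vector" where
  "gns_rep_map \<phi> f = (\<lambda>P\<in>hcarrier (gns_space \<phi>). gns_class \<phi> (\<lambda>n. cmult f (gns_rep P n)))"

definition gns_cyclic :: "'a::topological_space functional \<Rightarrow> 'a gns_vector" where
  "gns_cyclic \<phi> = gns_class \<phi> (\<lambda>n. const_bcontfun 1)"


section \<open>Dilation relations\<close>

definition dilation_map ::
  "('a::topological_space \<Rightarrow>\<^sub>C complex) set \<Rightarrow> 'a functional \<Rightarrow> 'a functional \<Rightarrow>
   (('a \<Rightarrow>\<^sub>C complex) \<Rightarrow> 'a gns_vector \<Rightarrow> 'a gns_vector) \<Rightarrow> bool" where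
  "dilation_map S \<phi> \<psi> \<Phi> \<longleftrightarrow>
     ucp_map (gns_space \<phi>) \<Phi> \<and>
     (\<forall>s\<in>S. \<Phi> s = gns_rep_map \<phi> s) \<and>
     (\<forall>a. \<psi> a = hinner (gns_space \<phi>) (\<Phi> a (gns_cyclic \<phi>)) (gns_cyclic \<phi>))"

definition dilation_le ::
  "('a::topological_space \<Rightarrow>\<^sub>C complex) set \<Rightarrow> 'a functional \<Rightarrow> 'a functional \<Rightarrow> bool" where
  "dilation_le S \<phi> \<psi> \<longleftrightarrow> (\<exists>\<Phi>. dilation_map S \<phi> \<psi> \<Phi>)"

definition strong_dilation_le ::
  "('a::topological_space \<Rightarrow>\<^sub>C complex) set \<Rightarrow> 'a functional \<Rightarrow> 'a functional \<Rightarrow> bool" where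
  "strong_dilation_le S \<phi> \<psi> \<longleftrightarrow>
     (\<exists>\<Phi>. dilation_map S \<phi> \<psi> \<Phi> \<and>
          range \<Phi> \<subseteq> commutant (gns_space \<phi>) (commutant (gns_space \<phi>) (range (gns_rep_map \<phi>))))"

definition barycenter :: "'a::topological_space functional measure \<Rightarrow> 'a functional" where
  "barycenter m = (\<lambda>a. \<integral>\<alpha>. \<alpha> a \<partial>m)"

definition isd_le ::
  "('a::topological_space \<Rightarrow>\<^sub>C complex) set \<Rightarrow> 'a functional \<Rightarrow> 'a functional \<Rightarrow> bool" where
  "isd_le S \<phi> \<psi> \<longleftrightarrow>
     (\<forall>m. prob_space m \<and> sets m = sets state_borel \<and> barycenter m = \<phi> \<longrightarrow>
        (\<exists>\<Psi>. (\<forall>\<alpha>\<in>states. \<Psi> \<alpha> \<in> states) \<and>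
             (\<forall>a. (\<lambda>\<alpha>. \<Psi> \<alpha> a) \<in> borel_measurable (completion m)) \<and>
             (AE \<alpha> in completion m. dilation_le S \<alpha> (\<Psi> \<alpha>)) \<and>
             (\<forall>a. \<psi> a = (\<integral>\<alpha>. \<Psi> \<alpha> a \<partial>completion m))))"

end

theory Submission
  imports Defs
begin

text \<open>
  Each of (2), (3), (4) implies (1), it being enough to compare \<open>\<integral> f d\<mu>\<close> and \<open>\<integral> f d\<nu>\<close> for
  \<open>f = max s\<^sub>i\<close>. Under (4), and under (3) applied to the image of \<open>\<mu>\<close> under \<open>x \<mapsto> \<delta>\<^sub>x\<close>, this is an integrated pointwise
  inequality. Under (2) the operators \<open>\<Phi>(a)\<close> commute with \<open>\<pi>(A)\<close>, so that \<open>\<Phi>(f) \<ge> \<pi>(s\<^sub>i)\<close> can be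
  localized by a partition of unity \<open>\<Sum> h\<^sub>i\<^sup>2 = 1\<close> with \<open>s\<^sub>i > f - \<epsilon>\<close> on the support of \<open>h\<^sub>i\<close>.

  Conversely, (1) yields a Borel kernel \<open>x \<mapsto> \<lambda>\<^sub>x\<close> from \<open>\<mu>\<close> to \<open>\<nu>\<close> with \<open>\<lambda>\<^sub>x(s) = s(x)\<close> for every \<open>x\<close>:
  Hahn-Banach gives a positive functional on \<open>C(X \<times> X)\<close> that is \<open>\<nu>\<close> on functions of the second
  variable and \<open>\<integral> F(x,x) d\<mu>\<close> on functions \<open>F\<close> with sections in \<open>S\<close>; it is a measure, and this is
  disintegrated by Radon-Nikodym derivatives for a countable dense set of functions of the second
  variable. Multiplication by \<open>x \<mapsto> \<lambda>\<^sub>x(a)\<close> on \<open>L\<^sup>2(\<mu>)\<close> is the map \<open>\<Phi>\<close> required in (2), and (3) follows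
  by applying this to \<open>\<alpha> \<in> Prob(X)\<close> in place of \<open>\<mu>\<close>.
\<close>

section \<open>Riesz representation on compact metric spaces\<close>

text \<open>Condition (1) enters at one point only: it makes the infimum \<open>upper\<close>
  finite. This is the dual of a transport problem, the cheapest way to dominate a function on the
  square by one with sections in the real part of \<open>S\<close> plus one of the second variable.
  A linear functional below \<open>upper\<close> has no further constraint to satisfy: functions of
  either kind dominate themselves, and so do their negatives, which forces the prescribed values.

  The densities give the barycentre equation almost everywhere only. Dirac measures on the
  exceptional Borel null set make it hold at every point, so that the same kernel can be averaged
  over any \<alpha> in \<open>Prob\<close> without new null sets. For (3) it remains to know that
  the representing measure of a state depends measurably on the state; then a barycentre becomes an
  average of measures.

  For (2) the obstacle is that the kernel applied to \<open>a\<close> is merely a Borel function,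
  while GNS vectors are classes of sequences of continuous ones. Approximants with a common sup
  bound make multiplication by it a strong limit of the representation, and this puts it into the
  bicommutant.\<close>

locale positive_functional =
  fixes I :: "('b::metric_space \<Rightarrow> real) \<Rightarrow> real"
  assumes compact_space: "compact (UNIV :: 'b set)"
    and add: "continuous_on UNIV f \<Longrightarrow> continuous_on UNIV g \<Longrightarrow> I (\<lambda>x. f x + g x) = I f + I g"
    and scale: "continuous_on UNIV f \<Longrightarrow> I (\<lambda>x. c * f x) = c * I f"
    and nonneg: "continuous_on UNIV f \<Longrightarrow> (\<And>x. 0 \<le> f x) \<Longrightarrow> 0 \<le> I f"
begin

lemma zero: "I (\<lambda>x. 0) = 0"
  using scale[of "\<lambda>_. 0" 0] by simp

lemma diff:
  assumes "continuous_on UNIV f" "continuous_on UNIV g"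
  shows "I (\<lambda>x. f x - g x) = I f - I g"
  using add[of f "\<lambda>x. -1 * g x"] scale[of g "-1"] assms by (simp add: continuous_intros)

lemma mono:
  assumes "continuous_on UNIV f" "continuous_on UNIV g" "\<And>x. f x \<le> g x"
  shows "I f \<le> I g"
  using nonneg[of "\<lambda>x. g x - f x"] diff[of g f] assms by (simp add: continuous_intros)

lemma sum:
  assumes "\<And>i. i \<in> F \<Longrightarrow> continuous_on UNIV (f i)"
  shows "I (\<lambda>x. \<Sum>i\<in>F. f i x) = (\<Sum>i\<in>F. I (f i))"
  using assms
  by (induction F rule: infinite_finite_induct) (auto simp: zero add continuous_intros)

section \<open>Daniell's outer measure of a positive functional and its measurable sets\<close>

definition covers :: "'b set \<Rightarrow> (nat \<Rightarrow> 'b \<Rightarrow> real) set" where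
  "covers A = {f. (\<forall>n. continuous_on UNIV (f n) \<and> (\<forall>x. 0 \<le> f n x)) \<and>
                  (\<forall>x\<in>A. 1 \<le> (\<Sum>n. ennreal (f n x)))}"

text \<open>Sequences of continuous functions take the place of coverings by open sets, so that the
  functional can be applied to the covering itself. Pointwise sums are formed in
  \<open>ennreal\<close> since they may diverge.\<close>

definition outer :: "'b set \<Rightarrow> ennreal" where
  "outer A = (INF f\<in>covers A. \<Sum>n. ennreal (I (f n)))"

lemma outer_le: "f \<in> covers A \<Longrightarrow> outer A \<le> (\<Sum>n. ennreal (I (f n)))"
  unfolding outer_def by (rule INF_lower)

lemma outer_le_single:
  assumes "continuous_on UNIV f" "\<And>x. 0 \<le> f x" "\<And>x. x \<in> A \<Longrightarrow> 1 \<le> f x"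
  shows "outer A \<le> ennreal (I f)"
proof -
  define F where "F n = (if n = (0::nat) then f else (\<lambda>x. 0))" for n
  have *: "(\<Sum>n. ennreal (F n x)) = ennreal (f x)" for x
    by (subst suminf_finite[of "{0}"]) (auto simp: F_def)
  have "F \<in> covers A"
    unfolding covers_def mem_Collect_eq *
  proof (intro conjI allI ballI)
    show "continuous_on UNIV (F n)" "0 \<le> F n x" for n x
      using assms(1,2) by (simp_all add: F_def)
    show "1 \<le> ennreal (f x)" if "x \<in> A" for x
      using ennreal_leI[OF assms(3)[OF that]] by simp
  qed
  then have "outer A \<le> (\<Sum>n. ennreal (I (F n)))"
    by (rule outer_le)
  also have "\<dots> = ennreal (I f)"
    by (subst suminf_finite[of "{0}"]) (auto simp: F_def zero)
  finally show ?thesis .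
qed

lemma outer_empty: "outer {} = 0"
  using outer_le_single[of "\<lambda>_. 0" "{}"] by (simp add: zero)

lemma outer_mono: "A \<subseteq> B \<Longrightarrow> outer A \<le> outer B"
  unfolding outer_def covers_def by (intro INF_superset_mono) auto

lemma outer_close: "outer A < e \<Longrightarrow> \<exists>f\<in>covers A. (\<Sum>n. ennreal (I (f n))) < e"
  unfolding outer_def INF_less_iff by auto

text \<open>Double sequences arise in countable subadditivity and when a cover is cut along a closed
  set; \<open>prod_decode\<close> enumerates the pairs, and sums in \<open>ennreal\<close> do not
  depend on the order.\<close>

lemma covers_prod_decode:
  assumes cont: "\<And>m n. continuous_on UNIV (f m n)" and nn: "\<And>m n x. 0 \<le> f m n x"
    and "\<And>x. x \<in> A \<Longrightarrow> 1 \<le> (\<Sum>m. \<Sum>n. ennreal (f m n x))"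
  shows "outer A \<le> (\<Sum>m. \<Sum>n. ennreal (I (f m n)))"
proof -
  define C where "C = case_prod f \<circ> prod_decode"
  have sum: "(\<Sum>i. g (C i)) = (\<Sum>m. \<Sum>n. g (f m n))" for g :: "_ \<Rightarrow> ennreal"
    unfolding C_def comp_def
    using suminf_ennreal_2dimen[of "\<lambda>m. \<Sum>n. g (f m n)" "\<lambda>p. g (f (fst p) (snd p))"]
    by (simp add: case_prod_unfold)
  have "C \<in> covers A"
    using assms sum[of "\<lambda>h. ennreal (h x)" for x]
    by (auto simp: covers_def C_def case_prod_unfold comp_def)
  from outer_le[OF this] show ?thesis
    by (simp add: sum[of "\<lambda>h. ennreal (I h)"])
qed

lemma countably_subadditive_outer: "countably_subadditive UNIV outer"
proof (simp add: countably_subadditive_def, safe)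
  fix A :: "nat \<Rightarrow> 'b set"
  show "outer (\<Union>i. A i) \<le> (\<Sum>n. outer (A n))"
  proof (rule ennreal_le_epsilon)
    fix e :: real assume "0 < e" "(\<Sum>n. outer (A n)) < top"
    then have *: "\<And>n. outer (A n) < outer (A n) + e * (1/2)^Suc n"
      by (auto simp add: less_top dest!: ennreal_suminf_lessD)
    obtain B where B: "\<And>n. B n \<in> covers (A n)"
      and Ble: "\<And>n. (\<Sum>i. ennreal (I (B n i))) \<le> outer (A n) + e * (1/2)^Suc n"
      by (metis less_imp_le outer_close[OF *])
    have "outer (\<Union>i. A i) \<le> (\<Sum>n. \<Sum>i. ennreal (I (B n i)))"
    proof (rule covers_prod_decode)
      fix x assume "x \<in> (\<Union>i. A i)"
      then obtain i where "x \<in> A i" by auto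
      with B[of i] have "1 \<le> (\<Sum>n. ennreal (B i n x))"
        by (auto simp: covers_def)
      also have "\<dots> \<le> (\<Sum>i. \<Sum>n. ennreal (B i n x))"
        using sum_le_suminf[of "\<lambda>i. \<Sum>n. ennreal (B i n x)" "{i}"] by simp
      finally show "1 \<le> (\<Sum>i. \<Sum>n. ennreal (B i n x))" .
    qed (use B in \<open>auto simp: covers_def\<close>)
    also have "\<dots> \<le> (\<Sum>n. outer (A n) + e * (1/2) ^ Suc n)"
      by (intro suminf_le allI Ble) auto
    also have "\<dots> = (\<Sum>n. outer (A n)) + (\<Sum>n. ennreal e * ennreal ((1/2) ^ Suc n))"
      using \<open>0 < e\<close> by (subst suminf_add[symmetric])
                       (auto simp del: ennreal_suminf_cmult simp add: ennreal_mult[symmetric])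
    also have "\<dots> = (\<Sum>n. outer (A n)) + e"
      unfolding ennreal_suminf_cmult
      by (subst suminf_ennreal_eq[OF zero_le_power power_half_series]) auto
    finally show "outer (\<Union>i. A i) \<le> (\<Sum>n. outer (A n)) + e" .
  qed
qed

lemma outer_measure_space_outer: "outer_measure_space UNIV outer"
  by (auto simp: outer_measure_space_def positive_def increasing_def outer_empty outer_mono
      countably_subadditive_outer)

text \<open>The Caratheodory inequality for a closed set, tested on one cover. The functions
  \<open>g k\<close> vanish on \<open>K\<close> and increase to 1 off \<open>K\<close>. Cutting
  \<open>f n\<close> into increments along \<open>g\<close> covers \<open>A - K\<close> at cost
  \<open>a n\<close>, the limit of \<open>J n k\<close> in \<open>k\<close>; the rests
  \<open>f n x * (1 - g k x)\<close> cover the part inside \<open>K\<close> at a cost that tends to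
  \<open>I (f n) - a n\<close>. The number \<open>a n\<close> is only a limit of values of
  \<open>I\<close>, not itself a value of \<open>I\<close>.\<close>

lemma outer_split_le:
  fixes K :: "'b set"
  assumes K: "closed K" "K \<noteq> {}" and f: "f \<in> covers A"
  shows "outer (A \<inter> K) + outer (A - K) \<le> (\<Sum>n. ennreal (I (f n)))"
proof -
  define g where "g k x = min 1 (real k * infdist x K)" for k x
  have f_cont [continuous_intros]: "continuous_on UNIV (f n)" and f_nn: "0 \<le> f n x" for n x
    using f by (auto simp: covers_def)
  have g_cont [continuous_intros]: "continuous_on UNIV (g k)" for k
    unfolding g_def by (intro continuous_intros)
  have g_range: "0 \<le> g k x" "g k x \<le> 1" for k x
    by (auto simp: g_def infdist_nonneg)
  have g_mono: "k \<le> l \<Longrightarrow> g k x \<le> g l x" for k l x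
    unfolding g_def by (intro min.mono mult_right_mono) (auto simp: infdist_nonneg)
  have g_zero: "g k x = 0" if "x \<in> K" for k x
    using that by (simp add: g_def)
  have g_lim: "(\<lambda>k. g k x) \<longlonglongrightarrow> 1" if "x \<notin> K" for x
  proof (rule tendsto_eventually)
    have pos: "infdist x K > 0"
      using that K by (simp add: infdist_pos_not_in_closed)
    then obtain N where N: "1 < real N * infdist x K"
      using reals_Archimedean3 by blast
    have "g k x = 1" if "k \<ge> N" for k
      using g_mono[OF that, of x] g_range[of k x] N by (auto simp: g_def)
    then show "\<forall>\<^sub>F k in sequentially. g k x = 1"
      by (auto simp: eventually_sequentially)
  qed
  define J where "J n k = I (\<lambda>x. f n x * g k x)" for n k
  have J_mono: "k \<le> l \<Longrightarrow> J n k \<le> J n l" for n k l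
    unfolding J_def by (intro mono continuous_intros mult_left_mono g_mono f_nn)
  have J_le: "J n k \<le> I (f n)" for n k
    unfolding J_def by (intro mono continuous_intros) (simp add: mult_left_le g_range f_nn)
  have J_0: "J n 0 = 0" for n
    by (simp add: J_def g_def zero)
  have "\<exists>a. J n \<longlonglongrightarrow> a" for n
  proof -
    have "incseq (J n)" using J_mono by (simp add: incseq_def)
    then obtain L where "J n \<longlonglongrightarrow> L"
      by (rule incseq_convergent) (use J_le in auto)
    then show ?thesis by (rule exI)
  qed
  then obtain a where a: "\<And>n. J n \<longlonglongrightarrow> a n" by metis
  have Ja: "J n k \<le> a n" for n k
    using incseq_le[OF _ a[of n]] J_mono by (simp add: incseq_def)
  have a_nn: "0 \<le> a n" for n
    using Ja[of n 0] by (simp add: J_0)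
  have a_le: "a n \<le> I (f n)" for n
    using LIMSEQ_le_const2[OF a] J_le by blast
  \<comment> \<open>Off \<open>K\<close> the increments of \<open>g\<close> telescope to 1 because
    \<open>g 0\<close> is 0; under \<open>I\<close> they telescope to the limit
    \<open>a n\<close>.\<close>
  have "outer (A - K) \<le> (\<Sum>n. \<Sum>k. ennreal (I (\<lambda>x. f n x * (g (Suc k) x - g k x))))"
  proof (rule covers_prod_decode)
    fix x assume x: "x \<in> A - K"
    have "(\<Sum>k. ennreal (f n x * (g (Suc k) x - g k x))) = ennreal (f n x)" for n
    proof (rule suminf_ennreal_eq)
      have "(\<lambda>k. g (Suc k) x - g k x) sums (1 - g 0 x)"
        using x by (intro telescope_sums g_lim) auto
      from sums_mult[OF this, of "f n x"]
      show "(\<lambda>k. f n x * (g (Suc k) x - g k x)) sums f n x"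
        by (simp add: g_def)
    qed (simp add: f_nn g_mono)
    then show "1 \<le> (\<Sum>n. \<Sum>k. ennreal (f n x * (g (Suc k) x - g k x)))"
      using f x by (simp add: covers_def)
  qed (auto intro!: continuous_intros simp: f_nn g_mono)
  also have "\<dots> = (\<Sum>n. ennreal (a n))"
  proof (rule suminf_cong, rule suminf_ennreal_eq)
    fix n
    have *: "I (\<lambda>x. f n x * (g (Suc k) x - g k x)) = J n (Suc k) - J n k" for k
      unfolding J_def right_diff_distrib by (intro diff continuous_intros)
    show "(\<lambda>k. I (\<lambda>x. f n x * (g (Suc k) x - g k x))) sums a n"
      using telescope_sums[OF a[of n]] by (simp add: * J_0)
    show "0 \<le> I (\<lambda>x. f n x * (g (Suc k) x - g k x))" for k
      by (simp add: * J_mono)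
  qed
  finally have 1: "outer (A - K) \<le> (\<Sum>n. ennreal (a n))" .
  have 2: "outer (A \<inter> K) \<le> (\<Sum>n. ennreal (I (f n) - J n (k n)))" for k
  proof -
    have "(\<lambda>n x. f n x * (1 - g (k n) x)) \<in> covers (A \<inter> K)"
      using f by (auto simp: covers_def g_zero g_range intro!: continuous_intros)
    from outer_le[OF this] show ?thesis
      unfolding J_def right_diff_distrib by (subst (asm) diff) (auto intro!: continuous_intros)
  qed
  show ?thesis
  proof (rule ennreal_le_epsilon)
    fix e :: real assume e: "0 < e"
    \<comment> \<open>The cut-off index may depend on \<open>n\<close>, which makes the errors
      summable to \<open>e\<close>.\<close>
    have "\<exists>k. a n - J n k < e * (1/2) ^ Suc n" for n
    proof -
      have "\<forall>\<^sub>F k in sequentially. a n - e * (1/2) ^ Suc n < J n k"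
        using e by (intro order_tendstoD[OF a]) simp
      then obtain k where "a n - e * (1/2) ^ Suc n < J n k"
        using eventually_happens trivial_limit_sequentially by blast
      then show ?thesis by (intro exI[of _ k]) linarith
    qed
    then obtain k where k: "\<And>n. a n - J n (k n) < e * (1/2) ^ Suc n" by metis
    have "outer (A \<inter> K) + outer (A - K)
      \<le> (\<Sum>n. ennreal (I (f n) - J n (k n))) + (\<Sum>n. ennreal (a n))"
      by (intro add_mono 1 2)
    also have "\<dots> = (\<Sum>n. ennreal (I (f n) - J n (k n)) + ennreal (a n))"
      by (intro suminf_add) auto
    also have "\<dots> \<le> (\<Sum>n. ennreal (I (f n)) + ennreal e * ennreal ((1/2) ^ Suc n))"
    proof (intro suminf_le allI)
      fix n
      have "ennreal (I (f n) - J n (k n)) + ennreal (a n) = ennreal (I (f n) - J n (k n) + a n)"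
        using J_le a_nn by (simp add: ennreal_plus)
      also have "\<dots> \<le> ennreal (I (f n) + e * (1/2) ^ Suc n)"
        using k[of n] by (intro ennreal_leI) linarith
      also have "\<dots> = ennreal (I (f n)) + ennreal e * ennreal ((1/2) ^ Suc n)"
        using e a_nn[of n] a_le[of n]
        by (simp add: ennreal_plus flip: ennreal_mult)
      finally show "ennreal (I (f n) - J n (k n)) + ennreal (a n)
        \<le> ennreal (I (f n)) + ennreal e * ennreal ((1/2) ^ Suc n)" .
    qed auto
    also have "\<dots> = (\<Sum>n. ennreal (I (f n))) + (\<Sum>n. ennreal e * ennreal ((1/2) ^ Suc n))"
      by (subst suminf_add[symmetric]) auto
    also have "\<dots> = (\<Sum>n. ennreal (I (f n))) + e"
      unfolding ennreal_suminf_cmult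
      by (subst suminf_ennreal_eq[OF zero_le_power power_half_series]) auto
    finally show "outer (A \<inter> K) + outer (A - K) \<le> (\<Sum>n. ennreal (I (f n))) + ennreal e" .
  qed
qed

lemma closed_in_lambda_system:
  assumes "closed K"
  shows "K \<in> lambda_system UNIV UNIV outer"
\<comment> \<open>The empty set is treated apart: \<open>infdist x {}\<close> is 0 by convention, so
  the cut-off functions of \<open>outer_split_le\<close> would vanish identically.\<close>
proof (cases "K = {}")
  case False
  have "outer (A \<inter> K) + outer (A - K) = outer A" for A
  proof (rule antisym)
    show "outer (A \<inter> K) + outer (A - K) \<le> outer A"
      unfolding outer_def[of A] by (intro INF_greatest outer_split_le assms False)
    have "subadditive UNIV outer"
      using ring_of_sets.countably_subadditive_subadditive[of UNIV UNIV outer]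
        countably_subadditive_outer outer_empty
      by (metis Pow_UNIV algebra_Pow algebra.axioms(1) positive_def)
    from subadditiveD[OF this, of "A \<inter> K" "A - K"]
    show "outer A \<le> outer (A \<inter> K) + outer (A - K)"
      by (simp add: Int_Diff_Un Int_Diff_disjoint)
  qed
  then show ?thesis
    by (subst algebra.lambda_system_eq) (auto simp: algebra_Pow[of UNIV, simplified])
qed (use algebra.lambda_system_empty[of UNIV UNIV outer] outer_empty algebra_Pow[of UNIV]
     in \<open>auto simp: positive_def\<close>)

section \<open>The representing measure and its integral\<close>

definition riesz_measure :: "'b measure" where
  "riesz_measure = measure_of UNIV (sets borel) outer"

lemma sets_riesz_measure [simp, measurable_cong]: "sets riesz_measure = sets borel"
  unfolding riesz_measure_def by (metis sets.sets_measure_of_eq space_borel)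

lemma space_riesz_measure [simp]: "space riesz_measure = UNIV"
  using sets_eq_imp_space_eq[OF sets_riesz_measure] by simp

lemma emeasure_riesz_measure:
  assumes "A \<in> sets borel"
  shows "emeasure riesz_measure A = outer A"
proof -
  have ms: "measure_space UNIV (lambda_system UNIV UNIV outer) outer"
    using sigma_algebra.caratheodory_lemma[of UNIV UNIV outer] outer_measure_space_outer
      sigma_algebra_Pow[of UNIV] by simp
  then interpret \<Lambda>: sigma_algebra UNIV "lambda_system UNIV UNIV outer"
    by (simp add: measure_space_def)
  have sub: "sets borel \<subseteq> lambda_system UNIV UNIV outer"
    unfolding borel_eq_closed
    by (subst sets_measure_of) (auto intro!: \<Lambda>.sigma_sets_subset closed_in_lambda_system)
  have "measure_space UNIV (sets borel) outer"
    using measure_down[OF ms _ sub] sets.sigma_algebra_axioms[of borel] by simp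
  with assms show ?thesis
    unfolding riesz_measure_def measure_space_def by (intro emeasure_measure_of_sigma) auto
qed

text \<open>A Dini argument gives the lower bound. The partial sums of a cover of the whole space
  pass \<open>1 - d\<close> on increasing open sets, so by compactness one finite partial sum does
  so everywhere, and \<open>I\<close> can be applied to it. This keeps the outer measure from being
  too small.\<close>

lemma outer_UNIV: "outer UNIV = ennreal (I (\<lambda>_. 1))"
proof (rule antisym)
  show "outer UNIV \<le> ennreal (I (\<lambda>_. 1))"
    by (rule outer_le_single) auto
  show "ennreal (I (\<lambda>_. 1)) \<le> outer UNIV"
    unfolding outer_def
  proof (intro INF_greatest)
    fix f assume f: "f \<in> covers UNIV"
    have f_cont [continuous_intros]: "continuous_on UNIV (f n)" and f_nn: "0 \<le> f n x"
      and f1: "1 \<le> (\<Sum>n. ennreal (f n x))" for n x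
      using f by (auto simp: covers_def)
    show "ennreal (I (\<lambda>_. 1)) \<le> (\<Sum>n. ennreal (I (f n)))"
    proof (rule ennreal_le_epsilon)
      fix e :: real assume e: "0 < e"
      \<comment> \<open>The loss \<open>d * I (\<lambda>_. 1)\<close> is then at most
        \<open>e\<close>; the 1 in the denominator covers the zero functional.\<close>
      define d where "d = e / (I (\<lambda>_. 1) + 1)"
      have I1: "0 \<le> I (\<lambda>_. 1)" by (rule nonneg) auto
      have d: "d > 0" "d * I (\<lambda>_. 1) \<le> e"
        using e I1 by (auto simp: d_def field_simps)
      define U where "U N = {x. 1 - d < (\<Sum>n<N. f n x)}" for N
      have "open (U N)" for N
        unfolding U_def by (intro open_Collect_less continuous_intros)
      moreover have "\<exists>N. x \<in> U N" for x
      proof -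
        have "ennreal (1 - d) < 1"
          using d by (simp add: ennreal_lessI flip: ennreal_1)
        also have "1 \<le> (SUP N. \<Sum>n<N. ennreal (f n x))"
          using f1[of x] by (simp add: suminf_eq_SUP)
        finally obtain N where "ennreal (1 - d) < (\<Sum>n<N. ennreal (f n x))"
          by (auto simp: less_SUP_iff)
        also have "\<dots> = ennreal (\<Sum>n<N. f n x)"
          using f_nn by (simp add: sum_ennreal)
        finally have "1 - d < (\<Sum>n<N. f n x)"
          by (meson ennreal_leI leD leI)
        then show ?thesis by (auto simp: U_def)
      qed
      ultimately obtain F where F: "finite F" "UNIV \<subseteq> (\<Union>N\<in>F. U N)"
        using compactE_image[OF compact_space, of UNIV U] by (metis UNIV_eq_I UN_I UNIV_I subset_UNIV order_refl)
      have "1 - d \<le> (\<Sum>n<Max F. f n x)" for x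
      proof -
        obtain N where N: "N \<in> F" "x \<in> U N" using F by auto
        then have "(\<Sum>n<N. f n x) \<le> (\<Sum>n<Max F. f n x)"
          using F f_nn by (intro sum_mono2) auto
        with N show ?thesis by (auto simp: U_def)
      qed
      then have "I (\<lambda>x. (1 - d) * 1) \<le> I (\<lambda>x. \<Sum>n<Max F. f n x)"
        by (intro mono continuous_intros) auto
      then have "(1 - d) * I (\<lambda>x. 1) \<le> (\<Sum>n<Max F. I (f n))"
        by (subst (asm) scale, simp, subst (asm) sum) (auto intro: continuous_intros)
      then have "I (\<lambda>_. 1) \<le> (\<Sum>n<Max F. I (f n)) + e"
        using d by (simp add: algebra_simps)
      then have "ennreal (I (\<lambda>_. 1)) \<le> ennreal ((\<Sum>n<Max F. I (f n)) + e)"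
        by (rule ennreal_leI)
      also have "\<dots> = (\<Sum>n<Max F. ennreal (I (f n))) + ennreal e"
        using e nonneg[OF f_cont f_nn] by (simp add: ennreal_plus sum_nonneg sum_ennreal)
      also have "\<dots> \<le> (\<Sum>n. ennreal (I (f n))) + ennreal e"
        by (intro add_mono sum_le_suminf) auto
      finally show "ennreal (I (\<lambda>_. 1)) \<le> (\<Sum>n. ennreal (I (f n))) + ennreal e" .
    qed
  qed
qed

lemma finite_riesz_measure: "finite_measure riesz_measure"
  by (rule finite_measureI) (simp add: emeasure_riesz_measure outer_UNIV)

lemma measure_riesz_measure_UNIV: "measure riesz_measure UNIV = I (\<lambda>_. 1)"
  using nonneg[of "\<lambda>_. 1"] by (simp add: measure_def emeasure_riesz_measure outer_UNIV)

lemma integrable_riesz_measure: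
  fixes f :: "'b \<Rightarrow> real"
  assumes "continuous_on UNIV f"
  shows "integrable riesz_measure f"
proof -
  interpret finite_measure riesz_measure by (rule finite_riesz_measure)
  obtain B where "\<And>x. norm (f x) \<le> B"
    using compact_imp_bounded[OF compact_continuous_image[OF assms compact_space]]
    by (auto simp: bounded_iff)
  then show ?thesis
    using borel_measurable_continuous_onI[OF assms]
    by (intro integrable_const_bound[where B=B]) (auto simp: measurable_cong_sets[OF sets_riesz_measure refl])
qed

text \<open>Cut \<open>f\<close> into horizontal slices of height \<open>1/n\<close>: the slice above level \<open>k/n\<close>, rescaled to
  height \<open>1\<close>, is a cover of the superlevel set \<open>{f \<ge> (k+1)/n}\<close>.\<close>

lemma integral_riesz_measure_le:
  assumes f: "continuous_on UNIV f" "\<And>x. 0 \<le> f x" "\<And>x. f x \<le> 1"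
  shows "(\<integral>x. f x \<partial>riesz_measure) \<le> I f"
proof (rule field_le_epsilon)
  fix e :: real assume "0 < e"
  interpret finite_measure riesz_measure by (rule finite_riesz_measure)
  define m where "m = measure riesz_measure UNIV"
  \<comment> \<open>The slicing costs the mass of one slice, \<open>m / n\<close>, which is to be at
    most \<open>e\<close>.\<close>
  obtain n :: nat where "max 0 (m / e) < real n"
    using reals_Archimedean2 by blast
  then have n: "m / e < real n" "n > 0" by auto
  define slice where "slice k x = min (1 / n) (max 0 (f x - k / n))" for k :: nat and x
  define E where "E k = {x. (Suc k) / n \<le> f x}" for k :: nat
  have slice_cont [continuous_intros]: "continuous_on UNIV (slice k)" for k
    unfolding slice_def by (intro continuous_intros f)
  have E: "closed (E k)" for k
    unfolding E_def by (intro closed_Collect_le continuous_intros f)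
  then have E_sets: "E k \<in> sets riesz_measure" for k by simp
  have part: "(\<Sum>k<j. slice k x) = min (f x) (j / n)" for x j
  proof (induction j)
    case 0 then show ?case using f(2)[of x] by simp
  next
    case (Suc j)
    have step: "real (Suc j) / n = j / n + 1 / n" by (simp add: add_divide_distrib)
    have aux: "min a b + min c (max 0 (a - b)) = min a (b + c)" if "0 \<le> c" for a b c :: real
      using that by (simp add: min_def max_def)
    from aux[of "1 / n" "f x" "j / n"] have slice: "min (f x) (j / n) + slice j x = min (f x) (j / n + 1 / n)"
      by (simp add: slice_def)
    show ?case by (simp only: sum.lessThan_Suc Suc.IH step slice)
  qed
  have slice_sum: "(\<Sum>k<n. slice k x) = f x" for x
    using n f(3)[of x] by (simp add: part)
  have "measure riesz_measure (E k) \<le> n * I (slice k)" for k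
  proof -
    have "emeasure riesz_measure (E k) \<le> ennreal (I (\<lambda>x. n * slice k x))"
      unfolding emeasure_riesz_measure[OF borel_closed[OF E]]
    proof (rule outer_le_single)
      fix x assume "x \<in> E k"
      then have "1 / n \<le> f x - k / n" by (simp add: E_def add_divide_distrib)
      then have "slice k x = 1 / n"
        unfolding slice_def using n by (metis divide_nonneg_nonneg max.absorb2 min.absorb1 of_nat_0_le_iff order_trans zero_le_one)
      then show "1 \<le> n * slice k x" using n by simp
    qed (auto intro!: continuous_intros f(1) simp: slice_def)
    moreover have "0 \<le> I (\<lambda>x. n * slice k x)"
      by (intro nonneg continuous_intros) (auto simp: slice_def)
    ultimately show ?thesis
      by (simp add: emeasure_eq_measure scale slice_cont)
  qed
  then have "(\<Sum>k<n. measure riesz_measure (E k)) \<le> (\<Sum>k<n. n * I (slice k))"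
    by (intro sum_mono)
  also have "\<dots> = n * I f"
    using slice_cont by (simp add: slice_sum flip: sum_distrib_left sum)
  finally have 1: "(\<Sum>k<n. measure riesz_measure (E k)) \<le> n * I f" .
  \<comment> \<open>The indices are shifted by one: slice \<open>Suc k\<close> vanishes off
    \<open>E k\<close>, while slice 0 is only bounded by \<open>1 / n\<close> and produces the error
    term.\<close>
  have "(\<integral>x. f x \<partial>riesz_measure) \<le> (\<integral>x. 1 / n + (\<Sum>k<n. 1 / n * indicator (E k) x) \<partial>riesz_measure)"
  proof (rule integral_mono)
    fix x
    have "slice (Suc k) x \<le> 1 / n * indicator (E k) x" for k
      by (auto simp: slice_def E_def indicator_def)
    then have "(\<Sum>k<n. slice (Suc k) x) \<le> (\<Sum>k<n. 1 / n * indicator (E k) x)"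
      by (intro sum_mono)
    moreover have "f x \<le> (\<Sum>k<Suc n. slice k x)"
      unfolding lessThan_Suc slice_sum[symmetric] by (simp add: slice_def)
    moreover have "(\<Sum>k<Suc n. slice k x) = slice 0 x + (\<Sum>k<n. slice (Suc k) x)"
      by (rule sum.lessThan_Suc_shift)
    moreover have "slice 0 x \<le> 1 / n" by (simp add: slice_def)
    ultimately show "f x \<le> 1 / n + (\<Sum>k<n. 1 / n * indicator (E k) x)" by linarith
  qed (use E_sets in \<open>auto intro!: integrable_riesz_measure f Bochner_Integration.integrable_add
        Bochner_Integration.integrable_sum integrable_mult_right simp: less_top[symmetric]\<close>)
  also have "\<dots> = m / n + (\<Sum>k<n. measure riesz_measure (E k)) / n"
  proof -
    have [simp]: "integrable riesz_measure (indicat_real (E k))" for k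
      using E_sets by (auto simp: less_top[symmetric])
    show ?thesis
      by (subst Bochner_Integration.integral_add) (simp_all add: m_def sum_divide_distrib)
  qed
  also have "\<dots> \<le> m / n + I f"
    using 1 n by (simp add: field_simps)
  also have "m / n \<le> e"
    using n \<open>0 < e\<close> by (simp add: field_simps)
  finally show "(\<integral>x. f x \<partial>riesz_measure) \<le> I f + e" by simp
qed

text \<open>For values in the unit interval the reverse inequality is
  \<open>integral_riesz_measure_le\<close> applied to \<open>1 - h\<close>, the total mass being
  \<open>I (\<lambda>_. 1)\<close>; a general continuous function is brought into that range by an
  affine change.\<close>

lemma integral_riesz_measure:
  assumes f: "continuous_on UNIV f"
  shows "(\<integral>x. f x \<partial>riesz_measure) = I f"
proof -
  interpret finite_measure riesz_measure by (rule finite_riesz_measure)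
  have unit: "(\<integral>x. h x \<partial>riesz_measure) = I h"
    if h: "continuous_on UNIV h" "\<And>x. 0 \<le> h x" "\<And>x. h x \<le> 1" for h
  proof (rule antisym)
    have "(\<integral>x. 1 - h x \<partial>riesz_measure) \<le> I (\<lambda>x. 1 - h x)"
      using h by (intro integral_riesz_measure_le continuous_intros) auto
    then show "I h \<le> (\<integral>x. h x \<partial>riesz_measure)"
      using h by (simp add: diff integrable_riesz_measure measure_riesz_measure_UNIV)
  qed (intro integral_riesz_measure_le h)
  obtain B where B: "\<And>x. norm (f x) \<le> B"
    using compact_imp_bounded[OF compact_continuous_image[OF f compact_space]]
    by (auto simp: bounded_iff)
  define C where "C = B + 1"
  have C: "C > 0" using B[of undefined] by (simp add: C_def add_nonneg_pos order_trans[OF norm_ge_zero])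
  define h where "h x = (1 / (2 * C)) * (f x + C)" for x
  have h: "continuous_on UNIV h"
    unfolding h_def by (intro continuous_intros f)
  have fh: "f = (\<lambda>x. (2 * C) * h x - C * 1)"
    using C by (auto simp: h_def)
  have "0 \<le> h x \<and> h x \<le> 1" for x
  proof -
    have "\<bar>f x\<bar> \<le> C" using B[of x] by (simp add: C_def)
    then have "0 \<le> f x + C" "f x + C \<le> 2 * C" by auto
    then show ?thesis using C by (simp add: h_def)
  qed
  then have "(\<integral>x. h x \<partial>riesz_measure) = I h"
    using h by (intro unit) auto
  moreover have "(\<integral>x. f x \<partial>riesz_measure) = 2 * C * (\<integral>x. h x \<partial>riesz_measure) - C * I (\<lambda>_. 1)"
    unfolding fh using h by (simp add: integrable_riesz_measure measure_riesz_measure_UNIV)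
  moreover have "I f = 2 * C * I h - C * I (\<lambda>_. 1)"
    unfolding fh using h scale[of "\<lambda>_. 1" C]
    by (subst diff) (auto simp: scale intro!: continuous_intros)
  ultimately show ?thesis by simp
qed

end

section \<open>Bounded continuous functions: Riesz theorem, uniqueness of measures,
  separability\<close>

lemma apply_bcontfun_Bcontfun:
  fixes f :: "'b::topological_space \<Rightarrow> 'c::metric_space"
  assumes "compact (UNIV :: 'b set)" "continuous_on UNIV f"
  shows "apply_bcontfun (Bcontfun f) = f"
  using assms by (intro Bcontfun_inverse) (auto simp: bcontfun_def intro!: compact_imp_bounded compact_continuous_image)

lemma abs_apply_bcontfun_le: "\<bar>apply_bcontfun f x\<bar> \<le> norm f" for f :: "'b::topological_space \<Rightarrow>\<^sub>C real"
  using norm_bounded[of f x] by simp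

lemma riesz_representation:
  fixes L :: "('b::metric_space \<Rightarrow>\<^sub>C real) \<Rightarrow> real"
  assumes compact: "compact (UNIV :: 'b set)"
    and lin: "linear L"
    and nonneg: "\<And>f. (\<And>x. 0 \<le> apply_bcontfun f x) \<Longrightarrow> 0 \<le> L f"
  obtains M where "finite_measure M" "sets M = sets borel"
    "\<And>f. (\<integral>x. apply_bcontfun f x \<partial>M) = L f"
proof -
  note app = apply_bcontfun_Bcontfun[OF compact]
  interpret positive_functional "\<lambda>f. L (Bcontfun f)"
  proof
    fix f g :: "'b \<Rightarrow> real" and c :: real
    assume f: "continuous_on UNIV f"
    show "L (Bcontfun (\<lambda>x. c * f x)) = c * L (Bcontfun f)"
      unfolding linear_scale[OF lin, symmetric, unfolded real_scaleR_def]
      by (rule arg_cong[of _ _ L], rule bcontfun_eqI) (use f in \<open>simp add: app continuous_intros\<close>)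
    show "0 \<le> L (Bcontfun f)" if "\<And>x. 0 \<le> f x"
      using that by (intro nonneg) (simp add: app f)
    assume g: "continuous_on UNIV g"
    show "L (Bcontfun (\<lambda>x. f x + g x)) = L (Bcontfun f) + L (Bcontfun g)"
      unfolding linear_add[OF lin, symmetric]
      by (rule arg_cong[of _ _ L], rule bcontfun_eqI) (use f g in \<open>simp add: app continuous_intros\<close>)
  qed (fact compact)
  show ?thesis
    by (rule that[of riesz_measure])
      (simp_all add: finite_riesz_measure integral_riesz_measure apply_bcontfun_inverse)
qed

lemma indicator_closed_limit:
  fixes K :: "'b::metric_space set"
  assumes "closed K"
  obtains g :: "nat \<Rightarrow> 'b \<Rightarrow> real"
  where "\<And>n. continuous_on UNIV (g n)" "\<And>n x. 0 \<le> g n x" "\<And>n x. g n x \<le> 1"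
    "\<And>x. (\<lambda>n. g n x) \<longlonglongrightarrow> indicator K x"
proof (cases "K = {}")
  case True
  then show ?thesis by (intro that[of "\<lambda>_ _. 0"]) auto
next
  case False
  define g where "g n x = max 0 (1 - real n * infdist x K)" for n x
  have "(\<lambda>n. g n x) \<longlonglongrightarrow> indicator K x" for x
  proof (cases "x \<in> K")
    case True then show ?thesis by (simp add: g_def)
  next
    case x: False
    then have pos: "infdist x K > 0"
      using False assms by (simp add: infdist_pos_not_in_closed)
    then obtain N where N: "1 < real N * infdist x K"
      using reals_Archimedean3 by blast
    have "g n x = 0" if "n \<ge> N" for n
    proof -
      have "real N * infdist x K \<le> real n * infdist x K"
        using pos that by (intro mult_right_mono) auto
      with N show ?thesis by (simp add: g_def)
    qed
    then have "\<forall>\<^sub>F n in sequentially. g n x = 0"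
      by (auto simp: eventually_sequentially)
    then show ?thesis using x by (simp add: tendsto_eventually)
  qed
  then show ?thesis
    by (intro that[of g]) (auto simp: g_def infdist_nonneg intro!: continuous_intros)
qed

lemma borel_measurable_continuous_on_UNIV:
  "sets M = sets borel \<Longrightarrow> continuous_on UNIV f \<Longrightarrow> f \<in> borel_measurable M"
  using borel_measurable_continuous_onI measurable_cong_sets by blast

lemma integral_indicator_closed_limit:
  fixes g :: "nat \<Rightarrow> 'b::metric_space \<Rightarrow> real"
  assumes "finite_measure M" and M: "sets M = sets borel" and K: "closed K"
    and g: "\<And>n. continuous_on UNIV (g n)" "\<And>n x. 0 \<le> g n x" "\<And>n x. g n x \<le> 1"
    "\<And>x. (\<lambda>n. g n x) \<longlonglongrightarrow> indicator K x"
  shows "(\<lambda>n. \<integral>x. g n x \<partial>M) \<longlonglongrightarrow> measure M K"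
proof -
  interpret finite_measure M by fact
  have [measurable]: "K \<in> sets M" "g n \<in> borel_measurable M" for n
    using K M g(1) by (auto intro: borel_measurable_continuous_on_UNIV)
  have "(\<lambda>n. \<integral>x. g n x \<partial>M) \<longlonglongrightarrow> (\<integral>x. indicator K x \<partial>M)"
    using g by (intro integral_dominated_convergence[where w="\<lambda>_. 1"]) auto
  then show ?thesis
    using sets.sets_into_space[of K M] by (simp add: Int_absorb2)
qed

lemma Int_stable_closed: "Int_stable {K. closed K}"
  by (auto simp: Int_stable_def)

lemma sets_borel_sigma_closed: "sets borel = sigma_sets UNIV {K. closed K}"
  unfolding borel_eq_closed by (rule sets_measure_of) auto

text \<open>Indicators of closed sets are bounded pointwise limits of the test functions, and the
  closed sets form a generator stable under intersection. Test functions with values in the unit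
  interval come with a bound that later applications need.\<close>

lemma measure_eqI_continuous:
  fixes M N :: "'b::metric_space measure"
  assumes "finite_measure M" "finite_measure N"
    and M: "sets M = sets borel" and N: "sets N = sets borel"
    and eq: "\<And>f :: 'b \<Rightarrow> real. continuous_on UNIV f \<Longrightarrow> (\<And>x. 0 \<le> f x) \<Longrightarrow> (\<And>x. f x \<le> 1) \<Longrightarrow>
      (\<integral>x. f x \<partial>M) = (\<integral>x. f x \<partial>N)"
  shows "M = N"
proof (rule measure_eqI_generator_eq[OF Int_stable_closed, where \<Omega>=UNIV and A="\<lambda>_. UNIV"])
  interpret M: finite_measure M by fact
  interpret N: finite_measure N by fact
  fix K :: "'b set" assume "K \<in> {K. closed K}"
  then have K: "closed K" by simp
  obtain g :: "nat \<Rightarrow> 'b \<Rightarrow> real"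
    where g: "\<And>n. continuous_on UNIV (g n)" "\<And>n x. 0 \<le> g n x" "\<And>n x. g n x \<le> 1"
    "\<And>x. (\<lambda>n. g n x) \<longlonglongrightarrow> indicator K x"
    using indicator_closed_limit[OF K] by metis
  have "(\<lambda>n. \<integral>x. g n x \<partial>M) \<longlonglongrightarrow> measure M K"
    by (rule integral_indicator_closed_limit) (use K g M assms(1) in auto)
  moreover have "(\<lambda>n. \<integral>x. g n x \<partial>M) \<longlonglongrightarrow> measure N K"
    unfolding eq[OF g(1-3)]
    by (rule integral_indicator_closed_limit) (use K g N assms(2) in auto)
  ultimately have "measure M K = measure N K" by (rule LIMSEQ_unique)
  then show "emeasure M K = emeasure N K"
    by (simp add: M.emeasure_eq_measure N.emeasure_eq_measure)
next
  show "emeasure M UNIV \<noteq> \<infinity>" for i :: nat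
    using finite_measure.emeasure_finite[OF assms(1)] by simp
qed (use M N in \<open>auto simp: sets_borel_sigma_closed\<close>)

lemma compact_UNIV_net:
  fixes e :: real
  assumes "compact (UNIV :: 'b::metric_space set)" "0 < e"
  obtains F :: "'b::metric_space set" where "finite F" "\<And>x. \<exists>c\<in>F. dist c x < e"
proof -
  have "\<exists>T\<subseteq>UNIV. finite T \<and> (UNIV :: 'b set) \<subseteq> (\<Union>c\<in>T. ball c e)"
    by (rule compactE_image[OF assms(1), of UNIV "\<lambda>c. ball c e"]) (use assms(2) in auto)
  then obtain T :: "'b set" where T: "finite T" "UNIV \<subseteq> (\<Union>c\<in>T. ball c e)" by auto
  show ?thesis
    by (rule that[OF T(1)]) (use T(2) in fastforce)
qed

text \<open>For every prescription of rational values on a net, up to a rational error, pick one function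
  of \<open>T\<close> that meets it, if there is any.\<close>

lemma countable_dense_subset_bcontfun:
  fixes T :: "('b::metric_space \<Rightarrow>\<^sub>C real) set"
  assumes compact: "compact (UNIV :: 'b set)"
  obtains D where "countable D" "D \<subseteq> T" "\<And>f e. f \<in> T \<Longrightarrow> 0 < e \<Longrightarrow> \<exists>d\<in>D. dist f d < e"
proof -
  \<comment> \<open>The net is a list, so that a prescription of values is a list of rationals and
    the triples below range over a countable type.\<close>
  have "\<exists>xs :: 'b list. \<forall>x. \<exists>i<length xs. dist (xs ! i) x < 1 / Suc n" for n
  proof -
    obtain F :: "'b set" where F: "finite F" "\<And>x. \<exists>c\<in>F. dist c x < 1 / Suc n"
      using compact_UNIV_net[OF compact, of "1 / Suc n"] by auto
    then obtain xs where "set xs = F" using finite_list by blast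
    with F(2) show ?thesis by (intro exI[of _ xs]) (metis in_set_conv_nth)
  qed
  then obtain xs :: "nat \<Rightarrow> 'b list"
    where xs: "\<And>n x. \<exists>i<length (xs n). dist (xs n ! i) x < 1 / Suc n" by metis
  define P where "P n m q f \<longleftrightarrow> (\<forall>i<length (xs n). \<forall>x. dist (xs n ! i) x < 1 / Suc n \<longrightarrow>
    \<bar>apply_bcontfun f x - of_rat (q ! i)\<bar> < 1 / Suc m)" for n m and q :: "rat list" and f :: "'b \<Rightarrow>\<^sub>C real"
  define h where "h = (\<lambda>(n, m, q). SOME f. f \<in> T \<and> P n m q f)"
  define D where "D = h ` {(n, m, q). \<exists>f\<in>T. P n m q f}"
  have h: "h (n, m, q) \<in> T \<and> P n m q (h (n, m, q))" if "f \<in> T" "P n m q f" for n m q f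
    unfolding h_def prod.case by (rule someI[of _ f]) (use that in auto)
  show ?thesis
  proof (rule that[of D])
    show "countable D" unfolding D_def by auto
    show "D \<subseteq> T" using h by (auto simp: D_def)
    fix f :: "'b \<Rightarrow>\<^sub>C real" and e :: real assume f: "f \<in> T" and e: "0 < e"
    \<comment> \<open>Half of the tolerance \<open>1 / Suc m\<close> goes to the oscillation of
      \<open>f\<close> between a point and the net, half to rounding to a rational. Then
      \<open>f\<close> and the chosen \<open>g\<close> are both within \<open>1 / Suc m\<close> of
      the same rational near every point.\<close>
    obtain m where m: "1 / Suc m < e / 2" using e nat_approx_posE[of "e / 2"] by auto
    have "uniformly_continuous_on UNIV (apply_bcontfun f)"
      by (rule compact_uniformly_continuous) (auto simp: compact)
    then obtain d where d: "d > 0"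
      "\<And>x x'. dist x' x < d \<Longrightarrow> dist (apply_bcontfun f x') (apply_bcontfun f x) < 1 / (2 * Suc m)"
      unfolding uniformly_continuous_on_def
      by (elim allE[of _ "1 / real (2 * Suc m)"]) auto
    obtain n where n: "1 / Suc n < d" using nat_approx_posE[OF d(1)] by auto
    have "\<exists>r. \<bar>y - of_rat r\<bar> < 1 / (2 * Suc m)" for y :: real
    proof -
      have "y - 1 / (2 * Suc m) < y + 1 / (2 * Suc m)" by simp
      from Rats_dense_in_real[OF this] obtain r where
        "y - 1 / (2 * Suc m) < of_rat r" "of_rat r < y + 1 / (2 * Suc m)"
        by (auto simp: Rats_def)
      then show ?thesis by (intro exI[of _ r]) (simp only: abs_less_iff, linarith)
    qed
    then obtain r where r: "\<And>y. \<bar>y - of_rat (r y)\<bar> < 1 / (2 * Suc m)" by metis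
    define q where "q = map (\<lambda>x. r (apply_bcontfun f x)) (xs n)"
    have P: "P n m q f"
      unfolding P_def
    proof safe
      fix i x assume i: "i < length (xs n)" and "dist (xs n ! i) x < 1 / Suc n"
      then have "dist (apply_bcontfun f (xs n ! i)) (apply_bcontfun f x) < 1 / (2 * Suc m)"
        using n by (intro d(2)) auto
      moreover have "\<bar>apply_bcontfun f (xs n ! i) - of_rat (q ! i)\<bar> < 1 / (2 * Suc m)"
        using i r by (simp add: q_def)
      moreover have "\<bar>apply_bcontfun f x - of_rat (q ! i)\<bar> \<le>
          dist (apply_bcontfun f (xs n ! i)) (apply_bcontfun f x) + \<bar>apply_bcontfun f (xs n ! i) - of_rat (q ! i)\<bar>"
        unfolding dist_real_def by linarith
      ultimately have "\<bar>apply_bcontfun f x - of_rat (q ! i)\<bar> < 1 / (2 * Suc m) + 1 / (2 * Suc m)"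
        by linarith
      also have "\<dots> = 1 / Suc m" by (simp add: field_simps)
      finally show "\<bar>apply_bcontfun f x - of_rat (q ! i)\<bar> < 1 / Suc m" .
    qed
    define g where "g = h (n, m, q)"
    have g: "P n m q g" "g \<in> D"
      using h[OF f P] P f by (auto simp: g_def D_def)
    have "dist f g \<le> 1 / Suc m + 1 / Suc m"
    proof (rule dist_bound)
      fix x
      obtain i where i: "i < length (xs n)" "dist (xs n ! i) x < 1 / Suc n" using xs by blast
      have "\<bar>apply_bcontfun f x - of_rat (q ! i)\<bar> < 1 / Suc m"
        using P i unfolding P_def by blast
      moreover have "\<bar>apply_bcontfun g x - of_rat (q ! i)\<bar> < 1 / Suc m"
        using g(1) i unfolding P_def by blast
      ultimately show "dist (apply_bcontfun f x) (apply_bcontfun g x) \<le> 1 / Suc m + 1 / Suc m"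
        unfolding dist_real_def by linarith
    qed
    also have "\<dots> < e" using m by simp
    finally show "\<exists>d\<in>D. dist f d < e" using g(2) by blast
  qed
qed

section \<open>A Hahn-Banach theorem\<close>

text \<open>Positive homogeneity is asked for as an inequality only; applying it also to the inverse
  factor gives equality and the value 0 at 0, as \<open>sublinearD\<close> records.\<close>

definition sublinear :: "('v::real_vector \<Rightarrow> real) \<Rightarrow> bool" where
  "sublinear p \<longleftrightarrow> (\<forall>x y. p (x + y) \<le> p x + p y) \<and> (\<forall>r>0. \<forall>x. p (r *\<^sub>R x) \<le> r * p x)"

lemma sublinearD:
  assumes "sublinear p"
  shows "p (x + y) \<le> p x + p y" and "0 \<le> r \<Longrightarrow> p (r *\<^sub>R x) = r * p x" and "p 0 = 0"
    and "- p (- x) \<le> p x"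
proof -
  show add: "p (x + y) \<le> p x + p y" for x y using assms by (simp add: sublinear_def)
  have le: "r > 0 \<Longrightarrow> p (r *\<^sub>R x) \<le> r * p x" for r x using assms by (simp add: sublinear_def)
  show zero: "p 0 = 0" using le[of 2 0] le[of "1/2" 0] by simp
  show "p (r *\<^sub>R x) = r * p x" if "0 \<le> r"
  proof (cases "r = 0")
    case False
    then have "r > 0" using that by simp
    with le[of r x] le[of "1 / r" "r *\<^sub>R x"] show ?thesis by (simp add: field_simps)
  qed (simp add: zero)
  show "- p (- x) \<le> p x" using add[of x "- x"] zero by simp
qed

text \<open>The standard device for lowering \<open>p\<close> in one direction: a minimal sublinear
  functional must coincide with its own shift, and the last inequality then reads
  \<open>p x + p y \<le> p (x + y)\<close>. Subadditivity bounds the expression from below by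
  \<open>- p (- x)\<close>, so the infimum is a genuine one.\<close>

lemma sublinear_shift:
  assumes p: "sublinear p"
  defines "p' \<equiv> \<lambda>y x. INF t\<in>{0..}. p (x + t *\<^sub>R y) - t * p y"
  shows "sublinear (p' y)" "p' y x \<le> p x" "p' y x \<le> p (x + y) - p y"
proof -
  note pD = sublinearD[OF p]
  have p'_eq: "p' y x = (INF t\<in>{0..}. p (x + t *\<^sub>R y) - t * p y)" for x
    by (simp add: p'_def)
  have bdd: "bdd_below ((\<lambda>t. p (x + t *\<^sub>R y) - t * p y) ` {0..})" for x
  proof (rule bdd_belowI2)
    fix t :: real assume "t \<in> {0..}"
    then show "- p (- x) \<le> p (x + t *\<^sub>R y) - t * p y"
      using pD(1)[of "x + t *\<^sub>R y" "- x"] pD(2)[of t y] by simp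
  qed
  have le: "p' y x \<le> p (x + t *\<^sub>R y) - t * p y" if "0 \<le> t" for x t
    unfolding p'_def using that by (intro cINF_lower bdd) auto
  show "p' y x \<le> p x" "p' y x \<le> p (x + y) - p y" using le[of 0 x] le[of 1 x] by simp_all
  have "p' y (x + x') \<le> p' y x + p' y x'" for x x'
  proof -
    have *: "p' y (x + x') - (p (x + t *\<^sub>R y) - t * p y) \<le> p (x' + t' *\<^sub>R y) - t' * p y"
      if "0 \<le> t" "0 \<le> t'" for t t'
      using le[of "t + t'" "x + x'"] pD(1)[of "x + t *\<^sub>R y" "x' + t' *\<^sub>R y"] that
      by (simp add: algebra_simps)
    then have "p' y (x + x') - (p (x + t *\<^sub>R y) - t * p y) \<le> p' y x'" if "0 \<le> t" for t
      unfolding p'_eq[of x'] using that by (intro cINF_greatest) auto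
    then have "p' y (x + x') - p' y x' \<le> p' y x"
      unfolding p'_eq[of x] by (intro cINF_greatest) (auto simp: algebra_simps)
    then show ?thesis by simp
  qed
  moreover have "p' y (r *\<^sub>R x) \<le> r * p' y x" if r: "r > 0" for r x
  proof -
    have "p' y (r *\<^sub>R x) / r \<le> p (x + t *\<^sub>R y) - t * p y" if "0 \<le> t" for t
      using le[of "r * t" "r *\<^sub>R x"] pD(2)[of r "x + t *\<^sub>R y"] that r
      by (simp add: field_simps scaleR_add_right)
    then have "p' y (r *\<^sub>R x) / r \<le> p' y x"
      unfolding p'_eq[of x] by (intro cINF_greatest) auto
    with r show ?thesis by (simp add: field_simps)
  qed
  ultimately show "sublinear (p' y)" by (simp add: sublinear_def)
qed

text \<open>Supplies the bounds for Zorn's lemma. In a chain the smaller of two members can replace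
  both, which makes the pointwise infimum subadditive; the common majorant \<open>q\<close> gives
  the lower bound \<open>- q (- x)\<close>.\<close>

lemma sublinear_chain_INF:
  assumes C: "C \<noteq> {}" "\<And>p. p \<in> C \<Longrightarrow> sublinear p" "\<And>p x. p \<in> C \<Longrightarrow> p x \<le> q x"
    and chain: "\<And>p p'. p \<in> C \<Longrightarrow> p' \<in> C \<Longrightarrow> p \<le> p' \<or> p' \<le> p"
  shows "sublinear (\<lambda>x. INF p\<in>C. p x)" "p \<in> C \<Longrightarrow> (INF p\<in>C. p x) \<le> p x"
proof -
  let ?u = "\<lambda>x. INF p\<in>C. p x"
  have bdd: "bdd_below ((\<lambda>p. p x) ` C)" for x
  proof (rule bdd_belowI2)
    fix p assume p: "p \<in> C"
    show "- q (- x) \<le> p x"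
      using sublinearD(4)[OF C(2)[OF p], of x] C(3)[OF p, of "- x"] by linarith
  qed
  show le: "p \<in> C \<Longrightarrow> ?u x \<le> p x" for p x
    by (intro cINF_lower bdd)
  have "?u (x + y) \<le> ?u x + ?u y" for x y
  proof -
    have "?u (x + y) - p x \<le> p' y" if p: "p \<in> C" "p' \<in> C" for p p'
    proof -
      have "\<exists>p0\<in>C. p0 x \<le> p x \<and> p0 y \<le> p' y"
        using chain[OF p] p by (auto simp: le_fun_def)
      then obtain p0 where "p0 \<in> C" "p0 x \<le> p x" "p0 y \<le> p' y" by blast
      with le[of p0 "x + y"] sublinearD(1)[OF C(2), of p0 x y] show ?thesis by simp
    qed
    then have "?u (x + y) - p x \<le> ?u y" if "p \<in> C" for p
      using that C(1) by (intro cINF_greatest) auto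
    then have "?u (x + y) - ?u y \<le> ?u x"
      using C(1) by (intro cINF_greatest) (auto simp: algebra_simps)
    then show ?thesis by simp
  qed
  moreover have "?u (r *\<^sub>R x) \<le> r * ?u x" if r: "r > 0" for r x
  proof -
    have "?u (r *\<^sub>R x) / r \<le> p x" if "p \<in> C" for p
      using le[OF that, of "r *\<^sub>R x"] sublinearD(2)[OF C(2)[OF that], of r x] r by (simp add: field_simps)
    then have "?u (r *\<^sub>R x) / r \<le> ?u x" using C(1) by (intro cINF_greatest) auto
    with r show ?thesis by (simp add: field_simps)
  qed
  ultimately show "sublinear ?u" by (simp add: sublinear_def)
qed

text \<open>By Zorn's lemma there is a minimal sublinear functional below \<open>q\<close>; minimality against
  the shifts of \<open>sublinear_shift\<close> makes it additive.\<close>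

lemma hahn_banach_sublinear:
  fixes q :: "'v::real_vector \<Rightarrow> real"
  assumes q: "sublinear q"
  obtains L where "linear L" "\<And>x. L x \<le> q x"
proof -
  define A where "A = {p. sublinear p \<and> (\<forall>x. p x \<le> q x)}"
  \<comment> \<open>The order is reversed because the maximal elements delivered by
    \<open>predicate_Zorn\<close> are to be minimal functionals.\<close>
  define P :: "('v \<Rightarrow> real) \<Rightarrow> ('v \<Rightarrow> real) \<Rightarrow> bool" where "P p p' \<longleftrightarrow> p' \<le> p" for p p'
  have "\<exists>m\<in>A. \<forall>a\<in>A. P m a \<longrightarrow> a = m"
  proof (rule predicate_Zorn)
    show "partial_order_on A (relation_of P A)"
      by (rule partial_order_on_relation_ofI) (auto simp: P_def)
    fix C assume "C \<in> Chains (relation_of P A)"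
    then have C: "\<And>p p'. p \<in> C \<Longrightarrow> p' \<in> C \<Longrightarrow> p \<le> p' \<or> p' \<le> p" and CA: "C \<subseteq> A"
      by (auto simp: Chains_def relation_of_def P_def)
    show "\<exists>u\<in>A. \<forall>a\<in>C. P a u"
    proof (cases "C = {}")
      case True then show ?thesis using q by (auto simp: A_def)
    next
      case False
      note u = sublinear_chain_INF[OF False, of q, OF _ _ C]
      have "sublinear (\<lambda>x. INF p\<in>C. p x)" by (rule u(1)) (use CA in \<open>auto simp: A_def\<close>)
      moreover have le: "(INF p\<in>C. p x) \<le> p x" if "p \<in> C" for p x
        by (rule u(2)) (use CA that in \<open>auto simp: A_def\<close>)
      moreover have "(INF p\<in>C. p x) \<le> q x" for x
      proof -
        obtain p where p: "p \<in> C" using False by blast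
        with CA have "p x \<le> q x" by (auto simp: A_def)
        with le[OF p] show ?thesis by (rule order_trans)
      qed
      ultimately show ?thesis
        by (intro bexI[of _ "\<lambda>x. INF p\<in>C. p x"]) (auto simp: A_def P_def le_fun_def)
    qed
  qed
  then obtain p where pA: "p \<in> A" and minA: "\<forall>a\<in>A. P p a \<longrightarrow> a = p" by blast
  have p: "sublinear p" "\<And>x. p x \<le> q x" using pA by (auto simp: A_def)
  have min: "p' = p" if "sublinear p'" "\<And>x. p' x \<le> p x" for p'
    using minA that order_trans[OF that(2) p(2)] by (auto simp: A_def P_def le_fun_def)
  have add: "p (x + y) = p x + p y" for x y
  proof (rule antisym)
    have "(\<lambda>x. INF t\<in>{0..}. p (x + t *\<^sub>R y) - t * p y) = p"
      by (rule min) (rule sublinear_shift[OF p(1)])+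
    from fun_cong[OF this, of x] have "p x \<le> p (x + y) - p y"
      using sublinear_shift(3)[OF p(1), where x=x and y=y] by simp
    then show "p x + p y \<le> p (x + y)" by simp
  qed (rule sublinearD[OF p(1)])
  have "linear p"
  proof (rule linearI)
    fix r x
    have neg: "p (- x) = - p x" for x using add[of x "- x"] sublinearD(3)[OF p(1)] by simp
    show "p (r *\<^sub>R x) = r *\<^sub>R p x"
    proof (cases "0 \<le> r")
      case True then show ?thesis using sublinearD(2)[OF p(1)] by simp
    next
      case False
      then have "p ((- r) *\<^sub>R x) = - r * p x" using sublinearD(2)[OF p(1), of "- r" x] by simp
      then show ?thesis using neg[of "r *\<^sub>R x"] by simp
    qed
  qed (fact add)
  with p(2) that show ?thesis by blast
qed

section \<open>Conditional densities\<close>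

lemma integrable_bcontfun:
  fixes f :: "'b::topological_space \<Rightarrow>\<^sub>C 'c::{banach, second_countable_topology}"
  assumes "finite_measure M" "sets M = sets borel"
  shows "integrable M (apply_bcontfun f)"
proof -
  interpret finite_measure M by fact
  show ?thesis
    using assms(2) norm_bounded[of f]
    by (intro integrable_const_bound[where B="norm f"] borel_measurable_continuous_on_UNIV) auto
qed

lemma integrable_mult_bcontfun:
  fixes u :: "'b::topological_space \<Rightarrow> real"
  assumes M: "finite_measure M" "sets M = sets borel"
    and u: "u \<in> borel_measurable M" "\<And>x. \<bar>u x\<bar> \<le> K"
  shows "integrable M (\<lambda>x. u x * apply_bcontfun f x)"
proof -
  interpret finite_measure M by fact
  have "norm (u x * apply_bcontfun f x) \<le> K * norm f" for x
    unfolding norm_mult using u(2)[of x] abs_apply_bcontfun_le[of f x]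
    by (intro mult_mono) auto
  then show ?thesis
    using M(2) u(1)
    by (intro integrable_const_bound[where B="K * norm f"] borel_measurable_times)
       (auto intro: borel_measurable_continuous_on_UNIV)
qed

lemma continuous_on_Max_image:
  fixes f :: "'i \<Rightarrow> 'b::topological_space \<Rightarrow> real"
  assumes "finite F" "F \<noteq> {}" "\<And>i. i \<in> F \<Longrightarrow> continuous_on T (f i)"
  shows "continuous_on T (\<lambda>x. Max ((\<lambda>i. f i x) ` F))"
  using assms
  by (induction F rule: finite_ne_induct) (auto intro!: continuous_intros)

text \<open>The hypothesis is tested on the set where \<open>h\<close> exceeds \<open>C\<close>:
  there the nonnegative excess has integral at most 0. This turns identities and bounds under the
  coupling into almost sure statements about densities.\<close>

lemma AE_le_of_set_integral_le:
  fixes h :: "'b \<Rightarrow> real"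
  assumes "finite_measure M" and h: "integrable M h"
    and le: "\<And>A. A \<in> sets M \<Longrightarrow> (\<integral>x. indicator A x * h x \<partial>M) \<le> C * measure M A"
  shows "AE x in M. h x \<le> C"
proof -
  interpret finite_measure M by fact
  define A where "A = {x \<in> space M. C < h x}"
  have [measurable]: "h \<in> borel_measurable M" using h by auto
  have A [measurable]: "A \<in> sets M" unfolding A_def by measurable
  have ih: "integrable M (\<lambda>x. indicator A x * h x)" "integrable M (\<lambda>x. indicator A x * C)"
    using integrable_real_mult_indicator[OF A h] integrable_real_mult_indicator[OF A, of "\<lambda>_. C"]
    by (simp_all add: mult.commute)
  have nn: "AE x in M. 0 \<le> indicator A x * h x - indicator A x * C"
    by (auto simp: A_def indicator_def)
  have "(\<integral>x. indicator A x * h x - indicator A x * C \<partial>M) \<le> 0"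
    using le[OF A] ih A by (simp add: mult.commute Int_absorb2 sets.sets_into_space)
  moreover have "0 \<le> (\<integral>x. indicator A x * h x - indicator A x * C \<partial>M)"
    by (rule integral_nonneg_AE[OF nn])
  ultimately have "(\<integral>x. indicator A x * h x - indicator A x * C \<partial>M) = 0" by simp
  then have "AE x in M. indicator A x * h x - indicator A x * C = 0"
    using integral_nonneg_eq_0_iff_AE[OF _ nn] ih by simp
  then show ?thesis
    using AE_space by eventually_elim (auto simp: A_def indicator_def split: if_splits)
qed

text \<open>For a nonnegative weight, its density with respect to the image of \<open>N\<close>
  under \<open>T\<close> is the conditional expectation of \<open>w\<close> given \<open>T\<close>,
  viewed as a function on the target.\<close>

definition weighted_image :: "'c::metric_space measure \<Rightarrow> ('c \<Rightarrow> 'b::metric_space) \<Rightarrow> ('c \<Rightarrow> real) \<Rightarrow> 'b measure" where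
  "weighted_image N T w = distr (density N (\<lambda>y. ennreal (w y))) borel T"

lemma sets_weighted_image [simp]: "sets (weighted_image N T w) = sets borel"
  by (simp add: weighted_image_def)

context
  fixes N :: "'c::metric_space measure" and T :: "'c \<Rightarrow> 'b::metric_space" and w :: "'c \<Rightarrow>\<^sub>C real"
  assumes N: "finite_measure N" "sets N = sets borel" and T: "continuous_on UNIV T"
    and w: "\<And>y. 0 \<le> apply_bcontfun w y"
begin

lemma measurable_T [measurable]: "T \<in> borel_measurable N"
  and measurable_w [measurable]: "apply_bcontfun w \<in> borel_measurable N"
  using N T by (auto intro: borel_measurable_continuous_on_UNIV)

lemma integral_weighted_image:
  fixes u :: "'b \<Rightarrow> real"
  assumes [measurable]: "u \<in> borel_measurable borel"
  shows "(\<integral>x. u x \<partial>weighted_image N T w) = (\<integral>y. u (T y) * apply_bcontfun w y \<partial>N)"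
  unfolding weighted_image_def
  by (subst integral_distr, simp, simp, subst integral_density) (use w in \<open>auto simp: mult.commute\<close>)

lemma finite_weighted_image: "finite_measure (weighted_image N T w)"
proof (rule finite_measureI)
  have "emeasure (weighted_image N T w) UNIV = (\<integral>\<^sup>+y. ennreal (apply_bcontfun w y) \<partial>N)"
    unfolding weighted_image_def
    by (subst emeasure_distr, simp, simp, subst emeasure_density)
       (auto intro!: nn_integral_cong simp: indicator_def)
  also have "\<dots> = ennreal (\<integral>y. apply_bcontfun w y \<partial>N)"
    using w N by (intro nn_integral_eq_integral integrable_bcontfun) auto
  finally show "emeasure (weighted_image N T w) (space (weighted_image N T w)) \<noteq> \<infinity>"
    by (simp add: weighted_image_def)
qed

lemma weighted_image_absolutely_continuous:
  "absolutely_continuous (distr N borel T) (weighted_image N T w)"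
  unfolding absolutely_continuous_def
proof
  fix A assume "A \<in> null_sets (distr N borel T)"
  then have A [measurable]: "A \<in> sets borel" and "emeasure N (T -` A \<inter> space N) = 0"
    by (auto simp: null_sets_def emeasure_distr)
  then have "T -` A \<inter> space N \<in> null_sets N" by (auto simp: null_sets_def)
  then have "emeasure (density N (\<lambda>y. ennreal (apply_bcontfun w y))) (T -` A \<inter> space N) = 0"
    by (metis absolutely_continuousI_density absolutely_continuous_def measurable_compose[OF measurable_w measurable_ennreal] null_setsD1 subsetD)
  then show "A \<in> null_sets (weighted_image N T w)"
    by (auto simp: null_sets_def weighted_image_def emeasure_distr)
qed

end

text \<open>Radon-Nikodym derivatives are taken of positive measures, so \<open>g\<close> is raised
  by its norm first and the constant is subtracted from the derivative afterwards.\<close>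

lemma conditional_density:
  fixes N :: "'c::metric_space measure" and T :: "'c \<Rightarrow> 'b::metric_space" and g :: "'c \<Rightarrow>\<^sub>C real"
  assumes N: "finite_measure N" "sets N = sets borel" and T: "continuous_on UNIV T"
  obtains k where "integrable (distr N borel T) k" "k \<in> borel_measurable borel"
    "\<And>A. A \<in> sets borel \<Longrightarrow>
      (\<integral>x. indicator A x * k x \<partial>distr N borel T) = (\<integral>y. indicator A (T y) * apply_bcontfun g y \<partial>N)"
proof -
  define w where "w = g + const_bcontfun (norm g)"
  have app: "apply_bcontfun w y = apply_bcontfun g y + norm g" for y
    by (simp add: w_def const_bcontfun.rep_eq)
  have w: "0 \<le> apply_bcontfun w y" for y
    using abs_apply_bcontfun_le[of g y] by (simp add: app abs_le_iff)
  let ?M = "distr N borel T"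
  let ?W = "weighted_image N T w"
  have T_meas [measurable]: "T \<in> borel_measurable N"
    using N T by (auto intro: borel_measurable_continuous_on_UNIV)
  interpret N: finite_measure N by fact
  interpret M: finite_measure ?M by (rule N.finite_measure_distr) simp
  interpret W: finite_measure ?W by (rule finite_weighted_image[OF N T w])
  have ac: "absolutely_continuous ?M ?W" by (rule weighted_image_absolutely_continuous[OF N T w])
  define k0 where "k0 x = enn2real (RN_deriv ?M ?W x)" for x
  have k0 [measurable]: "k0 \<in> borel_measurable borel"
    unfolding k0_def using borel_measurable_RN_deriv[of ?M ?W] by simp
  have sets: "sets ?W = sets ?M" by simp
  have k0_int: "integrable ?M k0"
    using M.RN_deriv_integrable[OF W.sigma_finite_measure_axioms ac sets, of "\<lambda>_. 1"]
    by (simp add: k0_def[abs_def])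
  show ?thesis
  proof (rule that[of "\<lambda>x. k0 x - norm g"])
    show "integrable ?M (\<lambda>x. k0 x - norm g)" using k0_int by simp
    fix A :: "'b set" assume A [measurable]: "A \<in> sets borel"
    have A': "A \<in> sets ?M" by simp
    have g_int: "integrable N (\<lambda>y. indicator A (T y) * apply_bcontfun g y)"
      and i_int: "integrable N (\<lambda>y. indicator A (T y) * norm g)"
    proof -
      show "integrable N (\<lambda>y. indicator A (T y) * apply_bcontfun g y)"
        by (rule integrable_mult_bcontfun[OF N, where K=1]) (auto simp: indicator_def)
      show "integrable N (\<lambda>y. indicator A (T y) * norm g)"
        by (rule N.integrable_const_bound[where B="norm g"]) (auto simp: indicator_def)
    qed
    have "(\<integral>x. indicator A x * (k0 x - norm g) \<partial>?M)
      = (\<integral>x. k0 x * indicator A x \<partial>?M) - (\<integral>x. indicator A x * norm g \<partial>?M)"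
      unfolding right_diff_distrib
      using integrable_real_mult_indicator[OF A' k0_int] integrable_real_mult_indicator[OF A', of "\<lambda>_. norm g"]
      by (subst Bochner_Integration.integral_diff) (auto simp: mult.commute)
    also have "(\<integral>x. k0 x * indicator A x \<partial>?M) = (\<integral>x. indicator A x \<partial>?W)"
      unfolding k0_def by (rule M.RN_deriv_integral[OF W.sigma_finite_measure_axioms ac sets, symmetric]) simp
    also have "\<dots> = (\<integral>y. indicator A (T y) * apply_bcontfun w y \<partial>N)"
      by (rule integral_weighted_image[OF N T w]) simp
    also have "(\<integral>x. indicator A x * norm g \<partial>?M) = (\<integral>y. indicator A (T y) * norm g \<partial>N)"
      by (rule integral_distr) simp_all
    also have "(\<integral>y. indicator A (T y) * apply_bcontfun w y \<partial>N) - (\<integral>y. indicator A (T y) * norm g \<partial>N)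
      = (\<integral>y. indicator A (T y) * apply_bcontfun g y \<partial>N)"
      unfolding app distrib_left
      by (subst Bochner_Integration.integral_add) (use g_int i_int in auto)
    finally show "(\<integral>x. indicator A x * (k0 x - norm g) \<partial>?M) = (\<integral>y. indicator A (T y) * apply_bcontfun g y \<partial>N)" .
  qed simp
qed

text \<open>Passage from continuous test functions to indicators of Borel sets. Raised by the same
  constant \<open>C\<close>, the weights \<open>f\<close> and \<open>g\<close> define positive
  measures on the target, with the identity map on the left and \<open>T\<close> on the right; these
  agree on continuous functions and hence coincide.\<close>

lemma set_integral_eq_of_continuous:
  fixes f :: "'b::metric_space \<Rightarrow>\<^sub>C real" and g :: "'c::metric_space \<Rightarrow>\<^sub>C real"
  assumes N: "finite_measure N" "sets N = sets borel" and T: "continuous_on UNIV T"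
    and eq: "\<And>h :: 'b \<Rightarrow>\<^sub>C real. (\<integral>x. apply_bcontfun h x * apply_bcontfun f x \<partial>distr N borel T)
      = (\<integral>y. apply_bcontfun h (T y) * apply_bcontfun g y \<partial>N)"
    and A: "A \<in> sets borel"
  shows "(\<integral>x. indicator A x * apply_bcontfun f x \<partial>distr N borel T)
    = (\<integral>y. indicator A (T y) * apply_bcontfun g y \<partial>N)"
proof -
  let ?M = "distr N borel T"
  have T_meas [measurable]: "T \<in> borel_measurable N"
    using N T by (auto intro: borel_measurable_continuous_on_UNIV)
  interpret N: finite_measure N by fact
  interpret M: finite_measure ?M by (rule N.finite_measure_distr) simp
  have M: "finite_measure ?M" "sets ?M = sets borel" using M.finite_measure_axioms by auto
  define C where "C = norm f + norm g"
  define v where "v = f + const_bcontfun C"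
  define w where "w = g + const_bcontfun C"
  have app: "apply_bcontfun v x = apply_bcontfun f x + C" "apply_bcontfun w y = apply_bcontfun g y + C" for x y
    by (simp_all add: v_def w_def const_bcontfun.rep_eq)
  have v: "0 \<le> apply_bcontfun v x" and w: "0 \<le> apply_bcontfun w y" for x y
    using abs_apply_bcontfun_le[of f x] abs_apply_bcontfun_le[of g y] norm_ge_zero[of f] norm_ge_zero[of g]
    by (simp_all add: app C_def abs_le_iff)
  \<comment> \<open>Stated for an arbitrary measure and weight because it is used on both sides, on
    the target with \<open>f\<close> and on the source with \<open>g\<close>.\<close>
  have split: "(\<integral>x. u x * (apply_bcontfun f' x + C) \<partial>L)
      = (\<integral>x. u x * apply_bcontfun f' x \<partial>L) + C * (\<integral>x. u x \<partial>L)"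
    if "finite_measure L" "sets L = sets borel" "u \<in> borel_measurable L" "\<And>x. \<bar>u x\<bar> \<le> K"
    for L :: "'d::metric_space measure" and u f' K
  proof -
    interpret L: finite_measure L by fact
    have u: "integrable L u"
      using that(3,4) by (intro L.integrable_const_bound[where B=K]) auto
    then show ?thesis
      unfolding distrib_left using integrable_mult_bcontfun[OF that] by (subst Bochner_Integration.integral_add) (auto simp: mult.commute)
  qed
  have WM: "(\<integral>x. u x \<partial>weighted_image ?M id v) = (\<integral>x. u x * apply_bcontfun f x \<partial>?M) + C * (\<integral>x. u x \<partial>?M)"
    and WN: "(\<integral>x. u x \<partial>weighted_image N T w) = (\<integral>y. u (T y) * apply_bcontfun g y \<partial>N) + C * (\<integral>x. u x \<partial>?M)"
    if "u \<in> borel_measurable borel" "\<And>x. \<bar>u x\<bar> \<le> K" for u K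
  proof -
    note [measurable] = that(1)
    show "(\<integral>x. u x \<partial>weighted_image ?M id v) = (\<integral>x. u x * apply_bcontfun f x \<partial>?M) + C * (\<integral>x. u x \<partial>?M)"
      using integral_weighted_image[OF M, of id v u] v that
      by (simp add: app split[OF M, of u K] continuous_on_id)
    show "(\<integral>x. u x \<partial>weighted_image N T w) = (\<integral>y. u (T y) * apply_bcontfun g y \<partial>N) + C * (\<integral>x. u x \<partial>?M)"
      using integral_weighted_image[OF N T, of w u] w that
      by (simp add: app split[OF N, of "\<lambda>y. u (T y)" K] integral_distr)
  qed
  have "weighted_image ?M id v = weighted_image N T w"
  proof (rule measure_eqI_continuous)
    show "finite_measure (weighted_image ?M id v)"
      by (rule finite_weighted_image[OF M]) (auto simp: v)
    show "finite_measure (weighted_image N T w)"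
      by (rule finite_weighted_image[OF N T w])
    fix h :: "'b \<Rightarrow> real" assume h: "continuous_on UNIV h" "\<And>x. 0 \<le> h x" "\<And>x. h x \<le> 1"
    have "h \<in> bcontfun" using h by (auto simp: bcontfun_def bounded_iff intro!: exI[of _ 1])
    then obtain h' where h': "h = apply_bcontfun h'" by (rule bcontfunE)
    have bm: "h \<in> borel_measurable borel" using h by (intro borel_measurable_continuous_onI)
    show "(\<integral>x. h x \<partial>weighted_image ?M id v) = (\<integral>x. h x \<partial>weighted_image N T w)"
    proof -
      have hb: "\<bar>h x\<bar> \<le> 1" for x using h(2,3)[of x] by simp
      show ?thesis
        unfolding WM[OF bm hb] WN[OF bm hb] using eq[of h'] by (simp add: h')
    qed
  qed auto
  then show ?thesis
    using WM[of "indicator A" 1] WN[of "indicator A" 1] A by (simp add: indicator_def)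
qed

section \<open>Couplings and kernels\<close>

text \<open>\<open>U\<close> stands for the real part of the function system, and
  \<open>max_le\<close> is the Choquet order tested on the maxima that generate the cone.\<close>

locale max_dominated =
  fixes U :: "('a::metric_space \<Rightarrow>\<^sub>C real) set" and \<mu> \<nu> :: "'a measure"
  assumes compact: "compact (UNIV :: 'a set)"
    and prob: "prob_space \<mu>" "prob_space \<nu>"
    and sets: "sets \<mu> = sets borel" "sets \<nu> = sets borel"
    and U: "subspace U" "const_bcontfun 1 \<in> U"
    and max_le: "\<And>F. finite F \<Longrightarrow> F \<noteq> {} \<Longrightarrow> F \<subseteq> U \<Longrightarrow>
      (\<integral>x. Max ((\<lambda>s. apply_bcontfun s x) ` F) \<partial>\<mu>) \<le> (\<integral>x. Max ((\<lambda>s. apply_bcontfun s x) ` F) \<partial>\<nu>)"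
begin

section \<open>Duality for couplings with a barycentre constraint\<close>

lemma finite_measures: "finite_measure \<mu>" "finite_measure \<nu>"
  using prob by (simp_all add: prob_space.finite_measure)

lemma compact_Times: "compact (UNIV :: ('a \<times> 'a) set)"
  using compact_Times[OF compact compact] by simp

lemma integrable_continuous:
  fixes f :: "'a \<Rightarrow> real"
  assumes "continuous_on UNIV f"
  shows "integrable \<mu> f" "integrable \<nu> f"
  using integrable_bcontfun[OF finite_measures(1) sets(1), of "Bcontfun f"]
    integrable_bcontfun[OF finite_measures(2) sets(2), of "Bcontfun f"] assms
  by (simp_all add: apply_bcontfun_Bcontfun[OF compact])

text \<open>A kernel that reproduces \<open>U\<close> integrates \<open>H (x, y)\<close> in
  \<open>y\<close> to \<open>H (x, x)\<close>. These are therefore the functions on the square whose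
  integral under the coupling is dictated by \<mu>.\<close>

definition sections_in :: "(('a \<times> 'a) \<Rightarrow>\<^sub>C real) \<Rightarrow> bool" where
  "sections_in H \<longleftrightarrow> (\<forall>x. \<exists>s\<in>U. \<forall>y. apply_bcontfun H (x, y) = apply_bcontfun s y)"

lemma continuous_on_diag [continuous_intros]:
  "continuous_on T (\<lambda>x. apply_bcontfun H (x, x))" for H :: "('a \<times> 'a) \<Rightarrow>\<^sub>C real"
  by (rule continuous_on_compose2[of UNIV "apply_bcontfun H"]) (auto intro!: continuous_intros)

lemma integrable_diag: "integrable \<mu> (\<lambda>x. apply_bcontfun H (x, x))" for H :: "('a \<times> 'a) \<Rightarrow>\<^sub>C real"
  by (intro integrable_continuous continuous_intros)

text \<open>The functional \<open>\<integral> H(x,x) d\<mu> + \<integral> g d\<nu>\<close> is nonnegative on nonnegative functions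
  \<open>H(x,y) + g(y)\<close> with \<open>H(x,\<cdot>) \<in> U\<close>: the minimum of \<open>H(c,\<cdot>)\<close> over a fine net of points \<open>c\<close>
  dominates \<open>-g\<close> and is almost below the diagonal of \<open>H\<close>.\<close>

lemma value_nonneg:
  assumes H: "sections_in H" and nonneg: "\<And>x y. 0 \<le> apply_bcontfun H (x, y) + apply_bcontfun g y"
  shows "0 \<le> (\<integral>x. apply_bcontfun H (x, x) \<partial>\<mu>) + (\<integral>y. apply_bcontfun g y \<partial>\<nu>)"
proof (rule field_le_epsilon)
  fix e :: real assume e: "0 < e"
  interpret \<mu>: prob_space \<mu> by (rule prob)
  have "uniformly_continuous_on UNIV (apply_bcontfun H)"
    by (rule compact_uniformly_continuous) (auto simp: compact_Times)
  then obtain d where d: "d > 0"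
    "\<And>p p'. dist p' p < d \<Longrightarrow> dist (apply_bcontfun H p') (apply_bcontfun H p) < e"
    unfolding uniformly_continuous_on_def using e by (elim allE[of _ e]) auto
  obtain C :: "'a set" where C: "finite C" "\<And>x. \<exists>c\<in>C. dist c x < d"
    using compact_UNIV_net[OF compact d(1)] by auto
  obtain s where s: "\<And>c. s c \<in> U" "\<And>c y. apply_bcontfun H (c, y) = apply_bcontfun (s c) y"
    using H unfolding sections_in_def by metis
  define F where "F = (\<lambda>c. - s c) ` C"
  have F: "finite F" "F \<noteq> {}" "F \<subseteq> U"
    using C s(1) subspace_neg[OF U(1)] by (auto simp: F_def)
  let ?m = "\<lambda>x. Max ((\<lambda>s. apply_bcontfun s x) ` F)"
  have m_cont: "continuous_on UNIV ?m"
    using F by (intro continuous_on_Max_image) auto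
  have "?m y \<le> apply_bcontfun g y" for y
  proof -
    have "- apply_bcontfun H (c, y) \<le> apply_bcontfun g y" for c
      using nonneg[of c y] by linarith
    then show ?thesis
      using F by (subst Max_le_iff) (auto simp: F_def s(2)[symmetric])
  qed
  then have 1: "(\<integral>y. ?m y \<partial>\<nu>) \<le> (\<integral>y. apply_bcontfun g y \<partial>\<nu>)"
    by (intro integral_mono integrable_continuous m_cont) auto
  have "- apply_bcontfun H (x, x) - e \<le> ?m x" for x
  proof -
    obtain c where c: "c \<in> C" "dist c x < d" using C by blast
    then have "dist (apply_bcontfun H (c, x)) (apply_bcontfun H (x, x)) < e"
      by (intro d(2)) (simp add: dist_Pair_Pair)
    then have "- apply_bcontfun H (x, x) - e \<le> apply_bcontfun (- s c) x"
      by (simp add: s(2)[of c, symmetric] dist_real_def)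
    also have "\<dots> \<le> ?m x"
      using F c by (intro Max_ge imageI[of "- s c" F "\<lambda>s. apply_bcontfun s x"]) (auto simp: F_def)
    finally show ?thesis .
  qed
  then have "(\<integral>x. - apply_bcontfun H (x, x) - e \<partial>\<mu>) \<le> (\<integral>x. ?m x \<partial>\<mu>)"
    by (intro integral_mono integrable_continuous m_cont continuous_intros)
  also have "(\<integral>x. - apply_bcontfun H (x, x) - e \<partial>\<mu>) = - (\<integral>x. apply_bcontfun H (x, x) \<partial>\<mu>) - e"
    using integrable_diag by (simp add: \<mu>.prob_space)
  finally show "0 \<le> (\<integral>x. apply_bcontfun H (x, x) \<partial>\<mu>) + (\<integral>y. apply_bcontfun g y \<partial>\<nu>) + e"
    using max_le[OF F] 1 by linarith
qed

text \<open>The dual side of maximizing the integral of \<open>F\<close> over all couplings of the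
  required kind: every such coupling integrates \<open>F\<close> to at most each of these
  numbers.\<close>

definition dominating_values :: "(('a \<times> 'a) \<Rightarrow>\<^sub>C real) \<Rightarrow> real set" where
  "dominating_values F = {(\<integral>x. apply_bcontfun H (x, x) \<partial>\<mu>) + (\<integral>y. apply_bcontfun g y \<partial>\<nu>) |H g.
     sections_in H \<and> (\<forall>x y. apply_bcontfun F (x, y) \<le> apply_bcontfun H (x, y) + apply_bcontfun g y)}"

lemma dominating_valuesI:
  assumes "sections_in H" "\<And>x y. apply_bcontfun F (x, y) \<le> apply_bcontfun H (x, y) + apply_bcontfun g y"
  shows "(\<integral>x. apply_bcontfun H (x, x) \<partial>\<mu>) + (\<integral>y. apply_bcontfun g y \<partial>\<nu>) \<in> dominating_values F"
  using assms unfolding dominating_values_def by blast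

lemma sections_in_0: "sections_in 0"
  unfolding sections_in_def using subspace_0[OF U(1)] by (auto intro!: bexI[of _ 0])

lemma sections_in_add: "sections_in H \<Longrightarrow> sections_in H' \<Longrightarrow> sections_in (H + H')"
  unfolding sections_in_def using subspace_add[OF U(1)] by (metis plus_bcontfun.rep_eq)

lemma sections_in_scaleR: "sections_in H \<Longrightarrow> sections_in (r *\<^sub>R H)"
  unfolding sections_in_def using subspace_scale[OF U(1)] by (metis scaleR_bcontfun.rep_eq)

text \<open>Since \<open>F\<close> is at least \<open>- norm F\<close>, raising \<open>g\<close> by
  the norm makes the dominating function nonnegative and \<open>value_nonneg\<close> applies. In
  this way the Choquet order makes the infimum finite.\<close>

lemma dominating_values_bound:
  assumes "a \<in> dominating_values F"
  shows "- norm F \<le> a"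
proof -
  interpret \<nu>: prob_space \<nu> by (rule prob)
  obtain H g where H: "sections_in H" "\<And>x y. apply_bcontfun F (x, y) \<le> apply_bcontfun H (x, y) + apply_bcontfun g y"
    and a: "a = (\<integral>x. apply_bcontfun H (x, x) \<partial>\<mu>) + (\<integral>y. apply_bcontfun g y \<partial>\<nu>)"
    using assms unfolding dominating_values_def by blast
  have app: "apply_bcontfun (g + const_bcontfun (norm F)) y = apply_bcontfun g y + norm F" for y
    by (simp add: const_bcontfun.rep_eq)
  have "0 \<le> apply_bcontfun H (x, y) + apply_bcontfun (g + const_bcontfun (norm F)) y" for x y
    using abs_apply_bcontfun_le[of F "(x, y)"] H(2)[of x y] unfolding app abs_le_iff by linarith
  from value_nonneg[OF H(1) this] show ?thesis
    unfolding app a using integrable_bcontfun[OF finite_measures(2) sets(2), of g]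
    by (simp add: \<nu>.prob_space)
qed

definition upper :: "(('a \<times> 'a) \<Rightarrow>\<^sub>C real) \<Rightarrow> real" where
  "upper F = Inf (dominating_values F)"

lemma upper_le: "a \<in> dominating_values F \<Longrightarrow> upper F \<le> a"
  unfolding upper_def by (intro cInf_lower bdd_belowI[of _ "- norm F"] dominating_values_bound)

lemma le_upper: "(\<And>a. a \<in> dominating_values F \<Longrightarrow> b \<le> a) \<Longrightarrow> b \<le> upper F"
proof -
  have "apply_bcontfun F (x, y) \<le> apply_bcontfun 0 (x, y) + apply_bcontfun (const_bcontfun (norm F)) y" for x y
    using abs_apply_bcontfun_le[of F "(x, y)"] by (simp add: const_bcontfun.rep_eq)
  from dominating_valuesI[OF sections_in_0 this] have "dominating_values F \<noteq> {}" by blast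
  then show "(\<And>a. a \<in> dominating_values F \<Longrightarrow> b \<le> a) \<Longrightarrow> b \<le> upper F"
    unfolding upper_def by (rule cInf_greatest)
qed

lemma dominating_values_add:
  assumes "a \<in> dominating_values F" "b \<in> dominating_values G"
  shows "a + b \<in> dominating_values (F + G)"
proof -
  obtain H g where H: "sections_in H" "\<And>x y. apply_bcontfun F (x, y) \<le> apply_bcontfun H (x, y) + apply_bcontfun g y"
    and a: "a = (\<integral>x. apply_bcontfun H (x, x) \<partial>\<mu>) + (\<integral>y. apply_bcontfun g y \<partial>\<nu>)"
    using assms(1) unfolding dominating_values_def by blast
  obtain H' g' where H': "sections_in H'" "\<And>x y. apply_bcontfun G (x, y) \<le> apply_bcontfun H' (x, y) + apply_bcontfun g' y"
    and b: "b = (\<integral>x. apply_bcontfun H' (x, x) \<partial>\<mu>) + (\<integral>y. apply_bcontfun g' y \<partial>\<nu>)"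
    using assms(2) unfolding dominating_values_def by blast
  have "apply_bcontfun (F + G) (x, y) \<le> apply_bcontfun (H + H') (x, y) + apply_bcontfun (g + g') y" for x y
    using H(2)[of x y] H'(2)[of x y] by simp
  from dominating_valuesI[OF sections_in_add[OF H(1) H'(1)] this] show ?thesis
    using integrable_diag[of H] integrable_diag[of H']
      integrable_bcontfun[OF finite_measures(2) sets(2), of g] integrable_bcontfun[OF finite_measures(2) sets(2), of g']
    by (simp add: a b algebra_simps)
qed

lemma dominating_values_scaleR:
  assumes "a \<in> dominating_values F" "r > 0"
  shows "r * a \<in> dominating_values (r *\<^sub>R F)"
proof -
  obtain H g where H: "sections_in H" "\<And>x y. apply_bcontfun F (x, y) \<le> apply_bcontfun H (x, y) + apply_bcontfun g y"
    and a: "a = (\<integral>x. apply_bcontfun H (x, x) \<partial>\<mu>) + (\<integral>y. apply_bcontfun g y \<partial>\<nu>)"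
    using assms(1) unfolding dominating_values_def by blast
  have "apply_bcontfun (r *\<^sub>R F) (x, y) \<le> apply_bcontfun (r *\<^sub>R H) (x, y) + apply_bcontfun (r *\<^sub>R g) y" for x y
    using mult_left_mono[OF H(2)[of x y], of r] assms(2) by (simp add: algebra_simps)
  from dominating_valuesI[OF sections_in_scaleR[OF H(1)] this] show ?thesis
    by (simp add: a algebra_simps)
qed

lemma sublinear_upper: "sublinear upper"
  unfolding sublinear_def
proof safe
  fix F G :: "('a \<times> 'a) \<Rightarrow>\<^sub>C real"
  have "upper (F + G) - b \<le> upper F" if "b \<in> dominating_values G" for b
    using upper_le[OF dominating_values_add[OF _ that]] by (intro le_upper) (simp add: diff_le_eq)
  then have "upper (F + G) - upper F \<le> upper G"
    by (intro le_upper) (simp add: algebra_simps)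
  then show "upper (F + G) \<le> upper F + upper G" by simp
next
  fix r :: real and F :: "('a \<times> 'a) \<Rightarrow>\<^sub>C real" assume r: "0 < r"
  have "upper (r *\<^sub>R F) / r \<le> upper F"
    using upper_le[OF dominating_values_scaleR[OF _ r]] r by (intro le_upper) (simp add: field_simps)
  with r show "upper (r *\<^sub>R F) \<le> r * upper F" by (simp add: field_simps)
qed

text \<open>Each requirement comes from an upper bound by \<open>upper\<close>. A nonpositive
  function is dominated by 0, so \<open>L\<close> is positive. A function of the second variable, or
  one with sections in \<open>U\<close>, is dominated by itself, and the same holds for its
  negative; the two bounds meet.\<close>

lemma coupling:
  obtains \<eta> :: "('a \<times> 'a) measure" where "finite_measure \<eta>" "sets \<eta> = sets borel"
    "\<And>g :: 'a \<Rightarrow>\<^sub>C real. (\<integral>p. apply_bcontfun g (snd p) \<partial>\<eta>) = (\<integral>y. apply_bcontfun g y \<partial>\<nu>)"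
    "\<And>F. sections_in F \<Longrightarrow> (\<integral>p. apply_bcontfun F p \<partial>\<eta>) = (\<integral>x. apply_bcontfun F (x, x) \<partial>\<mu>)"
proof -
  obtain L where L: "linear L" "\<And>F. L F \<le> upper F"
    using hahn_banach_sublinear[OF sublinear_upper] by blast
  have nonneg: "0 \<le> L F" if "\<And>p. 0 \<le> apply_bcontfun F p" for F
  proof -
    have "L (- F) \<le> 0"
      using upper_le[OF dominating_valuesI[OF sections_in_0, of "- F" 0]] that L(2)[of "- F"] by simp
    then show ?thesis by (simp add: linear_neg[OF L(1)])
  qed
  obtain \<eta> where \<eta>: "finite_measure \<eta>" "sets \<eta> = sets borel"
    and L_eq: "\<And>F. (\<integral>p. apply_bcontfun F p \<partial>\<eta>) = L F"
    using riesz_representation[OF compact_Times L(1) nonneg] by blast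
  have two_sided: "L F = v" if "L F \<le> v" "L (- F) \<le> - v" for F v
    using that by (simp add: linear_neg[OF L(1)])
  show ?thesis
  proof (rule that[OF \<eta>])
    fix g :: "'a \<Rightarrow>\<^sub>C real"
    define G where "G = Bcontfun (\<lambda>p :: 'a \<times> 'a. apply_bcontfun g (snd p))"
    have G: "apply_bcontfun G = (\<lambda>p. apply_bcontfun g (snd p))"
      unfolding G_def by (rule apply_bcontfun_Bcontfun[OF compact_Times])
        (rule continuous_on_compose2[of UNIV "apply_bcontfun g"], auto intro!: continuous_intros)
    have "L G = (\<integral>y. apply_bcontfun g y \<partial>\<nu>)"
    proof (rule two_sided)
      show "L G \<le> (\<integral>y. apply_bcontfun g y \<partial>\<nu>)"
        using upper_le[OF dominating_valuesI[OF sections_in_0, of G g]] L(2)[of G] by (simp add: G)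
      show "L (- G) \<le> - (\<integral>y. apply_bcontfun g y \<partial>\<nu>)"
        using upper_le[OF dominating_valuesI[OF sections_in_0, of "- G" "- g"]] L(2)[of "- G"] by (simp add: G)
    qed
    then show "(\<integral>p. apply_bcontfun g (snd p) \<partial>\<eta>) = (\<integral>y. apply_bcontfun g y \<partial>\<nu>)"
      using L_eq[of G] by (simp add: G)
  next
    fix F assume F: "sections_in F"
    show "(\<integral>p. apply_bcontfun F p \<partial>\<eta>) = (\<integral>x. apply_bcontfun F (x, x) \<partial>\<mu>)"
      unfolding L_eq
    proof (rule two_sided)
      show "L F \<le> (\<integral>x. apply_bcontfun F (x, x) \<partial>\<mu>)"
        using upper_le[OF dominating_valuesI[OF F, of F 0]] L(2)[of F] by simp
      show "L (- F) \<le> - (\<integral>x. apply_bcontfun F (x, x) \<partial>\<mu>)"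
        using upper_le[OF dominating_valuesI[OF sections_in_scaleR[OF F, of "-1"], of "- F" 0]] L(2)[of "- F"] by simp
    qed
  qed
qed

end

section \<open>From densities on a countable dense set to a kernel\<close>

lemma dist_integral_bcontfun_le:
  fixes f g :: "'a::topological_space \<Rightarrow>\<^sub>C real"
  assumes "prob_space M" "sets M = sets borel"
  shows "\<bar>(\<integral>x. apply_bcontfun f x \<partial>M) - (\<integral>x. apply_bcontfun g x \<partial>M)\<bar> \<le> dist f g"
proof -
  interpret prob_space M by fact
  have int: "integrable M (apply_bcontfun h)" for h :: "'a \<Rightarrow>\<^sub>C real"
    by (rule integrable_bcontfun[OF finite_measure_axioms assms(2)])
  have "(\<integral>x. apply_bcontfun f x \<partial>M) - (\<integral>x. apply_bcontfun g x \<partial>M) = (\<integral>x. apply_bcontfun (f - g) x \<partial>M)"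
    using int by simp
  also have "\<bar>\<dots>\<bar> \<le> (\<integral>x. norm (f - g) \<partial>M)"
    by (rule order_trans[OF integral_abs_bound], rule integral_mono)
       (use int abs_apply_bcontfun_le[of "f - g"] in \<open>auto intro: integrable_abs\<close>)
  also have "\<dots> = dist f g" by (simp add: prob_space dist_norm)
  finally show ?thesis .
qed

text \<open>The data \<open>k\<close> on the dense set \<open>D\<close> is linear only up to an error that is small when the
  corresponding combination of elements of \<open>D\<close> is, as \<open>D\<close> need not be closed under addition.\<close>

lemma prob_measure_of_dense_functional:
  fixes k :: "('a::metric_space \<Rightarrow>\<^sub>C real) \<Rightarrow> real"
  assumes compact: "compact (UNIV :: 'a set)"
    and dense: "\<And>f e. 0 < e \<Longrightarrow> \<exists>d\<in>D. dist f d < e"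
    and k: "\<And>c d e r. c \<in> D \<Longrightarrow> d \<in> D \<Longrightarrow> e \<in> D \<Longrightarrow> r \<in> \<rat> \<Longrightarrow>
      \<bar>k c - k d - r * k e\<bar> \<le> norm (c - d - r *\<^sub>R e)"
    and one: "const_bcontfun 1 \<in> D" "k (const_bcontfun 1) = 1"
  obtains M where "prob_space M" "sets M = sets borel"
    "\<And>d. d \<in> D \<Longrightarrow> (\<integral>x. apply_bcontfun d x \<partial>M) = k d"
proof -
  have k2: "\<bar>k c - k d\<bar> \<le> norm (c - d)" if "c \<in> D" "d \<in> D" for c d
    using k[OF that(1,2) that(1), of 0] by simp
  have "\<exists>d. (\<forall>n. d n \<in> D) \<and> d \<longlonglongrightarrow> f" for f
  proof -
    have "\<forall>n. \<exists>d. d \<in> D \<and> dist f d < 1 / Suc n" using dense by (metis of_nat_0_less_iff zero_less_Suc zero_less_divide_1_iff)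
    then obtain d where d: "\<And>n. d n \<in> D" "\<And>n. dist f (d n) < 1 / Suc n" by metis
    have "(\<lambda>n. dist (d n) f) \<longlonglongrightarrow> 0"
      by (rule Lim_null_comparison[OF _ LIMSEQ_inverse_real_of_nat])
         (use d(2) in \<open>auto simp: dist_commute inverse_eq_divide intro!: always_eventually less_imp_le\<close>)
    with d(1) show ?thesis using tendsto_dist_iff by blast
  qed
  then obtain d where d: "\<And>f n. d f n \<in> D" "\<And>f. d f \<longlonglongrightarrow> f" by metis
  have "convergent (\<lambda>n. k (d f n))" for f
  proof (rule Cauchy_convergent, rule metric_CauchyI)
    fix e :: real assume "e > 0"
    from metric_CauchyD[OF LIMSEQ_imp_Cauchy[OF d(2)[of f]] this]
    obtain N where N: "\<And>m n. m \<ge> N \<Longrightarrow> n \<ge> N \<Longrightarrow> dist (d f m) (d f n) < e" by blast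
    have "dist (k (d f m)) (k (d f n)) < e" if "m \<ge> N" "n \<ge> N" for m n
      using k2[OF d(1) d(1), of f m f n] N[OF that] by (simp add: dist_norm)
    then show "\<exists>N. \<forall>m\<ge>N. \<forall>n\<ge>N. dist (k (d f m)) (k (d f n)) < e" by blast
  qed
  then obtain l where l: "\<And>f. (\<lambda>n. k (d f n)) \<longlonglongrightarrow> l f" unfolding convergent_def by metis
  have lD: "\<bar>l f - k c\<bar> \<le> norm (f - c)" if "c \<in> D" for f c
    by (rule LIMSEQ_le[of "\<lambda>n. \<bar>k (d f n) - k c\<bar>" _ "\<lambda>n. norm (d f n - c)"])
       (use k2[OF d(1) that] in \<open>auto intro!: tendsto_intros l d\<close>)
  have l_eq: "l c = k c" if "c \<in> D" for c using lD[OF that, of c] by simp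
  have l_lin: "l (f + r *\<^sub>R g) = l f + r * l g" for f g r
  proof -
    \<comment> \<open>The bound on \<open>k\<close> is available for rational factors only, which
      form a countable set, so the real factor \<open>r\<close> is reached as a limit.\<close>
    obtain q where q: "\<And>n. q n \<in> \<rat>" "q \<longlonglongrightarrow> r"
    proof -
      have "\<forall>n. \<exists>q. q \<in> \<rat> \<and> \<bar>q - r\<bar> < 1 / Suc n"
      proof
        fix n
        obtain q where "q \<in> \<rat>" "r < q" "q < r + 1 / Suc n"
          using Rats_dense_in_real[of r "r + 1 / Suc n"] by auto
        then show "\<exists>q. q \<in> \<rat> \<and> \<bar>q - r\<bar> < 1 / Suc n" by (intro exI[of _ q]) auto
      qed
      then obtain q where q: "\<And>n. q n \<in> \<rat>" "\<And>n. \<bar>q n - r\<bar> < 1 / Suc n" by metis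
      have "(\<lambda>n. q n - r) \<longlonglongrightarrow> 0"
        by (rule Lim_null_comparison[OF _ LIMSEQ_inverse_real_of_nat])
           (use q(2) in \<open>auto simp: inverse_eq_divide intro!: always_eventually less_imp_le\<close>)
      then show ?thesis using that q(1) LIM_zero_iff by blast
    qed
    have "\<bar>l (f + r *\<^sub>R g) - l f - r * l g\<bar> \<le> norm (f + r *\<^sub>R g - f - r *\<^sub>R g)"
    proof (rule LIMSEQ_le[of "\<lambda>n. \<bar>k (d (f + r *\<^sub>R g) n) - k (d f n) - q n * k (d g n)\<bar>" _
          "\<lambda>n. norm (d (f + r *\<^sub>R g) n - d f n - q n *\<^sub>R d g n)"])
      show "\<exists>N. \<forall>n\<ge>N. \<bar>k (d (f + r *\<^sub>R g) n) - k (d f n) - q n * k (d g n)\<bar>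
          \<le> norm (d (f + r *\<^sub>R g) n - d f n - q n *\<^sub>R d g n)"
        using k[OF d(1) d(1) d(1) q(1)] by blast
    qed (intro tendsto_intros l d q)+
    then show ?thesis by simp
  qed
  have l1: "l (const_bcontfun 1) = 1" using l_eq[OF one(1)] one(2) by simp
  have l0: "l 0 = 0" using l_lin[of 0 1 0] by simp
  have lin: "linear l"
    by (rule linearI) (use l_lin[of _ 1] l_lin[of 0] l0 in auto)
  have l_norm: "\<bar>l f\<bar> \<le> norm f" for f
  proof -
    \<comment> \<open>With three equal arguments and the factor -1 the hypothesis on
      \<open>k\<close> reduces to this bound.\<close>
    have "\<bar>k (d f n)\<bar> \<le> norm (d f n)" for n
      using k[of "d f n" "d f n" "d f n" "-1"] d(1) by simp
    then show ?thesis
      by (intro LIMSEQ_le[of "\<lambda>n. \<bar>k (d f n)\<bar>" _ "\<lambda>n. norm (d f n)"])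
         (auto intro!: tendsto_intros l d)
  qed
  have nonneg: "0 \<le> l f" if "\<And>x. 0 \<le> apply_bcontfun f x" for f
  proof -
    \<comment> \<open>Positivity comes from the norm bound and the value at 1: a nonnegative
      \<open>f\<close> lies within \<open>norm f / 2\<close> of the constant
      \<open>norm f / 2\<close>, hence \<open>l f\<close> lies within \<open>norm f / 2\<close> of
      that number.\<close>
    define h where "h = f - (norm f / 2) *\<^sub>R const_bcontfun 1"
    have "norm h \<le> norm f / 2"
    proof (rule norm_bound)
      fix x
      show "norm (apply_bcontfun h x) \<le> norm f / 2"
      proof -
        have "apply_bcontfun h x = apply_bcontfun f x - norm f / 2"
          by (simp add: h_def const_bcontfun.rep_eq)
        then show ?thesis
          using that[of x] abs_apply_bcontfun_le[of f x]
          unfolding real_norm_def abs_le_iff by linarith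
      qed
    qed
    moreover have "l h = l f - norm f / 2"
      using l_lin[of f "- (norm f / 2)" "const_bcontfun 1"] by (simp add: h_def l1)
    ultimately show ?thesis using l_norm[of h] by (simp add: abs_le_iff)
  qed
  obtain M where M: "finite_measure M" "sets M = sets borel" "\<And>f. (\<integral>x. apply_bcontfun f x \<partial>M) = l f"
    using riesz_representation[OF compact lin nonneg] by blast
  have "space M = UNIV" using sets_eq_imp_space_eq[OF M(2)] by simp
  then have "measure M (space M) = 1"
    using M(3)[of "const_bcontfun 1"] l1 by (simp add: const_bcontfun.rep_eq)
  then have "emeasure M (space M) = 1"
    using finite_measure.emeasure_eq_measure[OF M(1)] by simp
  then have "prob_space M" by (rule prob_spaceI)
  with M l_eq show ?thesis by (intro that[of M]) auto
qed

context max_dominated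
begin

text \<open>\<open>k g\<close> is the conditional expectation, given the first coordinate, of
  \<open>g\<close> at the second. Each almost sure statement has a null set depending on the
  functions involved, so that only countably many can be combined later. The third property is
  linearity up to a norm error, in the form asked for by
  \<open>prob_measure_of_dense_functional\<close>.\<close>

lemma conditional_densities:
  obtains k where "\<And>g :: 'a \<Rightarrow>\<^sub>C real. integrable \<mu> (k g)" "\<And>g. k g \<in> borel_measurable borel"
    "\<And>c d e r. AE x in \<mu>. \<bar>k c x - k d x - r * k e x\<bar> \<le> norm (c - d - r *\<^sub>R e)"
    "\<And>s. s \<in> U \<Longrightarrow> AE x in \<mu>. k s x = apply_bcontfun s x"
    "\<And>g. (\<integral>x. k g x \<partial>\<mu>) = (\<integral>y. apply_bcontfun g y \<partial>\<nu>)"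
proof -
  obtain \<eta> :: "('a \<times> 'a) measure" where \<eta>: "finite_measure \<eta>" "sets \<eta> = sets borel"
    and snd_\<eta>: "\<And>g :: 'a \<Rightarrow>\<^sub>C real. (\<integral>p. apply_bcontfun g (snd p) \<partial>\<eta>) = (\<integral>y. apply_bcontfun g y \<partial>\<nu>)"
    and diag: "\<And>F. sections_in F \<Longrightarrow> (\<integral>p. apply_bcontfun F p \<partial>\<eta>) = (\<integral>x. apply_bcontfun F (x, x) \<partial>\<mu>)"
    using coupling by blast
  interpret \<eta>: finite_measure \<eta> by fact
  interpret \<mu>: prob_space \<mu> by (rule prob)
  have fst_cont: "continuous_on UNIV (fst :: 'a \<times> 'a \<Rightarrow> 'a)"
    and snd_cont: "continuous_on UNIV (snd :: 'a \<times> 'a \<Rightarrow> 'a)"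
    by (intro continuous_intros)+
  have [measurable]: "fst \<in> borel_measurable \<eta>"
    by (rule borel_measurable_continuous_on_UNIV[OF \<eta>(2) fst_cont])
  \<comment> \<open>For fixed \<open>x\<close> the product is a multiple of \<open>s\<close>, hence
    has sections in \<open>U\<close>; varying \<open>h\<close> localizes the equation in
    \<open>x\<close>.\<close>
  have diag_prod: "(\<integral>p. apply_bcontfun h (fst p) * apply_bcontfun s (snd p) \<partial>\<eta>)
      = (\<integral>x. apply_bcontfun h x * apply_bcontfun s x \<partial>\<mu>)" if s: "s \<in> U" for h s
  proof -
    define F where "F = Bcontfun (\<lambda>p. apply_bcontfun h (fst p) * apply_bcontfun s (snd p))"
    have F: "apply_bcontfun F = (\<lambda>p. apply_bcontfun h (fst p) * apply_bcontfun s (snd p))"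
      unfolding F_def
      by (intro apply_bcontfun_Bcontfun[OF compact_Times] continuous_on_mult
          continuous_on_compose2[of UNIV "apply_bcontfun h", OF _ fst_cont]
          continuous_on_compose2[of UNIV "apply_bcontfun s", OF _ snd_cont]) auto
    have "sections_in F"
      unfolding sections_in_def F
    proof
      fix x
      show "\<exists>t\<in>U. \<forall>y. apply_bcontfun h (fst (x, y)) * apply_bcontfun s (snd (x, y)) = apply_bcontfun t y"
        by (rule bexI[of _ "apply_bcontfun h x *\<^sub>R s"]) (simp_all add: subspace_scale[OF U(1) s])
    qed
    from diag[OF this] show ?thesis by (simp add: F)
  qed
  \<comment> \<open>The first marginal comes out because 1 lies in \<open>U\<close>, so that
    functions of the first variable alone have sections in \<open>U\<close>.\<close>
  have \<mu>_eq: "distr \<eta> borel fst = \<mu>"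
  proof (rule measure_eqI_continuous)
    show "finite_measure (distr \<eta> borel fst)" by (rule \<eta>.finite_measure_distr) simp
    fix h :: "'a \<Rightarrow> real" assume h: "continuous_on UNIV h"
    then have [measurable]: "h \<in> borel_measurable borel" by (rule borel_measurable_continuous_onI)
    show "(\<integral>x. h x \<partial>distr \<eta> borel fst) = (\<integral>x. h x \<partial>\<mu>)"
      using diag_prod[OF U(2), of "Bcontfun h"] h
      by (simp add: integral_distr apply_bcontfun_Bcontfun[OF compact] const_bcontfun.rep_eq)
  qed (use sets \<mu>.finite_measure_axioms in auto)
  define lift where "lift g = Bcontfun (\<lambda>p :: 'a \<times> 'a. apply_bcontfun g (snd p))" for g :: "'a \<Rightarrow>\<^sub>C real"
  have lift: "apply_bcontfun (lift g) = (\<lambda>p. apply_bcontfun g (snd p))" for g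
    unfolding lift_def
    by (intro apply_bcontfun_Bcontfun[OF compact_Times]
        continuous_on_compose2[of UNIV "apply_bcontfun g", OF _ snd_cont]) auto
  have "\<forall>g :: 'a \<Rightarrow>\<^sub>C real. \<exists>k. integrable \<mu> k \<and> k \<in> borel_measurable borel \<and> (\<forall>A\<in>sets borel.
      (\<integral>x. indicator A x * k x \<partial>\<mu>) = (\<integral>p. indicator A (fst p) * apply_bcontfun g (snd p) \<partial>\<eta>))"
  proof
    fix g :: "'a \<Rightarrow>\<^sub>C real"
    obtain k where "integrable (distr \<eta> borel fst) k" "k \<in> borel_measurable borel"
      "\<And>A. A \<in> sets borel \<Longrightarrow>
        (\<integral>x. indicator A x * k x \<partial>distr \<eta> borel fst) = (\<integral>p. indicator A (fst p) * apply_bcontfun (lift g) p \<partial>\<eta>)"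
      using conditional_density[OF \<eta> fst_cont] by blast
    then show "\<exists>k. integrable \<mu> k \<and> k \<in> borel_measurable borel \<and> (\<forall>A\<in>sets borel.
      (\<integral>x. indicator A x * k x \<partial>\<mu>) = (\<integral>p. indicator A (fst p) * apply_bcontfun g (snd p) \<partial>\<eta>))"
      unfolding \<mu>_eq lift by blast
  qed
  from choice[OF this] obtain k :: "('a \<Rightarrow>\<^sub>C real) \<Rightarrow> 'a \<Rightarrow> real"
    where k: "\<And>g. integrable \<mu> (k g)" "\<And>g. k g \<in> borel_measurable borel"
    and k_eq: "\<And>g A. A \<in> sets borel \<Longrightarrow>
      (\<integral>x. indicator A x * k g x \<partial>\<mu>) = (\<integral>p. indicator A (fst p) * apply_bcontfun g (snd p) \<partial>\<eta>)"
    by blast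
  have ind_k: "integrable \<mu> (\<lambda>x. indicator A x * k g x)" if "A \<in> sets borel" for A g
    using integrable_real_mult_indicator[OF _ k(1), of A g] that sets by (simp add: mult.commute)
  have ind_g: "integrable \<eta> (\<lambda>p. indicator A (fst p) * apply_bcontfun g (snd p))" if "A \<in> sets borel" for A and g :: "'a \<Rightarrow>\<^sub>C real"
    using integrable_mult_bcontfun[OF \<eta>, of "\<lambda>p. indicator A (fst p)" 1 "lift g"] that by (simp add: lift indicator_def)
  show ?thesis
  proof (rule that[of k])
    fix c d e :: "'a \<Rightarrow>\<^sub>C real" and r :: real
    let ?C = "norm (c - d - r *\<^sub>R e)"
    \<comment> \<open>The sign \<open>\<sigma>\<close> serves both halves of the absolute
      value.\<close>
    have bound: "AE x in \<mu>. \<sigma> * (k c x - k d x - r * k e x) \<le> ?C" if \<sigma>: "\<bar>\<sigma>\<bar> = 1" for \<sigma> :: real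
    proof (rule AE_le_of_set_integral_le)
      show "integrable \<mu> (\<lambda>x. \<sigma> * (k c x - k d x - r * k e x))" using k by simp
      fix A assume "A \<in> sets \<mu>"
      then have A: "A \<in> sets borel" by (simp add: sets)
      have "(\<integral>x. indicator A x * (\<sigma> * (k c x - k d x - r * k e x)) \<partial>\<mu>)
        = (\<integral>x. \<sigma> * (indicator A x * k c x - indicator A x * k d x - r * (indicator A x * k e x)) \<partial>\<mu>)"
        by (rule Bochner_Integration.integral_cong) (auto simp: algebra_simps)
      also have "\<dots> = (\<integral>p. \<sigma> * (indicator A (fst p) * apply_bcontfun c (snd p)
          - indicator A (fst p) * apply_bcontfun d (snd p) - r * (indicator A (fst p) * apply_bcontfun e (snd p))) \<partial>\<eta>)"
        using ind_k[OF A] ind_g[OF A] by (simp add: k_eq[OF A])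
      also have "\<dots> = (\<integral>p. indicator A (fst p) * (\<sigma> * apply_bcontfun (c - d - r *\<^sub>R e) (snd p)) \<partial>\<eta>)"
        by (rule Bochner_Integration.integral_cong) (auto simp: algebra_simps)
      also have "\<dots> \<le> (\<integral>p. indicator A (fst p) * ?C \<partial>\<eta>)"
      proof (rule integral_mono)
        have "\<sigma> * apply_bcontfun (c - d - r *\<^sub>R e) y \<le> ?C" for y
          using abs_apply_bcontfun_le[of "c - d - r *\<^sub>R e" y] \<sigma>
          by (metis abs_le_D1 abs_mult mult_1)
        then show "indicator A (fst p) * (\<sigma> * apply_bcontfun (c - d - r *\<^sub>R e) (snd p)) \<le> indicator A (fst p) * ?C" for p
          by (intro mult_left_mono) auto
        show "integrable \<eta> (\<lambda>p. indicator A (fst p) * ?C)"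
          by (rule \<eta>.integrable_const_bound[where B="?C"]) (use A in \<open>auto simp: indicator_def\<close>)
        show "integrable \<eta> (\<lambda>p. indicator A (fst p) * (\<sigma> * apply_bcontfun (c - d - r *\<^sub>R e) (snd p)))"
          using ind_g[OF A, of "\<sigma> *\<^sub>R (c - d - r *\<^sub>R e)"] by simp
      qed
      also have "\<dots> = (\<integral>x. indicator A x * ?C \<partial>\<mu>)"
        unfolding \<mu>_eq[symmetric] by (rule integral_distr[symmetric]) (use A in auto)
      also have "\<dots> = ?C * measure \<mu> A"
        using A sets sets.sets_into_space[of A \<mu>] by (simp add: Int_absorb2 mult.commute)
      finally show "(\<integral>x. indicator A x * (\<sigma> * (k c x - k d x - r * k e x)) \<partial>\<mu>) \<le> ?C * measure \<mu> A" .
    qed (rule \<mu>.finite_measure_axioms)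
    have "AE x in \<mu>. k c x - k d x - r * k e x \<le> ?C" "AE x in \<mu>. - (k c x - k d x - r * k e x) \<le> ?C"
      using bound[of 1] bound[of "-1"] by simp_all
    then show "AE x in \<mu>. \<bar>k c x - k d x - r * k e x\<bar> \<le> ?C"
      by eventually_elim (simp only: abs_le_iff)
  next
    fix s assume s: "s \<in> U"
    have eq: "(\<integral>x. indicator A x * apply_bcontfun s x \<partial>\<mu>) = (\<integral>x. indicator A x * k s x \<partial>\<mu>)"
      if A: "A \<in> sets borel" for A
      using set_integral_eq_of_continuous[OF \<eta> fst_cont, of s "lift s" A] diag_prod[OF s] A
      by (simp add: \<mu>_eq lift k_eq)
    have s_int: "integrable \<mu> (apply_bcontfun s)"
      by (rule integrable_continuous) simp
    have ind_s: "integrable \<mu> (\<lambda>x. indicator A x * apply_bcontfun s x)" if "A \<in> sets borel" for A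
      using integrable_real_mult_indicator[OF _ s_int, of A] that sets by (simp add: mult.commute)
    have "AE x in \<mu>. k s x - apply_bcontfun s x \<le> 0"
      by (rule AE_le_of_set_integral_le[OF \<mu>.finite_measure_axioms])
         (use k s_int ind_k ind_s eq sets in \<open>auto simp: right_diff_distrib\<close>)
    moreover have "AE x in \<mu>. apply_bcontfun s x - k s x \<le> 0"
      by (rule AE_le_of_set_integral_le[OF \<mu>.finite_measure_axioms])
         (use k s_int ind_k ind_s eq sets in \<open>auto simp: right_diff_distrib\<close>)
    ultimately show "AE x in \<mu>. k s x = apply_bcontfun s x"
      by eventually_elim simp
  next
    fix g
    show "(\<integral>x. k g x \<partial>\<mu>) = (\<integral>y. apply_bcontfun g y \<partial>\<nu>)"
      using k_eq[of UNIV g] snd_\<eta>[of g] by simp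
  qed (fact k)+
qed

text \<open>The countably many conditions are imposed on \<open>D\<close> and extended by uniform
  approximation: the barycentre equation, the measurability in \<open>x\<close> and the integral
  formula pass to uniform limits because every \<open>\<Lambda> x\<close> is a probability
  measure.\<close>

lemma barycentric_kernel:
  obtains \<Lambda> :: "'a \<Rightarrow> 'a measure" where "\<And>x. prob_space (\<Lambda> x)" "\<And>x. sets (\<Lambda> x) = sets borel"
    "\<And>f :: 'a \<Rightarrow>\<^sub>C real. (\<lambda>x. \<integral>y. apply_bcontfun f y \<partial>\<Lambda> x) \<in> borel_measurable borel"
    "\<And>x s. s \<in> U \<Longrightarrow> (\<integral>y. apply_bcontfun s y \<partial>\<Lambda> x) = apply_bcontfun s x"
    "\<And>f :: 'a \<Rightarrow>\<^sub>C real. (\<integral>x. \<integral>y. apply_bcontfun f y \<partial>\<Lambda> x \<partial>\<mu>) = (\<integral>y. apply_bcontfun f y \<partial>\<nu>)"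
proof -
  interpret \<mu>: prob_space \<mu> by (rule prob)
  obtain k where k: "\<And>g :: 'a \<Rightarrow>\<^sub>C real. integrable \<mu> (k g)" "\<And>g. k g \<in> borel_measurable borel"
    and k_lin: "\<And>c d e r. AE x in \<mu>. \<bar>k c x - k d x - r * k e x\<bar> \<le> norm (c - d - r *\<^sub>R e)"
    and k_U: "\<And>s. s \<in> U \<Longrightarrow> AE x in \<mu>. k s x = apply_bcontfun s x"
    and k_int: "\<And>g. (\<integral>x. k g x \<partial>\<mu>) = (\<integral>y. apply_bcontfun g y \<partial>\<nu>)"
    using conditional_densities by blast
  obtain D1 :: "('a \<Rightarrow>\<^sub>C real) set" where D1: "countable D1" "\<And>f e. 0 < e \<Longrightarrow> \<exists>d\<in>D1. dist f d < e"
    using countable_dense_subset_bcontfun[OF compact, of UNIV] by auto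
  \<comment> \<open>A second dense set, inside \<open>U\<close>: elements of \<open>D1\<close> close
    to some \<open>s\<close> need not lie in \<open>U\<close>, while \<open>k_U\<close> speaks of
    members of \<open>U\<close>.\<close>
  obtain D2 where D2: "countable D2" "D2 \<subseteq> U" "\<And>f e. f \<in> U \<Longrightarrow> 0 < e \<Longrightarrow> \<exists>d\<in>D2. dist f d < e"
    using countable_dense_subset_bcontfun[OF compact, of U] by blast
  define D where "D = D1 \<union> D2 \<union> {const_bcontfun 1}"
  have D: "countable D" using D1 D2 by (simp add: D_def)
  have dense: "\<exists>d\<in>D. dist f d < e" if "0 < e" for f e
    using D1(2)[OF that, of f] by (auto simp: D_def)
  have "AE x in \<mu>. (\<forall>c\<in>D. \<forall>d\<in>D. \<forall>e\<in>D. \<forall>r\<in>\<rat>. \<bar>k c x - k d x - r * k e x\<bar> \<le> norm (c - d - r *\<^sub>R e)) \<and>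
      (\<forall>s\<in>D2 \<union> {const_bcontfun 1}. k s x = apply_bcontfun s x)" (is "AE x in \<mu>. ?good x")
    using D2 U(2) by (intro AE_conjI AE_ball_countable' D countable_rat k_lin k_U) auto
  then obtain N where N: "N \<in> null_sets \<mu>" and N_good: "{x \<in> space \<mu>. \<not> ?good x} \<subseteq> N"
    unfolding eventually_ae_filter by blast
  have "?good x" if "x \<notin> N" for x
  proof -
    have "x \<in> space \<mu>" using sets_eq_imp_space_eq[OF sets(1)] by simp
    with that N_good show ?thesis by blast
  qed
  then have good: "\<And>x c d e r. x \<notin> N \<Longrightarrow> c \<in> D \<Longrightarrow> d \<in> D \<Longrightarrow> e \<in> D \<Longrightarrow> r \<in> \<rat> \<Longrightarrow>
      \<bar>k c x - k d x - r * k e x\<bar> \<le> norm (c - d - r *\<^sub>R e)"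
    and good_U: "\<And>x s. x \<notin> N \<Longrightarrow> s \<in> D2 \<union> {const_bcontfun 1} \<Longrightarrow> k s x = apply_bcontfun s x"
    by blast+
  have N_borel [measurable]: "N \<in> sets borel" using N sets by auto
  have "\<exists>M. prob_space M \<and> sets M = sets borel \<and> (\<forall>d\<in>D. (\<integral>y. apply_bcontfun d y \<partial>M) = k d x)" if x: "x \<notin> N" for x
  proof -
    obtain M where "prob_space M" "sets M = sets borel" "\<And>d. d \<in> D \<Longrightarrow> (\<integral>x. apply_bcontfun d x \<partial>M) = k d x"
    proof (rule prob_measure_of_dense_functional[OF compact dense, of "\<lambda>d. k d x"])
      show "k (const_bcontfun 1) x = 1"
        using good_U[OF x, of "const_bcontfun 1"] by (simp add: const_bcontfun.rep_eq)
    qed (use good[OF x] in \<open>auto simp: D_def\<close>)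
    then show ?thesis by blast
  qed
  then obtain \<Lambda>0 where \<Lambda>0: "\<And>x. x \<notin> N \<Longrightarrow> prob_space (\<Lambda>0 x)" "\<And>x. x \<notin> N \<Longrightarrow> sets (\<Lambda>0 x) = sets borel"
    "\<And>x d. x \<notin> N \<Longrightarrow> d \<in> D \<Longrightarrow> (\<integral>y. apply_bcontfun d y \<partial>\<Lambda>0 x) = k d x"
    by metis
  define \<Lambda> where "\<Lambda> x = (if x \<in> N then return borel x else \<Lambda>0 x)" for x
  have prob_\<Lambda>: "prob_space (\<Lambda> x)" and sets_\<Lambda>: "sets (\<Lambda> x) = sets borel" for x
    using \<Lambda>0 by (auto simp: \<Lambda>_def prob_space_return)
  have ret: "(\<integral>y. apply_bcontfun f y \<partial>\<Lambda> x) = apply_bcontfun f x" if "x \<in> N" for f :: "'a \<Rightarrow>\<^sub>C real" and x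
    using that by (simp add: \<Lambda>_def integral_return borel_measurable_continuous_onI)
  have \<Lambda>_D: "(\<integral>y. apply_bcontfun d y \<partial>\<Lambda> x) = (if x \<in> N then apply_bcontfun d x else k d x)" if "d \<in> D" for d x
    using ret[of x d] \<Lambda>0(3)[OF _ that] by (simp add: \<Lambda>_def)
  have "\<exists>d. (\<forall>n. d n \<in> D) \<and> (\<forall>n. dist f (d n) < 1 / Suc n)" for f
  proof -
    have "\<forall>n. \<exists>e. e \<in> D \<and> dist f e < 1 / Suc n"
      using dense by (auto simp: Bex_def)
    from choice[OF this] show ?thesis by blast
  qed
  then obtain d where d: "\<And>f n. d f n \<in> D" "\<And>f n. dist f (d f n) < 1 / Suc n" by metis
  have conv: "u \<longlonglongrightarrow> l" if "\<And>n. \<bar>u n - l\<bar> \<le> 1 / Suc n" for u and l :: real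
  proof -
    have "(\<lambda>n. u n - l) \<longlonglongrightarrow> 0"
      by (rule Lim_null_comparison[OF _ LIMSEQ_inverse_real_of_nat])
         (use that in \<open>auto simp: inverse_eq_divide\<close>)
    then show ?thesis by (simp add: LIM_zero_iff)
  qed
  have approx: "\<bar>(\<integral>y. apply_bcontfun (d f n) y \<partial>M) - (\<integral>y. apply_bcontfun f y \<partial>M)\<bar> \<le> 1 / Suc n"
    if "prob_space M" "sets M = sets borel" for f n M
    using order_trans[OF dist_integral_bcontfun_le[OF that] less_imp_le[OF d(2)[of f n, unfolded dist_commute[of f]]]] .
  have meas: "(\<lambda>x. \<integral>y. apply_bcontfun f y \<partial>\<Lambda> x) \<in> borel_measurable borel" for f :: "'a \<Rightarrow>\<^sub>C real"
  proof (rule borel_measurable_LIMSEQ_real)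
    show "(\<lambda>n. \<integral>y. apply_bcontfun (d f n) y \<partial>\<Lambda> x) \<longlonglongrightarrow> (\<integral>y. apply_bcontfun f y \<partial>\<Lambda> x)" for x
      by (rule conv) (rule approx[OF prob_\<Lambda> sets_\<Lambda>])
    have [measurable]: "apply_bcontfun g \<in> borel_measurable borel" for g :: "'a \<Rightarrow>\<^sub>C real"
      by (rule borel_measurable_continuous_onI) simp
    show "(\<lambda>x. \<integral>y. apply_bcontfun (d f n) y \<partial>\<Lambda> x) \<in> borel_measurable borel" for n
      unfolding \<Lambda>_D[OF d(1)] using k(2) by measurable
  qed
  have on_U: "(\<integral>y. apply_bcontfun s y \<partial>\<Lambda> x) = apply_bcontfun s x" if s: "s \<in> U" for s x
  proof (cases "x \<in> N")
    case False
    have "\<forall>n. \<exists>t. t \<in> D2 \<and> dist s t < 1 / Suc n"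
      using D2(3)[OF s] by (auto simp: Bex_def)
    from choice[OF this] obtain t where t: "\<And>n. t n \<in> D2" "\<And>n. dist s (t n) < 1 / Suc n" by blast
    have eq: "(\<integral>y. apply_bcontfun (t n) y \<partial>\<Lambda> x) = apply_bcontfun (t n) x" for n
      using t(1)[of n] False good_U[OF False, of "t n"] by (subst \<Lambda>_D) (auto simp: D_def)
    have "(\<lambda>n. apply_bcontfun (t n) x) \<longlonglongrightarrow> (\<integral>y. apply_bcontfun s y \<partial>\<Lambda> x)"
      unfolding eq[symmetric]
      by (rule conv, rule order_trans[OF dist_integral_bcontfun_le[OF prob_\<Lambda> sets_\<Lambda>]])
         (use t(2) in \<open>simp add: dist_commute less_imp_le\<close>)
    moreover have "(\<lambda>n. apply_bcontfun (t n) x) \<longlonglongrightarrow> apply_bcontfun s x"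
      by (rule conv, rule order_trans[OF dist_bounded[of "t n" x s for n, unfolded dist_real_def]])
         (use t(2) in \<open>simp add: dist_commute less_imp_le\<close>)
    ultimately show ?thesis by (rule LIMSEQ_unique)
  qed (rule ret)
  have "(\<integral>x. \<integral>y. apply_bcontfun f y \<partial>\<Lambda> x \<partial>\<mu>) = (\<integral>y. apply_bcontfun f y \<partial>\<nu>)" for f :: "'a \<Rightarrow>\<^sub>C real"
  proof (rule LIMSEQ_unique)
    have int: "integrable \<mu> (\<lambda>x. \<integral>y. apply_bcontfun g y \<partial>\<Lambda> x)" for g :: "'a \<Rightarrow>\<^sub>C real"
    proof (rule \<mu>.integrable_const_bound[where B="norm g"])
      show "(\<lambda>x. \<integral>y. apply_bcontfun g y \<partial>\<Lambda> x) \<in> borel_measurable \<mu>"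
        using meas sets by (simp cong: measurable_cong_sets)
      show "AE x in \<mu>. norm (\<integral>y. apply_bcontfun g y \<partial>\<Lambda> x) \<le> norm g"
        using dist_integral_bcontfun_le[OF prob_\<Lambda> sets_\<Lambda>, where f=g and g=0] by simp
    qed
    show "(\<lambda>n. \<integral>x. \<integral>y. apply_bcontfun (d f n) y \<partial>\<Lambda> x \<partial>\<mu>) \<longlonglongrightarrow> (\<integral>x. \<integral>y. apply_bcontfun f y \<partial>\<Lambda> x \<partial>\<mu>)"
    proof (rule conv)
      fix n
      have "(\<integral>x. \<integral>y. apply_bcontfun (d f n) y \<partial>\<Lambda> x \<partial>\<mu>) - (\<integral>x. \<integral>y. apply_bcontfun f y \<partial>\<Lambda> x \<partial>\<mu>)
        = (\<integral>x. (\<integral>y. apply_bcontfun (d f n) y \<partial>\<Lambda> x) - (\<integral>y. apply_bcontfun f y \<partial>\<Lambda> x) \<partial>\<mu>)"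
        using int by simp
      also have "\<bar>\<dots>\<bar> \<le> (\<integral>x. 1 / Suc n \<partial>\<mu>)"
        by (rule order_trans[OF integral_abs_bound], rule integral_mono)
           (use int approx[OF prob_\<Lambda> sets_\<Lambda>] in \<open>auto intro!: integrable_abs\<close>)
      also have "\<dots> = 1 / Suc n" by (simp add: \<mu>.prob_space)
      finally show "\<bar>(\<integral>x. \<integral>y. apply_bcontfun (d f n) y \<partial>\<Lambda> x \<partial>\<mu>) - (\<integral>x. \<integral>y. apply_bcontfun f y \<partial>\<Lambda> x \<partial>\<mu>)\<bar> \<le> 1 / Suc n" .
    qed
    have "(\<integral>x. \<integral>y. apply_bcontfun (d f n) y \<partial>\<Lambda> x \<partial>\<mu>) = (\<integral>y. apply_bcontfun (d f n) y \<partial>\<nu>)" for n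
      unfolding k_int[symmetric]
    proof (rule integral_cong_AE)
      show "AE x in \<mu>. (\<integral>y. apply_bcontfun (d f n) y \<partial>\<Lambda> x) = k (d f n) x"
        using AE_not_in[OF N] by eventually_elim (simp add: \<Lambda>_D[OF d(1)])
    qed (use k int in auto)
    then show "(\<lambda>n. \<integral>x. \<integral>y. apply_bcontfun (d f n) y \<partial>\<Lambda> x \<partial>\<mu>) \<longlonglongrightarrow> (\<integral>y. apply_bcontfun f y \<partial>\<nu>)"
      by (simp only:) (rule conv, rule approx[OF prob(2) sets(2)])
  qed
  with prob_\<Lambda> sets_\<Lambda> meas on_U that show ?thesis by blast
qed

end

section \<open>Mean square approximation\<close>

text \<open>Induction over integrable functions. For indicators, the sets that can be approximated
  contain the closed sets and are stable under complements and countable disjoint unions, hence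
  include all Borel sets; finiteness of \<open>M\<close> lets a union be truncated.\<close>

lemma integrable_bcontfun_approx:
  fixes f :: "'a::metric_space \<Rightarrow> complex"
  assumes compact: "compact (UNIV :: 'a set)" and M: "finite_measure M" "sets M = sets borel"
    and f: "integrable M f" and "0 < e"
  shows "\<exists>c :: 'a \<Rightarrow>\<^sub>C complex. (\<integral>x. norm (f x - apply_bcontfun c x) \<partial>M) < e"
  using f \<open>0 < e\<close>
proof (induction arbitrary: e rule: integrable_induct)
  case (base A z)
  interpret finite_measure M by fact
  have c_int: "integrable M (apply_bcontfun c)" for c :: "'a \<Rightarrow>\<^sub>C real"
    by (rule integrable_bcontfun[OF M])
  have closed_Pow: "{K :: 'a set. closed K} \<subseteq> Pow UNIV" by simp
  have real_approx: "\<forall>e>0. \<exists>c :: 'a \<Rightarrow>\<^sub>C real. (\<integral>x. \<bar>indicator A x - apply_bcontfun c x\<bar> \<partial>M) < e"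
    if "A \<in> sigma_sets UNIV {K. closed K}" for A :: "'a set"
    using Int_stable_closed closed_Pow that
  proof (induction A rule: sigma_sets_induct_disjoint)
    case (basic K)
    show ?case
    proof safe
      fix e :: real assume "e > 0"
      obtain g :: "nat \<Rightarrow> 'a \<Rightarrow> real"
        where g: "\<And>n. continuous_on UNIV (g n)" "\<And>n x. 0 \<le> g n x" "\<And>n x. g n x \<le> 1"
          "\<And>x. (\<lambda>n. g n x) \<longlonglongrightarrow> indicator K x"
        using indicator_closed_limit[of K] basic by auto
      have [measurable]: "K \<in> sets M" "g n \<in> borel_measurable M" for n
        using basic M(2) g(1) by (auto intro: borel_measurable_continuous_on_UNIV)
      have "(\<lambda>n. \<integral>x. \<bar>indicator K x - g n x\<bar> \<partial>M) \<longlonglongrightarrow> (\<integral>x. \<bar>indicator K x - indicator K x\<bar> \<partial>M)"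
      proof (rule integral_dominated_convergence[where w="\<lambda>_. 1"])
        show "AE x in M. norm \<bar>indicator K x - g n x\<bar> \<le> 1" for n
        proof (rule AE_I2)
          fix x show "norm \<bar>indicator K x - g n x\<bar> \<le> 1"
            using g(2)[of n x] g(3)[of n x] by (auto simp: indicator_def)
        qed
        show "AE x in M. (\<lambda>n. \<bar>indicator K x - g n x\<bar>) \<longlonglongrightarrow> \<bar>indicator K x - indicator K x\<bar>"
          by (intro AE_I2 tendsto_intros g)
      qed auto
      then have "\<forall>\<^sub>F n in sequentially. (\<integral>x. \<bar>indicator K x - g n x\<bar> \<partial>M) < e"
        using \<open>e > 0\<close> by (intro order_tendstoD) auto
      then obtain n where "(\<integral>x. \<bar>indicator K x - g n x\<bar> \<partial>M) < e"
        by (auto simp: eventually_sequentially)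
      then show "\<exists>c :: 'a \<Rightarrow>\<^sub>C real. (\<integral>x. \<bar>indicator K x - apply_bcontfun c x\<bar> \<partial>M) < e"
        by (intro exI[of _ "Bcontfun (g n)"]) (simp add: apply_bcontfun_Bcontfun[OF compact] g(1))
    qed
  next
    case empty
    show ?case by (auto intro!: exI[of _ 0])
  next
    case (compl A)
    show ?case
    proof safe
      fix e :: real assume "e > 0"
      with compl obtain c :: "'a \<Rightarrow>\<^sub>C real" where "(\<integral>x. \<bar>indicator A x - apply_bcontfun c x\<bar> \<partial>M) < e"
        by blast
      moreover have "\<bar>indicator (UNIV - A) x - apply_bcontfun (const_bcontfun 1 - c) x\<bar> = \<bar>indicator A x - apply_bcontfun c x\<bar>" for x
        by (auto simp: indicator_def const_bcontfun.rep_eq)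
      ultimately show "\<exists>c :: 'a \<Rightarrow>\<^sub>C real. (\<integral>x. \<bar>indicator (UNIV - A) x - apply_bcontfun c x\<bar> \<partial>M) < e"
        by (intro exI[of _ "const_bcontfun 1 - c"]) simp
    qed
  next
    case (union A)
    show ?case
    proof safe
      fix e :: real assume "e > 0"
      have [measurable]: "A i \<in> sets M" for i
        using union(2) M(2) by (auto simp: sets_borel_sigma_closed)
      have "(\<lambda>n. \<integral>x. \<bar>indicator (\<Union>i. A i) x - indicator (\<Union>i<n. A i) x\<bar> \<partial>M) \<longlonglongrightarrow> (\<integral>x. \<bar>indicator (\<Union>i. A i) x - indicator (\<Union>i. A i) x :: real\<bar> \<partial>M)"
      proof (rule integral_dominated_convergence[where w="\<lambda>_. 1"])
        show "AE x in M. norm \<bar>indicator (\<Union>i. A i) x - indicator (\<Union>i<n. A i) x :: real\<bar> \<le> 1" for n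
          by (rule AE_I2) (auto simp: indicator_def)
        show "AE x in M. (\<lambda>n. \<bar>indicator (\<Union>i. A i) x - indicator (\<Union>i<n. A i) x\<bar>) \<longlonglongrightarrow> \<bar>indicator (\<Union>i. A i) x - indicator (\<Union>i. A i) x :: real\<bar>"
          by (intro AE_I2 tendsto_intros LIMSEQ_indicator_UN)
      qed auto
      then have "\<forall>\<^sub>F n in sequentially. (\<integral>x. \<bar>indicator (\<Union>i. A i) x - indicator (\<Union>i<n. A i) x\<bar> \<partial>M) < e / 2"
        using \<open>e > 0\<close> by (intro order_tendstoD) auto
      then obtain n where n: "(\<integral>x. \<bar>indicator (\<Union>i. A i) x - indicator (\<Union>i<n. A i) x\<bar> \<partial>M) < e / 2"
        by (auto simp: eventually_sequentially)
      \<comment> \<open>The \<open>n\<close> errors add up to at most \<open>e / 2\<close>;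
        \<open>Suc n\<close> keeps the denominator positive when \<open>n\<close> is 0.\<close>
      have "\<exists>c :: 'a \<Rightarrow>\<^sub>C real. (\<integral>x. \<bar>indicator (A i) x - apply_bcontfun c x\<bar> \<partial>M) < e / (2 * Suc n)" for i
        using union(3)[of i] \<open>e > 0\<close> by (auto simp: zero_less_mult_iff)
      then obtain c :: "nat \<Rightarrow> 'a \<Rightarrow>\<^sub>C real"
        where c: "\<And>i. (\<integral>x. \<bar>indicator (A i) x - apply_bcontfun (c i) x\<bar> \<partial>M) < e / (2 * Suc n)"
        by metis
      have A_int: "integrable M (indicator (A i) :: 'a \<Rightarrow> real)" for i
        by (auto simp: less_top[symmetric])
      have UN_sum: "indicator (\<Union>i<n. A i) x = (\<Sum>i<n. indicator (A i) x :: real)" for x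
        using union(1) by (intro indicator_UN_disjoint) (auto simp: disjoint_family_on_def)
      have app_sum: "apply_bcontfun (\<Sum>i<n. c i) x = (\<Sum>i<n. apply_bcontfun (c i) x)" for n x
        by (induction n) auto
      have "(\<integral>x. \<bar>indicator (\<Union>i. A i) x - apply_bcontfun (\<Sum>i<n. c i) x\<bar> \<partial>M)
        \<le> (\<integral>x. \<bar>indicator (\<Union>i. A i) x - indicator (\<Union>i<n. A i) x\<bar> + (\<Sum>i<n. \<bar>indicator (A i) x - apply_bcontfun (c i) x\<bar>) \<partial>M)"
      proof (rule integral_mono)
        fix x
        have "\<bar>indicator (\<Union>i<n. A i) x - apply_bcontfun (\<Sum>i<n. c i) x\<bar> \<le> (\<Sum>i<n. \<bar>indicator (A i) x - apply_bcontfun (c i) x\<bar>)"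
          unfolding UN_sum app_sum sum_subtractf[symmetric] by (rule sum_abs)
        then show "\<bar>indicator (\<Union>i. A i) x - apply_bcontfun (\<Sum>i<n. c i) x\<bar>
          \<le> \<bar>indicator (\<Union>i. A i) x - indicator (\<Union>i<n. A i) x\<bar> + (\<Sum>i<n. \<bar>indicator (A i) x - apply_bcontfun (c i) x\<bar>)"
          by linarith
      qed (auto intro!: integrable_abs Bochner_Integration.integrable_add Bochner_Integration.integrable_diff
          Bochner_Integration.integrable_sum c_int simp: less_top[symmetric])
      also have "\<dots> = (\<integral>x. \<bar>indicator (\<Union>i. A i) x - indicator (\<Union>i<n. A i) x\<bar> \<partial>M) + (\<Sum>i<n. \<integral>x. \<bar>indicator (A i) x - apply_bcontfun (c i) x\<bar> \<partial>M)"
        using A_int c_int by (subst Bochner_Integration.integral_add)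
          (auto intro!: integrable_abs Bochner_Integration.integrable_diff Bochner_Integration.integrable_sum simp: less_top[symmetric])
      also have "\<dots> < e / 2 + e / 2"
      proof (rule add_less_le_mono[OF n])
        have "(\<Sum>i<n. \<integral>x. \<bar>indicator (A i) x - apply_bcontfun (c i) x\<bar> \<partial>M) \<le> (\<Sum>i<n. e / (2 * Suc n))"
          using c by (intro sum_mono less_imp_le)
        also have "\<dots> \<le> e / 2" using \<open>e > 0\<close> by (simp add: field_simps)
        finally show "(\<Sum>i<n. \<integral>x. \<bar>indicator (A i) x - apply_bcontfun (c i) x\<bar> \<partial>M) \<le> e / 2" .
      qed
      finally show "\<exists>c :: 'a \<Rightarrow>\<^sub>C real. (\<integral>x. \<bar>indicator (\<Union>i. A i) x - apply_bcontfun c x\<bar> \<partial>M) < e"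
        by (intro exI[of _ "\<Sum>i<n. c i"]) simp
    qed
  qed
  have "A \<in> sigma_sets UNIV {K. closed K}"
    using base(1) M(2) by (simp add: sets_borel_sigma_closed)
  \<comment> \<open>The error gets multiplied by \<open>norm z\<close>, which may be 0; hence the 1
    in the denominator.\<close>
  from real_approx[OF this] obtain c :: "'a \<Rightarrow>\<^sub>C real"
    where c: "(\<integral>x. \<bar>indicator A x - apply_bcontfun c x\<bar> \<partial>M) < e / (norm z + 1)"
    using base(3) norm_ge_zero[of z] by (meson add_nonneg_pos divide_pos_pos zero_less_one)
  have zc: "apply_bcontfun (const_mult z (of_real_fun c)) x = z * of_real (apply_bcontfun c x)" for x
    by (simp add: const_mult.rep_eq of_real_fun.rep_eq)
  have "(\<integral>x. norm (indicator A x *\<^sub>R z - apply_bcontfun (const_mult z (of_real_fun c)) x) \<partial>M)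
    = (\<integral>x. norm z * \<bar>indicator A x - apply_bcontfun c x\<bar> \<partial>M)"
  proof (rule Bochner_Integration.integral_cong)
    fix x
    have "indicator A x *\<^sub>R z - apply_bcontfun (const_mult z (of_real_fun c)) x
      = z * of_real (indicator A x - apply_bcontfun c x)"
      by (simp add: zc scaleR_conv_of_real algebra_simps)
    then show "norm (indicator A x *\<^sub>R z - apply_bcontfun (const_mult z (of_real_fun c)) x) = norm z * \<bar>indicator A x - apply_bcontfun c x\<bar>"
      by (simp only: norm_mult norm_of_real)
  qed simp
  also have "\<dots> \<le> norm z * (e / (norm z + 1))"
    unfolding integral_mult_right_zero using c by (intro mult_left_mono) auto
  also have "\<dots> < e"
  proof -
    have "0 < norm z + 1" by (simp add: add_nonneg_pos)
    then show ?thesis using base(3) by (simp add: divide_less_eq algebra_simps)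
  qed
  finally show ?case by blast
next
  case (add f g)
  obtain c d :: "'a \<Rightarrow>\<^sub>C complex" where c: "(\<integral>x. norm (f x - apply_bcontfun c x) \<partial>M) < e / 2"
    and d: "(\<integral>x. norm (g x - apply_bcontfun d x) \<partial>M) < e / 2"
    using add.IH(1)[of "e / 2"] add.IH(2)[of "e / 2"] add.prems by auto
  have int: "integrable M (\<lambda>x. norm (f x - apply_bcontfun c x))" "integrable M (\<lambda>x. norm (g x - apply_bcontfun d x))"
    "integrable M (\<lambda>x. norm (f x + g x - apply_bcontfun (c + d) x))"
    using add.hyps by (auto intro!: integrable_norm Bochner_Integration.integrable_diff Bochner_Integration.integrable_add integrable_bcontfun[OF M])
  have "(\<integral>x. norm (f x + g x - apply_bcontfun (c + d) x) \<partial>M)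
    \<le> (\<integral>x. norm (f x - apply_bcontfun c x) + norm (g x - apply_bcontfun d x) \<partial>M)"
    using int by (intro integral_mono) (auto simp: add_diff_add intro: norm_triangle_ineq)
  also have "\<dots> < e" using int c d by simp
  finally show ?case by blast
next
  case (lim f s)
  \<comment> \<open>The approximants satisfy \<open>norm (s i x) \<le> 2 * norm (f x)\<close>,
    whence the factor 3 in the majorant.\<close>
  have "(\<lambda>i. \<integral>x. norm (f x - s i x) \<partial>M) \<longlonglongrightarrow> (\<integral>x. norm (f x - f x) \<partial>M)"
  proof (rule integral_dominated_convergence[where w="\<lambda>x. 3 * norm (f x)"])
    show "AE x in M. (\<lambda>i. norm (f x - s i x)) \<longlonglongrightarrow> norm (f x - f x)"
      using lim.hyps by (intro AE_I2 tendsto_intros) auto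
    show "AE x in M. norm (norm (f x - s i x)) \<le> 3 * norm (f x)" for i
    proof (rule AE_I2)
      fix x assume "x \<in> space M"
      then show "norm (norm (f x - s i x)) \<le> 3 * norm (f x)"
        using norm_triangle_ineq4[of "f x" "s i x"] lim.hyps(3)[of x i] by simp
    qed
  qed (use lim.hyps in auto)
  then have "\<forall>\<^sub>F i in sequentially. (\<integral>x. norm (f x - s i x) \<partial>M) < e / 2"
    using lim.prems by (intro order_tendstoD) auto
  then obtain i where i: "(\<integral>x. norm (f x - s i x) \<partial>M) < e / 2"
    by (auto simp: eventually_sequentially)
  obtain c where c: "(\<integral>x. norm (s i x - apply_bcontfun c x) \<partial>M) < e / 2"
    using lim.IH[of "e / 2" i] lim.prems by auto
  have int: "integrable M (\<lambda>x. norm (f x - s i x))" "integrable M (\<lambda>x. norm (s i x - apply_bcontfun c x))"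
    "integrable M (\<lambda>x. norm (f x - apply_bcontfun c x))"
    using lim.hyps by (auto intro!: integrable_norm Bochner_Integration.integrable_diff integrable_bcontfun[OF M])
  have "(\<integral>x. norm (f x - apply_bcontfun c x) \<partial>M) \<le> (\<integral>x. norm (f x - s i x) + norm (s i x - apply_bcontfun c x) \<partial>M)"
    using int by (intro integral_mono) (auto simp flip: dist_norm intro: dist_triangle)
  also have "\<dots> < e" using int i c by simp
  finally show ?case by blast
qed

locale borel_prob = prob_space \<mu> for \<mu> :: "'a::metric_space measure" +
  assumes compact: "compact (UNIV :: 'a set)" and sets_eq: "sets \<mu> = sets borel"
begin

lemma space_eq [simp]: "space \<mu> = UNIV"
  using sets_eq_imp_space_eq[OF sets_eq] by simp

lemma measurable_bcontfun [measurable]: "apply_bcontfun f \<in> borel_measurable \<mu>"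
  by (rule borel_measurable_continuous_on_UNIV[OF sets_eq]) simp

text \<open>Bounds hold at every point, not only almost everywhere, so that multiplication by such a
  function can be estimated pointwise.\<close>

definition bm :: "('a \<Rightarrow> complex) set" where
  "bm = {f \<in> borel_measurable \<mu>. \<exists>K. \<forall>x. norm (f x) \<le> K}"

lemma bm_measurable [measurable_dest]: "f \<in> bm \<Longrightarrow> f \<in> borel_measurable \<mu>"
  by (simp add: bm_def)

lemma bmI: "f \<in> borel_measurable \<mu> \<Longrightarrow> (\<And>x. norm (f x) \<le> K) \<Longrightarrow> f \<in> bm"
  by (auto simp: bm_def)

lemma bm_apply [simp, intro]: "apply_bcontfun f \<in> bm"
  by (rule bmI[of _ "norm f"]) (auto simp: norm_bounded)

lemma bm_const [simp, intro]: "(\<lambda>_. c) \<in> bm"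
  by (rule bmI[of _ "norm c"]) auto

lemma bm_add [simp, intro]: "f \<in> bm \<Longrightarrow> g \<in> bm \<Longrightarrow> (\<lambda>x. f x + g x) \<in> bm"
  unfolding bm_def by (auto intro!: borel_measurable_add) (meson norm_triangle_ineq add_mono order_trans)

lemma bm_diff [simp, intro]: "f \<in> bm \<Longrightarrow> g \<in> bm \<Longrightarrow> (\<lambda>x. f x - g x) \<in> bm"
  unfolding bm_def by (auto intro!: borel_measurable_diff) (meson norm_triangle_ineq4 add_mono order_trans)

lemma bm_mult [simp, intro]:
  assumes "f \<in> bm" "g \<in> bm"
  shows "(\<lambda>x. f x * g x) \<in> bm"
proof -
  obtain K L where "\<And>x. norm (f x) \<le> K" "\<And>x. norm (g x) \<le> L"
    using assms by (auto simp: bm_def)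
  then have "norm (f x * g x) \<le> K * L" for x
    unfolding norm_mult by (intro mult_mono) (auto intro: order_trans[OF norm_ge_zero])
  with assms show ?thesis by (auto intro!: bmI)
qed

lemma bm_cnj [simp, intro]: "f \<in> bm \<Longrightarrow> (\<lambda>x. cnj (f x)) \<in> bm"
  unfolding bm_def
  using measurable_compose[of f \<mu> borel cnj borel] borel_measurable_continuous_onI[of cnj]
  by (auto intro!: continuous_intros)

lemma bm_integrable [simp, intro]: "f \<in> bm \<Longrightarrow> integrable \<mu> f"
  by (auto simp: bm_def intro: integrable_const_bound)

lemma bm_integrable_norm_mult: "f \<in> bm \<Longrightarrow> g \<in> bm \<Longrightarrow> integrable \<mu> (\<lambda>x. norm (f x) * norm (g x))"
  using integrable_norm[OF bm_integrable[OF bm_mult, of f g]] by (simp add: norm_mult)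

section \<open>Seminorm and inner product of bounded measurable functions\<close>

definition l2 :: "('a \<Rightarrow> complex) \<Rightarrow> real" where
  "l2 f = sqrt (\<integral>x. norm (f x) * norm (f x) \<partial>\<mu>)"

definition ip :: "('a \<Rightarrow> complex) \<Rightarrow> ('a \<Rightarrow> complex) \<Rightarrow> complex" where
  "ip f g = (\<integral>x. f x * cnj (g x) \<partial>\<mu>)"

lemma l2_nonneg [simp]: "0 \<le> l2 f"
  by (simp add: l2_def)

lemma l2_square: "(l2 f)\<^sup>2 = (\<integral>x. norm (f x) * norm (f x) \<partial>\<mu>)"
  by (simp add: l2_def)

lemma integral_norm_mult_le:
  assumes "f \<in> bm" "g \<in> bm"
  shows "(\<integral>x. norm (f x) * norm (g x) \<partial>\<mu>) \<le> l2 f * l2 g"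
proof -
  define a where "a = (\<integral>x. norm (f x) * norm (f x) \<partial>\<mu>)"
  define b where "b = (\<integral>x. norm (g x) * norm (g x) \<partial>\<mu>)"
  define c where "c = (\<integral>x. norm (f x) * norm (g x) \<partial>\<mu>)"
  have c: "0 \<le> c" unfolding c_def by (intro integral_nonneg_AE) simp
  have b: "0 \<le> b" unfolding b_def by (intro integral_nonneg_AE) simp
  have quad: "0 \<le> a - 2 * s * c + s * s * b" for s
  proof -
    have "0 \<le> (\<integral>x. (norm (f x) - s * norm (g x))\<^sup>2 \<partial>\<mu>)" by (intro integral_nonneg_AE) simp
    also have "\<dots> = (\<integral>x. norm (f x) * norm (f x) - 2 * s * (norm (f x) * norm (g x)) + s * s * (norm (g x) * norm (g x)) \<partial>\<mu>)"
      by (rule Bochner_Integration.integral_cong) (auto simp: power2_eq_square algebra_simps)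
    also have "\<dots> = a - 2 * s * c + s * s * b"
      unfolding a_def b_def c_def using assms by (simp add: bm_integrable_norm_mult)
    finally show ?thesis .
  qed
  have "c\<^sup>2 \<le> a * b"
  proof (cases "b = 0")
    case True
    have "c = 0"
    proof (rule ccontr)
      assume "c \<noteq> 0"
      \<comment> \<open>With \<open>b = 0\<close> the quadratic is linear in \<open>s\<close> and
        takes the value -1 here.\<close>
      with quad[of "(a + 1) / (2 * c)"] True show False by simp
    qed
    with True show ?thesis by simp
  next
    case False
    with b have "b > 0" by simp
    \<comment> \<open>\<open>c / b\<close> minimizes the quadratic in \<open>s\<close>.\<close>
    with quad[of "c / b"] show ?thesis by (simp add: field_simps power2_eq_square)
  qed
  then have "sqrt (c\<^sup>2) \<le> sqrt (a * b)" by (rule real_sqrt_le_mono)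
  then show ?thesis
    using c by (simp add: real_sqrt_mult l2_def flip: a_def b_def c_def)
qed

lemma norm_ip_le:
  assumes "f \<in> bm" "g \<in> bm"
  shows "norm (ip f g) \<le> l2 f * l2 g"
proof -
  have "norm (ip f g) \<le> (\<integral>x. norm (f x) * norm (g x) \<partial>\<mu>)"
    unfolding ip_def by (rule order_trans[OF integral_norm_bound]) (simp add: norm_mult)
  also note integral_norm_mult_le[OF assms]
  finally show ?thesis .
qed

lemma l2_mono:
  assumes "f \<in> bm" "g \<in> bm" "\<And>x. norm (f x) \<le> norm (g x)"
  shows "l2 f \<le> l2 g"
  unfolding l2_def using assms
  by (intro real_sqrt_le_mono integral_mono bm_integrable_norm_mult mult_mono) auto

lemma l2_triangle:
  assumes "f \<in> bm" "g \<in> bm"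
  shows "l2 (\<lambda>x. f x + g x) \<le> l2 f + l2 g"
proof (rule power2_le_imp_le)
  have "(l2 (\<lambda>x. f x + g x))\<^sup>2 \<le> (\<integral>x. norm (f x) * norm (f x) + 2 * (norm (f x) * norm (g x)) + norm (g x) * norm (g x) \<partial>\<mu>)"
    unfolding l2_square
  proof (rule integral_mono)
    fix x
    have "norm (f x + g x) * norm (f x + g x) \<le> (norm (f x) + norm (g x)) * (norm (f x) + norm (g x))"
      by (intro mult_mono norm_triangle_ineq) auto
    then show "norm (f x + g x) * norm (f x + g x) \<le> norm (f x) * norm (f x) + 2 * (norm (f x) * norm (g x)) + norm (g x) * norm (g x)"
      by (simp add: algebra_simps)
  qed (use assms in \<open>auto intro!: bm_integrable_norm_mult Bochner_Integration.integrable_add integrable_mult_right\<close>)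
  also have "\<dots> = (l2 f)\<^sup>2 + 2 * (\<integral>x. norm (f x) * norm (g x) \<partial>\<mu>) + (l2 g)\<^sup>2"
    unfolding l2_square using assms by (simp add: bm_integrable_norm_mult)
  also have "\<dots> \<le> (l2 f + l2 g)\<^sup>2"
    using integral_norm_mult_le[OF assms] by (simp add: power2_sum)
  finally show "(l2 (\<lambda>x. f x + g x))\<^sup>2 \<le> (l2 f + l2 g)\<^sup>2" .
qed simp

lemma l2_minus_commute: "l2 (\<lambda>x. f x - g x) = l2 (\<lambda>x. g x - f x)"
  by (simp add: l2_def norm_minus_commute)

lemma l2_triangle_diff:
  assumes "f \<in> bm" "g \<in> bm" "h \<in> bm"
  shows "l2 (\<lambda>x. f x - h x) \<le> l2 (\<lambda>x. f x - g x) + l2 (\<lambda>x. g x - h x)"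
  using l2_triangle[of "\<lambda>x. f x - g x" "\<lambda>x. g x - h x"] assms by simp

lemma l2_mult_le:
  assumes "f \<in> bm" "h \<in> borel_measurable \<mu>" "\<And>x. norm (h x) \<le> K"
  shows "l2 (\<lambda>x. h x * f x) \<le> K * l2 f"
proof -
  have K: "0 \<le> K" using order_trans[OF norm_ge_zero assms(3)] .
  have "l2 (\<lambda>x. h x * f x) \<le> l2 (\<lambda>x. of_real K * f x)"
    using assms bmI[OF assms(2,3)] K by (intro l2_mono) (auto simp: norm_mult intro!: mult_right_mono)
  also have "\<dots> = K * l2 f"
  proof -
    have "(\<integral>x. norm (of_real K * f x) * norm (of_real K * f x) \<partial>\<mu>) = K\<^sup>2 * (\<integral>x. norm (f x) * norm (f x) \<partial>\<mu>)"
      unfolding integral_mult_right_zero[symmetric]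
      by (rule Bochner_Integration.integral_cong) (auto simp: norm_mult power2_eq_square algebra_simps)
    with K show ?thesis by (simp add: l2_def real_sqrt_mult)
  qed
  finally show ?thesis .
qed

text \<open>Approximation in mean becomes approximation in mean square once the approximants are
  bounded. Clipping real and imaginary parts at \<open>K\<close> brings them no farther from those
  of \<open>g\<close> and bounds the modulus by \<open>2 * K\<close>. The bound is uniform in
  \<open>n\<close>, as \<open>mult_op_strong_limit\<close> requires.\<close>

lemma bcontfun_dense_l2:
  assumes g: "g \<in> borel_measurable \<mu>" "\<And>x. norm (g x) \<le> K"
  obtains c :: "nat \<Rightarrow> 'a \<Rightarrow>\<^sub>C complex"
  where "\<And>n x. norm (apply_bcontfun (c n) x) \<le> 2 * K"
    "(\<lambda>n. l2 (\<lambda>x. g x - apply_bcontfun (c n) x)) \<longlonglongrightarrow> 0"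
proof -
  have K: "0 \<le> K" using order_trans[OF norm_ge_zero g(2)] .
  have "\<exists>c. (\<forall>x. norm (apply_bcontfun c x) \<le> 2 * K) \<and> (l2 (\<lambda>x. g x - apply_bcontfun c x))\<^sup>2 \<le> 1 / Suc n" for n
  proof -
    \<comment> \<open>\<open>6 * K\<close> is \<open>3 * K\<close>, a bound of the difference after
      clipping, times 2, the factor lost by treating the two parts separately; the added 1 allows
      \<open>K = 0\<close>.\<close>
    define e where "e = 1 / (Suc n * (6 * K + 1))"
    have e: "0 < e" using K by (simp add: e_def add_nonneg_pos)
    obtain c :: "'a \<Rightarrow>\<^sub>C complex" where c: "(\<integral>x. norm (g x - apply_bcontfun c x) \<partial>\<mu>) < e"
      using integrable_bcontfun_approx[OF compact finite_measure_axioms sets_eq _ e] bmI[OF g] by blast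
    define clip where "clip t = max (- K) (min K t)" for t
    define c' where "c' = Bcontfun (\<lambda>x. Complex (clip (Re (apply_bcontfun c x))) (clip (Im (apply_bcontfun c x))))"
    have c': "apply_bcontfun c' = (\<lambda>x. Complex (clip (Re (apply_bcontfun c x))) (clip (Im (apply_bcontfun c x))))"
      unfolding c'_def Complex_eq clip_def
      by (intro apply_bcontfun_Bcontfun[OF compact] continuous_intros) auto
    have clip_le: "\<bar>clip t\<bar> \<le> K" for t using K by (auto simp: clip_def)
    have clip_dist: "\<bar>s - clip t\<bar> \<le> \<bar>s - t\<bar>" if "\<bar>s\<bar> \<le> K" for s t
      using that by (auto simp: clip_def)
    have bound: "norm (apply_bcontfun c' x) \<le> 2 * K" for x
      using cmod_le[of "apply_bcontfun c' x"] clip_le[of "Re (apply_bcontfun c x)"] clip_le[of "Im (apply_bcontfun c x)"]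
      by (simp add: c')
    have close: "norm (g x - apply_bcontfun c' x) \<le> 2 * norm (g x - apply_bcontfun c x)" for x
    proof -
      have "norm (g x - apply_bcontfun c' x) \<le> \<bar>Re (g x) - clip (Re (apply_bcontfun c x))\<bar> + \<bar>Im (g x) - clip (Im (apply_bcontfun c x))\<bar>"
        using cmod_le[of "g x - apply_bcontfun c' x"] by (simp add: c')
      also have "\<dots> \<le> \<bar>Re (g x) - Re (apply_bcontfun c x)\<bar> + \<bar>Im (g x) - Im (apply_bcontfun c x)\<bar>"
        using g(2)[of x] abs_Re_le_cmod[of "g x"] abs_Im_le_cmod[of "g x"]
        by (intro add_mono clip_dist) auto
      also have "\<dots> \<le> 2 * norm (g x - apply_bcontfun c x)"
        using abs_Re_le_cmod[of "g x - apply_bcontfun c x"] abs_Im_le_cmod[of "g x - apply_bcontfun c x"] by simp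
      finally show ?thesis .
    qed
    have "(l2 (\<lambda>x. g x - apply_bcontfun c' x))\<^sup>2 \<le> (\<integral>x. (6 * K) * norm (g x - apply_bcontfun c x) \<partial>\<mu>)"
      unfolding l2_square
    proof (rule integral_mono)
      fix x
      have "norm (g x - apply_bcontfun c' x) \<le> 3 * K"
        using norm_triangle_ineq4[of "g x" "apply_bcontfun c' x"] g(2)[of x] bound[of x] by linarith
      then have "norm (g x - apply_bcontfun c' x) * norm (g x - apply_bcontfun c' x) \<le> (3 * K) * (2 * norm (g x - apply_bcontfun c x))"
        using close[of x] K by (intro mult_mono) auto
      then show "norm (g x - apply_bcontfun c' x) * norm (g x - apply_bcontfun c' x) \<le> (6 * K) * norm (g x - apply_bcontfun c x)"
        by simp
    qed (use bmI[OF g] in \<open>auto intro!: bm_integrable_norm_mult integrable_mult_right integrable_norm bm_integrable\<close>)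
    also have "\<dots> \<le> (6 * K) * e" using c K by (simp add: mult_left_mono)
    also have "\<dots> \<le> (6 * K + 1) * e" using e by (simp add: algebra_simps)
    also have "\<dots> = 1 / Suc n" using K by (simp add: e_def field_simps add_nonneg_eq_0_iff)
    finally show ?thesis using bound by blast
  qed
  then obtain c where c: "\<And>n x. norm (apply_bcontfun (c n) x) \<le> 2 * K"
    "\<And>n. (l2 (\<lambda>x. g x - apply_bcontfun (c n) x))\<^sup>2 \<le> 1 / Suc n"
    by metis
  have "(\<lambda>n. (l2 (\<lambda>x. g x - apply_bcontfun (c n) x))\<^sup>2) \<longlonglongrightarrow> 0"
    by (rule Lim_null_comparison[OF _ LIMSEQ_inverse_real_of_nat])
       (use c(2) in \<open>auto simp: inverse_eq_divide\<close>)
  then have "(\<lambda>n. sqrt ((l2 (\<lambda>x. g x - apply_bcontfun (c n) x))\<^sup>2)) \<longlonglongrightarrow> sqrt 0"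
    by (rule tendsto_real_sqrt)
  then have "(\<lambda>n. l2 (\<lambda>x. g x - apply_bcontfun (c n) x)) \<longlonglongrightarrow> 0"
    by simp
  with c(1) that show ?thesis by blast
qed

end

section \<open>The GNS representation of a measure\<close>

context borel_prob
begin

abbreviation \<phi> :: "('a \<Rightarrow>\<^sub>C complex) \<Rightarrow> complex" where "\<phi> \<equiv> state_of \<mu>"
abbreviation H :: "'a gns_vector inner_space" where "H \<equiv> gns_space \<phi>"
abbreviation fn :: "('a \<Rightarrow>\<^sub>C complex) \<Rightarrow> 'a \<Rightarrow> complex" where "fn \<equiv> apply_bcontfun"
abbreviation cls :: "(nat \<Rightarrow> 'a \<Rightarrow>\<^sub>C complex) \<Rightarrow> 'a gns_vector" where "cls \<equiv> gns_class \<phi>"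

text \<open>Formulated for bounded measurable functions because multiplying a Cauchy sequence of
  continuous functions by such a function leaves the continuous ones.\<close>

definition l2_cauchy :: "(nat \<Rightarrow> 'a \<Rightarrow> complex) \<Rightarrow> bool" where
  "l2_cauchy u \<longleftrightarrow> (\<forall>n. u n \<in> bm) \<and> (\<forall>e>0. \<exists>N. \<forall>m\<ge>N. \<forall>n\<ge>N. l2 (\<lambda>x. u m x - u n x) < e)"

definition l2_null :: "(nat \<Rightarrow> 'a \<Rightarrow> complex) \<Rightarrow> (nat \<Rightarrow> 'a \<Rightarrow> complex) \<Rightarrow> bool" where
  "l2_null u v \<longleftrightarrow> (\<lambda>n. l2 (\<lambda>x. u n x - v n x)) \<longlonglongrightarrow> 0"

lemma fn_simps [simp]:
  "fn (cmult f g) = (\<lambda>x. fn f x * fn g x)" "fn (conj_fun f) = (\<lambda>x. cnj (fn f x))"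
  "fn (const_mult c f) = (\<lambda>x. c * fn f x)" "fn (const_bcontfun c) = (\<lambda>x. c)"
  by (auto simp: cmult.rep_eq conj_fun.rep_eq const_mult.rep_eq const_bcontfun.rep_eq)

lemma state_ip: "\<phi> (cmult (conj_fun g) f) = ip (fn f) (fn g)"
  by (simp add: state_of_def ip_def mult.commute)

lemma ip_self: "f \<in> bm \<Longrightarrow> ip f f = of_real ((l2 f)\<^sup>2)"
proof -
  have "(\<lambda>x. f x * cnj (f x)) = (\<lambda>x. complex_of_real (norm (f x) * norm (f x)))"
    by (rule ext) (metis complex_norm_square power2_eq_square)
  then show ?thesis unfolding ip_def l2_square by (simp only: integral_complex_of_real)
qed

lemma gns_seminorm_eq: "gns_seminorm \<phi> f = l2 (fn f)"
  by (simp add: gns_seminorm_def state_ip ip_self)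

lemma gns_cauchy_iff: "u \<in> gns_cauchy \<phi> \<longleftrightarrow> l2_cauchy (\<lambda>n. fn (u n))"
  by (simp add: gns_cauchy_def gns_seminorm_eq l2_cauchy_def minus_bcontfun.rep_eq[abs_def])

lemma gns_rel_iff: "(u, v) \<in> gns_rel \<phi> \<longleftrightarrow>
    u \<in> gns_cauchy \<phi> \<and> v \<in> gns_cauchy \<phi> \<and> l2_null (\<lambda>n. fn (u n)) (\<lambda>n. fn (v n))"
  by (simp add: gns_rel_def gns_seminorm_eq l2_null_def minus_bcontfun.rep_eq[abs_def])

lemma l2_null_refl [simp]: "l2_null u u"
  by (simp add: l2_null_def l2_def)

lemma l2_null_sym: "l2_null u v \<Longrightarrow> l2_null v u"
  unfolding l2_null_def by (subst l2_minus_commute)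

lemma tendsto_0_squeeze:
  fixes f g :: "nat \<Rightarrow> real"
  assumes "g \<longlonglongrightarrow> 0" "\<And>n. 0 \<le> f n" "\<And>n. f n \<le> g n"
  shows "f \<longlonglongrightarrow> 0"
  by (rule tendsto_sandwich[OF _ _ tendsto_const assms(1)]) (use assms in auto)

lemma l2_null_trans:
  assumes "l2_null u v" "l2_null v w" "\<And>n. u n \<in> bm" "\<And>n. v n \<in> bm" "\<And>n. w n \<in> bm"
  shows "l2_null u w"
  unfolding l2_null_def
  by (rule tendsto_0_squeeze[OF tendsto_add_zero[OF assms(1,2)[unfolded l2_null_def]]])
     (use assms l2_triangle_diff in auto)

lemma l2_null_add:
  assumes "l2_null u v" "l2_null u' v'" "\<And>n. u n \<in> bm" "\<And>n. v n \<in> bm" "\<And>n. u' n \<in> bm" "\<And>n. v' n \<in> bm"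
  shows "l2_null (\<lambda>n x. u n x + u' n x) (\<lambda>n x. v n x + v' n x)"
  unfolding l2_null_def add_diff_add
  by (rule tendsto_0_squeeze[OF tendsto_add_zero[OF assms(1,2)[unfolded l2_null_def]]])
     (use assms l2_triangle in auto)

lemma l2_null_mult:
  assumes "l2_null u v" "\<And>n. u n \<in> bm" "\<And>n. v n \<in> bm" and g: "g \<in> bm"
  shows "l2_null (\<lambda>n x. g x * u n x) (\<lambda>n x. g x * v n x)"
proof -
  obtain K where K: "\<And>x. norm (g x) \<le> K" using g by (auto simp: bm_def)
  show ?thesis
    unfolding l2_null_def right_diff_distrib[symmetric]
    by (rule tendsto_0_squeeze[OF tendsto_mult_right_zero[OF assms(1)[unfolded l2_null_def], of K]])
       (use assms K in \<open>auto intro!: l2_mult_le bm_measurable\<close>)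
qed

lemma l2_cauchy_bm: "l2_cauchy u \<Longrightarrow> u n \<in> bm"
  by (simp add: l2_cauchy_def)

lemma l2_cauchy_null:
  assumes u: "l2_cauchy u" and uv: "l2_null u v" and v: "\<And>n. v n \<in> bm"
  shows "l2_cauchy v"
  unfolding l2_cauchy_def
proof (intro conjI allI impI v)
  fix e :: real assume "0 < e"
  then obtain N where N: "\<And>m n. m \<ge> N \<Longrightarrow> n \<ge> N \<Longrightarrow> l2 (\<lambda>x. u m x - u n x) < e / 3"
    using u unfolding l2_cauchy_def by (metis divide_pos_pos zero_less_numeral)
  have "\<forall>\<^sub>F n in sequentially. l2 (\<lambda>x. u n x - v n x) < e / 3"
    using uv \<open>0 < e\<close> unfolding l2_null_def by (intro order_tendstoD) auto
  then obtain N' where N': "\<And>n. n \<ge> N' \<Longrightarrow> l2 (\<lambda>x. u n x - v n x) < e / 3"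
    by (auto simp: eventually_sequentially)
  have "l2 (\<lambda>x. v m x - v n x) < e" if "m \<ge> max N N'" "n \<ge> max N N'" for m n
  proof -
    have "l2 (\<lambda>x. v m x - v n x) \<le> l2 (\<lambda>x. v m x - u m x) + l2 (\<lambda>x. u m x - v n x)"
      by (intro l2_triangle_diff v l2_cauchy_bm[OF u])
    also have "l2 (\<lambda>x. u m x - v n x) \<le> l2 (\<lambda>x. u m x - u n x) + l2 (\<lambda>x. u n x - v n x)"
      by (intro l2_triangle_diff v l2_cauchy_bm[OF u])
    finally show ?thesis
      using N[of m n] N'[of m] N'[of n] that l2_minus_commute[of "u m" "v m"] by simp
  qed
  then show "\<exists>N. \<forall>m\<ge>N. \<forall>n\<ge>N. l2 (\<lambda>x. v m x - v n x) < e" by blast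
qed

lemma l2_cauchy_add:
  assumes u: "l2_cauchy u" and v: "l2_cauchy v"
  shows "l2_cauchy (\<lambda>n x. u n x + v n x)"
  unfolding l2_cauchy_def
proof (intro conjI allI impI)
  fix e :: real assume "0 < e"
  then obtain N N' where N: "\<And>m n. m \<ge> N \<Longrightarrow> n \<ge> N \<Longrightarrow> l2 (\<lambda>x. u m x - u n x) < e / 2"
    and N': "\<And>m n. m \<ge> N' \<Longrightarrow> n \<ge> N' \<Longrightarrow> l2 (\<lambda>x. v m x - v n x) < e / 2"
    using u v unfolding l2_cauchy_def by (metis divide_pos_pos zero_less_numeral)
  have "l2 (\<lambda>x. u m x + v m x - (u n x + v n x)) < e" if "m \<ge> max N N'" "n \<ge> max N N'" for m n
  proof -
    have "l2 (\<lambda>x. u m x + v m x - (u n x + v n x)) \<le> l2 (\<lambda>x. u m x - u n x) + l2 (\<lambda>x. v m x - v n x)"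
      unfolding add_diff_add by (intro l2_triangle bm_diff l2_cauchy_bm[OF u] l2_cauchy_bm[OF v])
    then show ?thesis using N[of m n] N'[of m n] that by simp
  qed
  then show "\<exists>N. \<forall>m\<ge>N. \<forall>n\<ge>N. l2 (\<lambda>x. u m x + v m x - (u n x + v n x)) < e" by blast
qed (intro bm_add l2_cauchy_bm[OF u] l2_cauchy_bm[OF v])

lemma l2_cauchy_mult:
  assumes u: "l2_cauchy u" and g: "g \<in> bm"
  shows "l2_cauchy (\<lambda>n x. g x * u n x)"
  unfolding l2_cauchy_def
proof (intro conjI allI impI)
  fix e :: real assume e: "0 < e"
  obtain K where K: "\<And>x. norm (g x) \<le> K" using g by (auto simp: bm_def)
  then have K0: "0 \<le> K" by (rule order_trans[OF norm_ge_zero])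
  then have "0 < e / (K + 1)" using e by simp
  then obtain N where N: "\<And>m n. m \<ge> N \<Longrightarrow> n \<ge> N \<Longrightarrow> l2 (\<lambda>x. u m x - u n x) < e / (K + 1)"
    using u unfolding l2_cauchy_def by metis
  have "l2 (\<lambda>x. g x * u m x - g x * u n x) < e" if "m \<ge> N" "n \<ge> N" for m n
  proof -
    have "l2 (\<lambda>x. g x * u m x - g x * u n x) \<le> K * l2 (\<lambda>x. u m x - u n x)"
      unfolding right_diff_distrib[symmetric]
      by (intro l2_mult_le bm_diff l2_cauchy_bm[OF u] bm_measurable g K)
    also have "\<dots> \<le> K * (e / (K + 1))"
      using N[OF that] K0 by (intro mult_left_mono) auto
    also have "\<dots> < e" using K0 e by (simp add: field_simps)
    finally show ?thesis .
  qed
  then show "\<exists>N. \<forall>m\<ge>N. \<forall>n\<ge>N. l2 (\<lambda>x. g x * u m x - g x * u n x) < e" by blast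
qed (intro bm_mult l2_cauchy_bm[OF u] g)

lemma l2_cauchy_bounded:
  assumes u: "l2_cauchy u"
  obtains B where "\<And>n. l2 (u n) \<le> B"
proof -
  obtain N where N: "\<And>m n. m \<ge> N \<Longrightarrow> n \<ge> N \<Longrightarrow> l2 (\<lambda>x. u m x - u n x) < 1"
    using u unfolding l2_cauchy_def by (metis zero_less_one)
  define B where "B = Max ((\<lambda>n. l2 (u n)) ` {..N}) + 1"
  have le_B: "l2 (u n) + 1 \<le> B" if "n \<le> N" for n
    unfolding B_def using that by (intro add_right_mono Max_ge) auto
  have "l2 (u n) \<le> B" for n
  proof (cases "n \<le> N")
    case True then show ?thesis using le_B[of n] by simp
  next
    case False
    have "l2 (u n) \<le> l2 (\<lambda>x. u n x - u N x) + l2 (u N)"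
      using l2_triangle[of "\<lambda>x. u n x - u N x" "u N"] l2_cauchy_bm[OF u] by simp
    then show ?thesis using N[of n N] False le_B[of N] by simp
  qed
  then show ?thesis by (rule that)
qed

lemma ip_diff_le:
  assumes "f \<in> bm" "g \<in> bm" "f' \<in> bm" "g' \<in> bm"
  shows "norm (ip f g - ip f' g') \<le> l2 (\<lambda>x. f x - f' x) * l2 g + l2 f' * l2 (\<lambda>x. g x - g' x)"
proof -
  have "ip f g - ip f' g' = (\<integral>x. f x * cnj (g x) - f' x * cnj (g' x) \<partial>\<mu>)"
    unfolding ip_def by (rule Bochner_Integration.integral_diff[symmetric]) (use assms in auto)
  also have "\<dots> = (\<integral>x. (f x - f' x) * cnj (g x) + f' x * cnj (g x - g' x) \<partial>\<mu>)"
    by (rule Bochner_Integration.integral_cong) (auto simp: algebra_simps)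
  also have "\<dots> = ip (\<lambda>x. f x - f' x) g + ip f' (\<lambda>x. g x - g' x)"
    unfolding ip_def by (rule Bochner_Integration.integral_add) (use assms in \<open>auto intro!: bm_integrable bm_mult bm_diff bm_cnj\<close>)
  finally have "norm (ip f g - ip f' g') \<le> norm (ip (\<lambda>x. f x - f' x) g) + norm (ip f' (\<lambda>x. g x - g' x))"
    by (simp add: norm_triangle_ineq)
  also have "\<dots> \<le> l2 (\<lambda>x. f x - f' x) * l2 g + l2 f' * l2 (\<lambda>x. g x - g' x)"
    using assms by (intro add_mono norm_ip_le) auto
  finally show ?thesis .
qed

text \<open>Makes the inner product of classes independent of the representing sequences; Cauchy
  sequences are bounded, so the cofactors in \<open>ip_diff_le\<close> stay bounded.\<close>

lemma ip_null:
  assumes "l2_cauchy u" "l2_cauchy v" "l2_cauchy u'" "l2_cauchy v'" "l2_null u u'" "l2_null v v'"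
  shows "(\<lambda>n. ip (u n) (v n) - ip (u' n) (v' n)) \<longlonglongrightarrow> 0"
proof -
  obtain B where B: "\<And>n. l2 (v n) \<le> B" using l2_cauchy_bounded[OF assms(2)] by metis
  obtain B' where B': "\<And>n. l2 (u' n) \<le> B'" using l2_cauchy_bounded[OF assms(3)] by metis
  show ?thesis
  proof (rule Lim_null_comparison)
    show "(\<lambda>n. l2 (\<lambda>x. u n x - u' n x) * B + B' * l2 (\<lambda>x. v n x - v' n x)) \<longlonglongrightarrow> 0"
      using assms(5,6) unfolding l2_null_def
      by (auto intro!: tendsto_eq_intros)
    have "norm (ip (u n) (v n) - ip (u' n) (v' n)) \<le> l2 (\<lambda>x. u n x - u' n x) * B + B' * l2 (\<lambda>x. v n x - v' n x)" for n
      using ip_diff_le[of "u n" "v n" "u' n" "v' n"] assms(1-4)[THEN l2_cauchy_bm, of n]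
        mult_left_mono[OF B[of n], of "l2 (\<lambda>x. u n x - u' n x)"] mult_right_mono[OF B'[of n], of "l2 (\<lambda>x. v n x - v' n x)"]
      by simp
    then show "\<forall>\<^sub>F n in sequentially. norm (ip (u n) (v n) - ip (u' n) (v' n)) \<le> l2 (\<lambda>x. u n x - u' n x) * B + B' * l2 (\<lambda>x. v n x - v' n x)"
      by simp
  qed
qed

lemma ip_convergent:
  assumes u: "l2_cauchy u" and v: "l2_cauchy v"
  shows "convergent (\<lambda>n. ip (u n) (v n))"
proof (rule Cauchy_convergent, rule metric_CauchyI)
  fix e :: real assume e: "0 < e"
  obtain B where B: "\<And>n. l2 (v n) \<le> B" using l2_cauchy_bounded[OF v] by metis
  obtain B' where B': "\<And>n. l2 (u n) \<le> B'" using l2_cauchy_bounded[OF u] by metis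
  define C where "C = max B B' + 1"
  have C: "0 < C" "B \<le> C" "B' \<le> C"
    using order_trans[OF l2_nonneg B] by (auto simp: C_def)
  have e': "0 < e / (2 * C)" using C e by simp
  obtain N where N: "\<And>m n. m \<ge> N \<Longrightarrow> n \<ge> N \<Longrightarrow> l2 (\<lambda>x. u m x - u n x) < e / (2 * C)"
    using u e' unfolding l2_cauchy_def by metis
  obtain N' where N': "\<And>m n. m \<ge> N' \<Longrightarrow> n \<ge> N' \<Longrightarrow> l2 (\<lambda>x. v m x - v n x) < e / (2 * C)"
    using v e' unfolding l2_cauchy_def by metis
  have "dist (ip (u m) (v m)) (ip (u n) (v n)) < e" if "m \<ge> max N N'" "n \<ge> max N N'" for m n
  proof -
    have "dist (ip (u m) (v m)) (ip (u n) (v n)) \<le> l2 (\<lambda>x. u m x - u n x) * l2 (v m) + l2 (u n) * l2 (\<lambda>x. v m x - v n x)"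
      unfolding dist_norm using u v by (intro ip_diff_le l2_cauchy_bm)
    also have "\<dots> \<le> l2 (\<lambda>x. u m x - u n x) * C + C * l2 (\<lambda>x. v m x - v n x)"
      using B[of m] B'[of n] C by (intro add_mono mult_left_mono mult_right_mono) auto
    also have "\<dots> < (e / (2 * C)) * C + C * (e / (2 * C))"
      using N[of m n] N'[of m n] that C by (intro add_strict_mono mult_strict_left_mono mult_strict_right_mono) auto
    also have "\<dots> = e" using C by simp
    finally show ?thesis .
  qed
  then show "\<exists>N. \<forall>m\<ge>N. \<forall>n\<ge>N. dist (ip (u m) (v m)) (ip (u n) (v n)) < e" by blast
qed

section \<open>GNS vectors computed on representing sequences\<close>

abbreviation cauchy :: "(nat \<Rightarrow> 'a \<Rightarrow>\<^sub>C complex) \<Rightarrow> bool" where "cauchy u \<equiv> l2_cauchy (\<lambda>n. fn (u n))"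
abbreviation null :: "(nat \<Rightarrow> 'a \<Rightarrow>\<^sub>C complex) \<Rightarrow> (nat \<Rightarrow> 'a \<Rightarrow>\<^sub>C complex) \<Rightarrow> bool" where
  "null u v \<equiv> l2_null (\<lambda>n. fn (u n)) (\<lambda>n. fn (v n))"

lemma equiv_gns_rel: "equiv (gns_cauchy \<phi>) (gns_rel \<phi>)"
  by (rule equivI)
    (auto simp: refl_on_def gns_rel_iff sym_def trans_def intro: l2_null_sym l2_null_trans)

lemma cls_eq_iff: "cauchy u \<Longrightarrow> cauchy v \<Longrightarrow> cls u = cls v \<longleftrightarrow> null u v"
  using eq_equiv_class_iff[OF equiv_gns_rel, of u v] by (simp add: gns_class_def gns_rel_iff gns_cauchy_iff)

lemma hcarrier_eq: "hcarrier H = cls ` {u. cauchy u}"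
  by (auto simp: gns_space_def quotient_def gns_class_def gns_cauchy_iff)

lemma cls_in [simp]: "cauchy u \<Longrightarrow> cls u \<in> hcarrier H"
  by (simp add: hcarrier_eq)

lemma hcarrierE:
  assumes "P \<in> hcarrier H"
  obtains u where "cauchy u" "P = cls u"
  using assms by (auto simp: hcarrier_eq)

text \<open>This is what is known of the sequence picked by \<open>gns_rep\<close>; it lets the
  operations be computed on any representing sequence.\<close>

lemma gns_rep_cls:
  assumes "cauchy u"
  shows "cauchy (gns_rep (cls u))" "null (gns_rep (cls u)) u"
proof -
  have "u \<in> cls u" using assms by (simp add: gns_class_def gns_rel_iff gns_cauchy_iff)
  then have "gns_rep (cls u) \<in> cls u" unfolding gns_rep_def by (rule someI[of "\<lambda>v. v \<in> cls u"])
  then show "cauchy (gns_rep (cls u))" "null (gns_rep (cls u)) u"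
    by (auto simp: gns_class_def gns_rel_iff gns_cauchy_iff intro: l2_null_sym)
qed

lemma cauchy_add: "cauchy u \<Longrightarrow> cauchy v \<Longrightarrow> cauchy (\<lambda>n. u n + v n)"
  using l2_cauchy_add by (simp add: plus_bcontfun.rep_eq[abs_def])

lemma cauchy_const_mult: "cauchy u \<Longrightarrow> cauchy (\<lambda>n. const_mult c (u n))"
  using l2_cauchy_mult[of _ "\<lambda>_. c"] by simp

lemma cauchy_cmult: "cauchy u \<Longrightarrow> cauchy (\<lambda>n. cmult f (u n))"
  using l2_cauchy_mult[of _ "fn f"] by simp

lemma cauchy_const [simp]: "cauchy (\<lambda>n. f)"
  by (auto simp: l2_cauchy_def l2_def)

lemma hadd_cls:
  assumes "cauchy u" "cauchy v"
  shows "hadd H (cls u) (cls v) = cls (\<lambda>n. u n + v n)"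
proof -
  note r = gns_rep_cls[OF assms(1)] gns_rep_cls[OF assms(2)]
  have "null (\<lambda>n. gns_rep (cls u) n + gns_rep (cls v) n) (\<lambda>n. u n + v n)"
    using l2_null_add[OF r(2,4)] by (simp add: plus_bcontfun.rep_eq[abs_def])
  then have "cls (\<lambda>n. gns_rep (cls u) n + gns_rep (cls v) n) = cls (\<lambda>n. u n + v n)"
    by (rule cls_eq_iff[THEN iffD2, OF cauchy_add[OF r(1,3)] cauchy_add[OF assms]])
  then show ?thesis by (simp add: gns_space_def)
qed

lemma hscale_cls:
  assumes "cauchy u"
  shows "hscale H c (cls u) = cls (\<lambda>n. const_mult c (u n))"
proof -
  note r = gns_rep_cls[OF assms]
  have "null (\<lambda>n. const_mult c (gns_rep (cls u) n)) (\<lambda>n. const_mult c (u n))"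
    using l2_null_mult[OF r(2), of "\<lambda>_. c"] by simp
  then have "cls (\<lambda>n. const_mult c (gns_rep (cls u) n)) = cls (\<lambda>n. const_mult c (u n))"
    by (rule cls_eq_iff[THEN iffD2, OF cauchy_const_mult[OF r(1)] cauchy_const_mult[OF assms]])
  then show ?thesis by (simp add: gns_space_def)
qed

lemma gns_rep_map_cls:
  assumes "cauchy u"
  shows "gns_rep_map \<phi> f (cls u) = cls (\<lambda>n. cmult f (u n))"
proof -
  note r = gns_rep_cls[OF assms]
  have "null (\<lambda>n. cmult f (gns_rep (cls u) n)) (\<lambda>n. cmult f (u n))"
    using l2_null_mult[OF r(2), of "fn f"] by simp
  then have "cls (\<lambda>n. cmult f (gns_rep (cls u) n)) = cls (\<lambda>n. cmult f (u n))"
    by (rule cls_eq_iff[THEN iffD2, OF cauchy_cmult[OF r(1)] cauchy_cmult[OF assms]])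
  then show ?thesis using assms by (simp add: gns_rep_map_def)
qed

lemma hinner_cls:
  assumes u: "cauchy u" and v: "cauchy v"
  shows "(\<lambda>n. ip (fn (u n)) (fn (v n))) \<longlonglongrightarrow> hinner H (cls u) (cls v)"
proof -
  note r = gns_rep_cls[OF u] gns_rep_cls[OF v]
  have "(\<lambda>n. ip (fn (gns_rep (cls u) n)) (fn (gns_rep (cls v) n))) \<longlonglongrightarrow> hinner H (cls u) (cls v)"
    using ip_convergent[OF r(1,3)] by (simp add: gns_space_def state_ip convergent_LIMSEQ_iff)
  from tendsto_diff[OF this ip_null[OF r(1,3) u v r(2,4)]] show ?thesis by simp
qed

lemma hnorm_cls:
  assumes "cauchy u"
  shows "(\<lambda>n. l2 (fn (u n))) \<longlonglongrightarrow> hnorm H (cls u)"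
proof -
  have "(\<lambda>n. sqrt (Re (ip (fn (u n)) (fn (u n))))) \<longlonglongrightarrow> hnorm H (cls u)"
    unfolding hnorm_def by (intro tendsto_real_sqrt tendsto_Re hinner_cls assms)
  then show ?thesis by (simp add: ip_self)
qed

text \<open>The distance in the GNS space, spelled with \<open>hadd\<close> and
  \<open>hscale\<close> so that bounded operators, which respect these, are Lipschitz for
  it.\<close>

definition hdist :: "'a gns_vector \<Rightarrow> 'a gns_vector \<Rightarrow> real" where
  "hdist P Q = hnorm H (hadd H P (hscale H (-1) Q))"

lemma hdist_cls:
  assumes "cauchy u" "cauchy v"
  shows "(\<lambda>n. l2 (\<lambda>x. fn (u n) x - fn (v n) x)) \<longlonglongrightarrow> hdist (cls u) (cls v)"
proof -
  have "hdist (cls u) (cls v) = hnorm H (cls (\<lambda>n. u n + const_mult (-1) (v n)))"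
    by (simp only: hdist_def hscale_cls[OF assms(2)] hadd_cls[OF assms(1) cauchy_const_mult[OF assms(2)]])
  then show ?thesis
    using hnorm_cls[OF cauchy_add[OF assms(1) cauchy_const_mult[OF assms(2), of "-1"]]]
    by (simp add: plus_bcontfun.rep_eq[abs_def])
qed

lemma hdist_eq_0:
  assumes "P \<in> hcarrier H" "Q \<in> hcarrier H" "hdist P Q = 0"
  shows "P = Q"
proof -
  obtain u v where uv: "cauchy u" "P = cls u" "cauchy v" "Q = cls v"
    using assms(1,2) by (auto elim!: hcarrierE)
  then show ?thesis
    using hdist_cls[of u v] assms(3) by (simp add: cls_eq_iff l2_null_def)
qed

text \<open>The last term has its arguments swapped, the order in which
  \<open>mult_op_bicommutant\<close> needs them.\<close>

lemma hdist_triangle: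
  assumes "P \<in> hcarrier H" "Q \<in> hcarrier H" "R \<in> hcarrier H"
  shows "hdist P R \<le> hdist P Q + hdist R Q"
proof -
  obtain u v w where uvw: "cauchy u" "P = cls u" "cauchy v" "Q = cls v" "cauchy w" "R = cls w"
    using assms by (auto elim!: hcarrierE)
  show ?thesis
    unfolding uvw(2,4,6)
  proof (rule LIMSEQ_le[OF hdist_cls tendsto_add[OF hdist_cls hdist_cls]])
    show "\<exists>N. \<forall>n\<ge>N. l2 (\<lambda>x. fn (u n) x - fn (w n) x)
        \<le> l2 (\<lambda>x. fn (u n) x - fn (v n) x) + l2 (\<lambda>x. fn (w n) x - fn (v n) x)"
    proof (intro exI allI impI)
      fix n
      show "l2 (\<lambda>x. fn (u n) x - fn (w n) x)
        \<le> l2 (\<lambda>x. fn (u n) x - fn (v n) x) + l2 (\<lambda>x. fn (w n) x - fn (v n) x)"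
        using l2_triangle_diff[of "fn (u n)" "fn (v n)" "fn (w n)"] l2_minus_commute[of "fn (w n)" "fn (v n)"] by simp
    qed
  qed (fact uvw)+
qed

lemma hdist_nonneg: "P \<in> hcarrier H \<Longrightarrow> Q \<in> hcarrier H \<Longrightarrow> 0 \<le> hdist P Q"
  by (auto elim!: hcarrierE intro!: LIMSEQ_le_const[OF hdist_cls])

lemma hscale_in: "P \<in> hcarrier H \<Longrightarrow> hscale H c P \<in> hcarrier H"
  by (elim hcarrierE) (simp only: hscale_cls cls_in[OF cauchy_const_mult])

lemma hadd_in: "P \<in> hcarrier H \<Longrightarrow> Q \<in> hcarrier H \<Longrightarrow> hadd H P Q \<in> hcarrier H"
  by (elim hcarrierE) (simp only: hadd_cls cls_in[OF cauchy_add])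

lemma bounded_operators_hdist:
  assumes "R \<in> bounded_operators H"
  shows "\<exists>K. \<forall>P\<in>hcarrier H. \<forall>Q\<in>hcarrier H. hdist (R P) (R Q) \<le> K * hdist P Q"
proof -
  obtain K where K: "\<And>h. h \<in> hcarrier H \<Longrightarrow> hnorm H (R h) \<le> K * hnorm H h"
    using assms unfolding bounded_operators_def by blast
  have "hdist (R P) (R Q) \<le> K * hdist P Q" if PQ: "P \<in> hcarrier H" "Q \<in> hcarrier H" for P Q
  proof -
    have "hadd H (R P) (hscale H (-1) (R Q)) = R (hadd H P (hscale H (-1) Q))"
      using assms PQ hscale_in by (auto simp: bounded_operators_def)
    then show ?thesis using K[OF hadd_in[OF PQ(1) hscale_in[OF PQ(2), of "-1"]]] by (simp add: hdist_def)
  qed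
  then show ?thesis by blast
qed

text \<open>The vectors are classes of Cauchy sequences of continuous functions, so a product with \<open>g\<close> only has
  to be approximated termwise by continuous functions; completeness of \<open>L\<^sup>2(\<mu>)\<close> is not involved.\<close>

definition mult_op :: "('a \<Rightarrow> complex) \<Rightarrow> 'a gns_vector \<Rightarrow> 'a gns_vector" where
  "mult_op g = (\<lambda>P\<in>hcarrier H. cls (SOME v. l2_null (\<lambda>n x. g x * fn (gns_rep P n) x) (\<lambda>n. fn (v n))))"

lemma bcontfun_seq_approx:
  assumes "\<And>n. h n \<in> bm"
  obtains v where "l2_null h (\<lambda>n. fn (v n))"
proof -
  have "\<exists>c. l2 (\<lambda>x. h n x - fn c x) < 1 / Suc n" for n
  proof -
    obtain K where K: "\<And>x. norm (h n x) \<le> K" using assms[of n] by (auto simp: bm_def)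
    obtain c where c: "(\<lambda>k. l2 (\<lambda>x. h n x - fn (c k) x)) \<longlonglongrightarrow> 0"
      using bcontfun_dense_l2[OF bm_measurable[OF assms[of n]] K] by metis
    have "\<forall>\<^sub>F k in sequentially. l2 (\<lambda>x. h n x - fn (c k) x) < 1 / Suc n"
      by (rule order_tendstoD(2)[OF c]) simp
    then show ?thesis by (auto simp: eventually_sequentially)
  qed
  then obtain v where v: "\<And>n. l2 (\<lambda>x. h n x - fn (v n) x) < 1 / Suc n" by metis
  have "l2_null h (\<lambda>n. fn (v n))"
    unfolding l2_null_def
    by (rule tendsto_0_squeeze[OF LIMSEQ_inverse_real_of_nat]) (use v in \<open>auto simp: inverse_eq_divide less_imp_le\<close>)
  then show ?thesis by (rule that)
qed

text \<open>Any sequence of continuous functions asymptotic to the products of \<open>g\<close> with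
  \<open>u\<close> represents the result, whatever \<open>gns_rep\<close> and the choice in
  \<open>mult_op\<close> have picked, since two such sequences differ by a null sequence.\<close>

lemma mult_op_cls:
  assumes u: "cauchy u" and g: "g \<in> bm" and v: "l2_null (\<lambda>n x. g x * fn (u n) x) (\<lambda>n. fn (v n))"
  shows "cauchy v" "mult_op g (cls u) = cls v"
proof -
  show v_c: "cauchy v" by (rule l2_cauchy_null[OF l2_cauchy_mult[OF u g] v]) simp
  note r = gns_rep_cls[OF u]
  let ?w = "SOME w. l2_null (\<lambda>n x. g x * fn (gns_rep (cls u) n) x) (\<lambda>n. fn (w n))"
  obtain w where "l2_null (\<lambda>n x. g x * fn (gns_rep (cls u) n) x) (\<lambda>n. fn (w n))"
    using bcontfun_seq_approx[of "\<lambda>n x. g x * fn (gns_rep (cls u) n) x"] g by (metis bm_apply bm_mult)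
  then have w: "l2_null (\<lambda>n x. g x * fn (gns_rep (cls u) n) x) (\<lambda>n. fn (?w n))"
    by (rule someI[of "\<lambda>w. l2_null (\<lambda>n x. g x * fn (gns_rep (cls u) n) x) (\<lambda>n. fn (w n))"])
  have w_c: "cauchy ?w" by (rule l2_cauchy_null[OF l2_cauchy_mult[OF r(1) g] w]) simp
  have "null ?w v"
    using l2_null_trans[OF l2_null_trans[OF l2_null_sym[OF w] l2_null_mult[OF r(2) _ _ g]] v] g by simp
  then show "mult_op g (cls u) = cls v"
    using u v_c w_c by (simp add: mult_op_def cls_eq_iff)
qed

lemma mult_op_obtain:
  assumes u: "cauchy u" and g: "g \<in> bm"
  obtains v where "l2_null (\<lambda>n x. g x * fn (u n) x) (\<lambda>n. fn (v n))" "cauchy v" "mult_op g (cls u) = cls v"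
proof -
  obtain v where v: "l2_null (\<lambda>n x. g x * fn (u n) x) (\<lambda>n. fn (v n))"
    using bcontfun_seq_approx[of "\<lambda>n x. g x * fn (u n) x"] g by (metis bm_apply bm_mult)
  show ?thesis by (rule that[OF v mult_op_cls[OF u g v]])
qed

text \<open>For a continuous multiplier the products are continuous already and approximate
  themselves.\<close>

lemma mult_op_fn: "mult_op (fn f) = gns_rep_map \<phi> f"
proof
  fix P
  show "mult_op (fn f) P = gns_rep_map \<phi> f P"
  proof (cases "P \<in> hcarrier H")
    case True
    then obtain u where u: "cauchy u" "P = cls u" by (rule hcarrierE)
    show ?thesis
      unfolding u(2) gns_rep_map_cls[OF u(1)] by (rule mult_op_cls(2)[OF u(1)]) simp_all
  qed (simp add: mult_op_def gns_rep_map_def)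
qed

text \<open>The measurable products themselves compute the limit, so that the continuous
  approximants disappear from later calculations.\<close>

lemma hinner_mult_op:
  assumes u: "cauchy u" and w: "cauchy w" and g: "g \<in> bm"
  shows "(\<lambda>n. ip (\<lambda>x. g x * fn (u n) x) (fn (w n))) \<longlonglongrightarrow> hinner H (mult_op g (cls u)) (cls w)"
proof -
  obtain v where v: "l2_null (\<lambda>n x. g x * fn (u n) x) (\<lambda>n. fn (v n))" "cauchy v" "mult_op g (cls u) = cls v"
    using mult_op_obtain[OF u g] .
  have "(\<lambda>n. ip (\<lambda>x. g x * fn (u n) x) (fn (w n)) - ip (fn (v n)) (fn (w n))) \<longlonglongrightarrow> 0"
    by (rule ip_null[OF l2_cauchy_mult[OF u g] w v(2) w v(1)]) simp
  from tendsto_add[OF this hinner_cls[OF v(2) w]] show ?thesis by (simp add: v(3))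
qed

lemma mult_op_add:
  assumes g: "g \<in> bm" "h \<in> bm" and P: "P \<in> hcarrier H"
  shows "mult_op (\<lambda>x. g x + h x) P = hadd H (mult_op g P) (mult_op h P)"
proof -
  obtain u where u: "cauchy u" "P = cls u" using P by (rule hcarrierE)
  obtain v where v: "l2_null (\<lambda>n x. g x * fn (u n) x) (\<lambda>n. fn (v n))" "cauchy v" "mult_op g (cls u) = cls v"
    using mult_op_obtain[OF u(1) g(1)] .
  obtain w where w: "l2_null (\<lambda>n x. h x * fn (u n) x) (\<lambda>n. fn (w n))" "cauchy w" "mult_op h (cls u) = cls w"
    using mult_op_obtain[OF u(1) g(2)] .
  have "mult_op (\<lambda>x. g x + h x) (cls u) = cls (\<lambda>n. v n + w n)"
    using l2_null_add[OF v(1) w(1)] g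
    by (intro mult_op_cls(2) u) (auto simp: plus_bcontfun.rep_eq[abs_def] distrib_right)
  then show ?thesis by (simp add: u v w hadd_cls)
qed

lemma mult_op_scale:
  assumes g: "g \<in> bm" and P: "P \<in> hcarrier H"
  shows "mult_op (\<lambda>x. c * g x) P = hscale H c (mult_op g P)"
proof -
  obtain u where u: "cauchy u" "P = cls u" using P by (rule hcarrierE)
  obtain v where v: "l2_null (\<lambda>n x. g x * fn (u n) x) (\<lambda>n. fn (v n))" "cauchy v" "mult_op g (cls u) = cls v"
    using mult_op_obtain[OF u(1) g] .
  have "mult_op (\<lambda>x. c * g x) (cls u) = cls (\<lambda>n. const_mult c (v n))"
    using l2_null_mult[OF v(1), of "\<lambda>_. c"] g
    by (intro mult_op_cls(2) u) (auto simp: mult.assoc)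
  then show ?thesis by (simp add: u v hscale_cls)
qed

lemma mult_op_bounded:
  assumes g: "g \<in> bm"
  shows "mult_op g \<in> bounded_operators H"
  unfolding bounded_operators_def
proof (intro CollectI conjI ballI allI)
  show "mult_op g \<in> hcarrier H \<rightarrow>\<^sub>E hcarrier H"
  proof
    fix P assume "P \<in> hcarrier H"
    then obtain u where u: "cauchy u" "P = cls u" by (rule hcarrierE)
    then show "mult_op g P \<in> hcarrier H"
      by (metis mult_op_obtain[OF u(1) g] cls_in)
  qed (simp add: mult_op_def)
  fix P assume "P \<in> hcarrier H"
  then obtain u where u: "cauchy u" "P = cls u" by (rule hcarrierE)
  obtain v where v: "l2_null (\<lambda>n x. g x * fn (u n) x) (\<lambda>n. fn (v n))" "cauchy v" "mult_op g (cls u) = cls v"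
    using mult_op_obtain[OF u(1) g] .
  show "mult_op g (hscale H c P) = hscale H c (mult_op g P)" for c
  proof -
    have "mult_op g (cls (\<lambda>n. const_mult c (u n))) = cls (\<lambda>n. const_mult c (v n))"
      using l2_null_mult[OF v(1), of "\<lambda>_. c"] g u
      by (intro mult_op_cls(2) cauchy_const_mult) (auto simp: algebra_simps)
    then show ?thesis by (simp add: u v hscale_cls)
  qed
  show "mult_op g (hadd H P Q) = hadd H (mult_op g P) (mult_op g Q)" if Q: "Q \<in> hcarrier H" for Q
  proof -
    obtain u' where u': "cauchy u'" "Q = cls u'" using Q by (rule hcarrierE)
    obtain v' where v': "l2_null (\<lambda>n x. g x * fn (u' n) x) (\<lambda>n. fn (v' n))" "cauchy v'" "mult_op g (cls u') = cls v'"
      using mult_op_obtain[OF u'(1) g] .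
    have "mult_op g (cls (\<lambda>n. u n + u' n)) = cls (\<lambda>n. v n + v' n)"
      using l2_null_add[OF v(1) v'(1)] g u u'
      by (intro mult_op_cls(2) cauchy_add) (auto simp: plus_bcontfun.rep_eq[abs_def] distrib_left)
    then show ?thesis by (simp add: u u' v v' hadd_cls)
  qed
next
  obtain K where K: "\<And>x. norm (g x) \<le> K" using g by (auto simp: bm_def)
  show "\<exists>K. \<forall>h\<in>hcarrier H. hnorm H (mult_op g h) \<le> K * hnorm H h"
  proof (intro exI ballI)
    fix P assume "P \<in> hcarrier H"
    then obtain u where u: "cauchy u" "P = cls u" by (rule hcarrierE)
    obtain v where v: "l2_null (\<lambda>n x. g x * fn (u n) x) (\<lambda>n. fn (v n))" "cauchy v" "mult_op g (cls u) = cls v"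
      using mult_op_obtain[OF u(1) g] .
    have "hnorm H (cls v) \<le> 0 + K * hnorm H (cls u)"
    proof (rule LIMSEQ_le[OF hnorm_cls[OF v(2)] tendsto_add[OF v(1)[unfolded l2_null_def] tendsto_mult_left[OF hnorm_cls[OF u(1)]]]])
      have "l2 (fn (v n)) \<le> l2 (\<lambda>x. g x * fn (u n) x - fn (v n) x) + K * l2 (fn (u n))" for n
      proof -
        have "l2 (\<lambda>x. (fn (v n) x - g x * fn (u n) x) + g x * fn (u n) x)
          \<le> l2 (\<lambda>x. fn (v n) x - g x * fn (u n) x) + l2 (\<lambda>x. g x * fn (u n) x)"
          using g by (intro l2_triangle) auto
        moreover have "l2 (\<lambda>x. g x * fn (u n) x) \<le> K * l2 (fn (u n))"
          by (rule l2_mult_le) (use g K in auto)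
        ultimately show ?thesis
          by (simp add: l2_minus_commute[of "fn (v n)"])
      qed
      then show "\<exists>N. \<forall>n\<ge>N. l2 (fn (v n)) \<le> l2 (\<lambda>x. g x * fn (u n) x - fn (v n) x) + K * l2 (fn (u n))" by blast
    qed
    then show "hnorm H (mult_op g P) \<le> K * hnorm H P" by (simp add: u v)
  qed
qed

text \<open>Split \<open>u n\<close> into a fixed term \<open>u N\<close> and a remainder. On
  \<open>u N\<close>, which is bounded, convergence of \<open>c k\<close> to \<open>g\<close> in
  mean square suffices; the remainder is small in mean square and is multiplied by functions bounded
  by \<open>K + K'\<close>, uniformly in \<open>k\<close>.\<close>

lemma mult_op_strong_limit:
  assumes g: "g \<in> bm" and c: "\<And>k x. norm (fn (c k) x) \<le> K" "(\<lambda>k. l2 (\<lambda>x. g x - fn (c k) x)) \<longlonglongrightarrow> 0"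
    and P: "P \<in> hcarrier H"
  shows "(\<lambda>k. hdist (mult_op g P) (gns_rep_map \<phi> (c k) P)) \<longlonglongrightarrow> 0"
proof -
  obtain u where u: "cauchy u" "P = cls u" using P by (rule hcarrierE)
  obtain v where v: "l2_null (\<lambda>n x. g x * fn (u n) x) (\<lambda>n. fn (v n))" "cauchy v" "mult_op g (cls u) = cls v"
    using mult_op_obtain[OF u(1) g] .
  obtain K' where K': "\<And>x. norm (g x) \<le> K'" using g by (auto simp: bm_def)
  have K_nn: "0 \<le> K + K'" using order_trans[OF norm_ge_zero c(1)] order_trans[OF norm_ge_zero K'] by (metis add_nonneg_nonneg)
  have d_bm: "(\<lambda>x. g x - fn (c k) x) \<in> bm" for k using g by auto
  have d_bound: "norm (g x - fn (c k) x) \<le> K + K'" for k x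
    using norm_triangle_ineq4[of "g x" "fn (c k) x"] c(1)[of k x] K'[of x] by linarith
  have bound: "hdist (mult_op g P) (gns_rep_map \<phi> (c k) P)
      \<le> norm (u N) * l2 (\<lambda>x. g x - fn (c k) x) + (K + K') * e"
    if N: "\<And>n. n \<ge> N \<Longrightarrow> l2 (\<lambda>x. fn (u n) x - fn (u N) x) \<le> e" for N e k
  proof -
    have "hdist (cls v) (cls (\<lambda>n. cmult (c k) (u n)))
      \<le> 0 + (norm (u N) * l2 (\<lambda>x. g x - fn (c k) x) + (K + K') * e)"
    proof (rule LIMSEQ_le[OF hdist_cls[OF v(2) cauchy_cmult[OF u(1)]] tendsto_add[OF v(1)[unfolded l2_null_def] tendsto_const]])
      have "l2 (\<lambda>x. fn (v n) x - fn (cmult (c k) (u n)) x)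
        \<le> l2 (\<lambda>x. g x * fn (u n) x - fn (v n) x) + (norm (u N) * l2 (\<lambda>x. g x - fn (c k) x) + (K + K') * e)"
        if "n \<ge> N" for n
      proof -
        have "l2 (\<lambda>x. fn (v n) x - fn (c k) x * fn (u n) x)
          \<le> l2 (\<lambda>x. fn (v n) x - g x * fn (u n) x) + l2 (\<lambda>x. g x * fn (u n) x - fn (c k) x * fn (u n) x)"
          using g by (intro l2_triangle_diff) auto
        also have "l2 (\<lambda>x. g x * fn (u n) x - fn (c k) x * fn (u n) x)
          = l2 (\<lambda>x. fn (u N) x * (g x - fn (c k) x) + (g x - fn (c k) x) * (fn (u n) x - fn (u N) x))"
          by (simp add: algebra_simps)
        also have "\<dots> \<le> l2 (\<lambda>x. fn (u N) x * (g x - fn (c k) x)) + l2 (\<lambda>x. (g x - fn (c k) x) * (fn (u n) x - fn (u N) x))"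
          using g by (intro l2_triangle) auto
        also have "l2 (\<lambda>x. fn (u N) x * (g x - fn (c k) x)) \<le> norm (u N) * l2 (\<lambda>x. g x - fn (c k) x)"
          by (rule l2_mult_le[OF d_bm]) (auto simp: norm_bounded)
        also have "l2 (\<lambda>x. (g x - fn (c k) x) * (fn (u n) x - fn (u N) x)) \<le> (K + K') * l2 (\<lambda>x. fn (u n) x - fn (u N) x)"
          by (rule l2_mult_le) (use bm_measurable[OF d_bm] d_bound in auto)
        also have "\<dots> \<le> (K + K') * e" using N[OF that] K_nn by (intro mult_left_mono)
        finally show ?thesis by (simp add: l2_minus_commute[of "fn (v n)"])
      qed
      then show "\<exists>N'. \<forall>n\<ge>N'. l2 (\<lambda>x. fn (v n) x - fn (cmult (c k) (u n)) x)
        \<le> l2 (\<lambda>x. g x * fn (u n) x - fn (v n) x) + (norm (u N) * l2 (\<lambda>x. g x - fn (c k) x) + (K + K') * e)" by blast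
    qed
    then show ?thesis by (simp add: u v gns_rep_map_cls)
  qed
  have rep_in: "gns_rep_map \<phi> f P \<in> hcarrier H" for f
    unfolding u(2) gns_rep_map_cls[OF u(1)] by (rule cls_in[OF cauchy_cmult[OF u(1)]])
  have op_in: "mult_op g P \<in> hcarrier H" using u v by simp
  show ?thesis
  proof (rule LIMSEQ_I)
    fix r :: real assume r: "0 < r"
    \<comment> \<open>Chosen so that the remainder contributes at most \<open>r / 2\<close>, also
      when both bounds are 0.\<close>
    define e where "e = r / (2 * (K + K' + 1))"
    have e: "0 < e" using r K_nn by (simp add: e_def)
    have e_le: "(K + K') * e \<le> r / 2" using r K_nn by (simp add: e_def field_simps)
    obtain N where N: "\<And>n. n \<ge> N \<Longrightarrow> l2 (\<lambda>x. fn (u n) x - fn (u N) x) \<le> e"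
      using u(1) e unfolding l2_cauchy_def by (meson less_imp_le order_refl)
    have "(\<lambda>k. norm (u N) * l2 (\<lambda>x. g x - fn (c k) x)) \<longlonglongrightarrow> 0"
      by (rule tendsto_mult_right_zero[OF c(2)])
    then have "\<forall>\<^sub>F k in sequentially. norm (u N) * l2 (\<lambda>x. g x - fn (c k) x) < r / 2"
      using r by (intro order_tendstoD(2)) auto
    then obtain k0 where k0: "\<And>k. k \<ge> k0 \<Longrightarrow> norm (u N) * l2 (\<lambda>x. g x - fn (c k) x) < r / 2"
      by (auto simp: eventually_sequentially)
    have "norm (hdist (mult_op g P) (gns_rep_map \<phi> (c k) P) - 0) < r" if "k \<ge> k0" for k
    proof -
      have "hdist (mult_op g P) (gns_rep_map \<phi> (c k) P) \<le> norm (u N) * l2 (\<lambda>x. g x - fn (c k) x) + (K + K') * e"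
        by (rule bound[OF N])
      also have "\<dots> < r / 2 + r / 2"
        by (intro add_less_le_mono e_le) (rule k0[OF that])
      finally show ?thesis using hdist_nonneg[OF op_in rep_in] by simp
    qed
    then show "\<exists>k0. \<forall>k\<ge>k0. norm (hdist (mult_op g P) (gns_rep_map \<phi> (c k) P) - 0) < r" by blast
  qed
qed

lemma gns_rep_map_bounded: "gns_rep_map \<phi> f \<in> bounded_operators H"
  using mult_op_bounded[of "fn f"] by (simp add: mult_op_fn)

text \<open>A bounded operator that commutes with the representation commutes with its strong
  limits: the distance of the two products is estimated through
  \<open>gns_rep_map \<phi> (c k) (R P)\<close>, which equals
  \<open>R (gns_rep_map \<phi> (c k) P)\<close>.\<close>

lemma mult_op_bicommutant:
  assumes g: "g \<in> bm"
  shows "mult_op g \<in> commutant H (commutant H (range (gns_rep_map \<phi>)))"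
  unfolding commutant_def[of H "commutant H (range (gns_rep_map \<phi>))"]
proof (intro CollectI conjI ballI mult_op_bounded g)
  fix R assume R: "R \<in> commutant H (range (gns_rep_map \<phi>))"
  then have R_op: "R \<in> bounded_operators H"
    and R_comm: "\<And>f. compose (hcarrier H) R (gns_rep_map \<phi> f) = compose (hcarrier H) (gns_rep_map \<phi> f) R"
    by (auto simp: commutant_def)
  have in_H: "T P \<in> hcarrier H" if "T \<in> bounded_operators H" "P \<in> hcarrier H" for T P
    using that by (auto simp: bounded_operators_def)
  have comm: "R (gns_rep_map \<phi> f P) = gns_rep_map \<phi> f (R P)" if "P \<in> hcarrier H" for f P
    using fun_cong[OF R_comm[of f], of P] that by (simp add: compose_def)
  obtain L where L: "\<And>P Q. P \<in> hcarrier H \<Longrightarrow> Q \<in> hcarrier H \<Longrightarrow> hdist (R P) (R Q) \<le> L * hdist P Q"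
    using bounded_operators_hdist[OF R_op] by blast
  obtain K where K: "\<And>x. norm (g x) \<le> K" using g by (auto simp: bm_def)
  obtain c :: "nat \<Rightarrow> 'a \<Rightarrow>\<^sub>C complex" where c: "\<And>n x. norm (fn (c n) x) \<le> 2 * K"
    "(\<lambda>n. l2 (\<lambda>x. g x - fn (c n) x)) \<longlonglongrightarrow> 0"
    using bcontfun_dense_l2[OF bm_measurable[OF g] K] by blast
  have "mult_op g (R P) = R (mult_op g P)" if P: "P \<in> hcarrier H" for P
  proof (rule hdist_eq_0)
    note RP = in_H[OF R_op P] and gP = in_H[OF mult_op_bounded[OF g] P]
    show "mult_op g (R P) \<in> hcarrier H" "R (mult_op g P) \<in> hcarrier H"
      using in_H mult_op_bounded[OF g] R_op P by auto
    have "hdist (mult_op g (R P)) (R (mult_op g P)) \<le> 0 + L * 0"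
    proof (rule LIMSEQ_le_const[OF tendsto_add[OF mult_op_strong_limit[OF g c RP] tendsto_mult_left[OF mult_op_strong_limit[OF g c P]]]], intro exI allI impI)
      fix k
      have "hdist (mult_op g (R P)) (R (mult_op g P))
        \<le> hdist (mult_op g (R P)) (gns_rep_map \<phi> (c k) (R P)) + hdist (R (mult_op g P)) (gns_rep_map \<phi> (c k) (R P))"
        using in_H mult_op_bounded[OF g] gns_rep_map_bounded R_op P by (intro hdist_triangle) auto
      also have "hdist (R (mult_op g P)) (gns_rep_map \<phi> (c k) (R P)) = hdist (R (mult_op g P)) (R (gns_rep_map \<phi> (c k) P))"
        by (simp add: comm P)
      also have "\<dots> \<le> L * hdist (mult_op g P) (gns_rep_map \<phi> (c k) P)"
        by (intro L gP in_H[OF gns_rep_map_bounded P])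
      finally show "hdist (mult_op g (R P)) (R (mult_op g P))
        \<le> hdist (mult_op g (R P)) (gns_rep_map \<phi> (c k) (R P)) + L * hdist (mult_op g P) (gns_rep_map \<phi> (c k) P)"
        by simp
    qed
    then show "hdist (mult_op g (R P)) (R (mult_op g P)) = 0"
      using hdist_nonneg[of "mult_op g (R P)" "R (mult_op g P)"] in_H mult_op_bounded[OF g] R_op P by force
  qed
  then show "compose (hcarrier H) (mult_op g) R = compose (hcarrier H) R (mult_op g)"
    unfolding compose_def by (rule restrict_ext)
qed

lemma gns_cyclic_cls: "gns_cyclic \<phi> = cls (\<lambda>n. const_bcontfun 1)"
  by (simp add: gns_cyclic_def)

lemma hinner_mult_op_const:
  assumes g: "g \<in> bm"
  shows "hinner H (mult_op g (cls (\<lambda>n. f))) (cls (\<lambda>n. h)) = (\<integral>x. g x * fn f x * cnj (fn h x) \<partial>\<mu>)"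
  using LIMSEQ_unique[OF hinner_mult_op[OF cauchy_const cauchy_const g] tendsto_const] by (simp add: ip_def)

end

lemma apply_bcontfun_sum:
  fixes f :: "'i \<Rightarrow> 'b::topological_space \<Rightarrow>\<^sub>C 'c::real_normed_vector"
  shows "apply_bcontfun (\<Sum>i\<in>I. f i) x = (\<Sum>i\<in>I. apply_bcontfun (f i) x)"
  by (induction I rule: infinite_finite_induct) auto

lemma sum_nonneg_Reals:
  fixes f :: "'i \<Rightarrow> complex"
  shows "(\<And>i. i \<in> I \<Longrightarrow> f i \<in> \<real>\<^sub>\<ge>\<^sub>0) \<Longrightarrow> sum f I \<in> \<real>\<^sub>\<ge>\<^sub>0"
  by (induction I rule: infinite_finite_induct) (auto intro: nonneg_Reals_add_I)

lemma integral_nonneg_Reals: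
  fixes F :: "'b \<Rightarrow> complex"
  assumes "\<And>x. F x \<in> \<real>\<^sub>\<ge>\<^sub>0"
  shows "(\<integral>x. F x \<partial>M) \<in> \<real>\<^sub>\<ge>\<^sub>0"
proof -
  have F: "F = (\<lambda>x. complex_of_real (Re (F x)))" and "0 \<le> Re (F x)" for x
    using assms by (auto simp: complex_nonneg_Reals_iff complex_eq_iff fun_eq_iff)
  then have "0 \<le> (\<integral>x. Re (F x) \<partial>M)" by (intro integral_nonneg_AE) auto
  then show ?thesis by (subst F) (simp add: integral_complex_of_real)
qed

lemma closed_nonneg_Reals_complex: "closed (\<real>\<^sub>\<ge>\<^sub>0 :: complex set)"
proof -
  have "(\<real>\<^sub>\<ge>\<^sub>0 :: complex set) = {z. 0 \<le> Re z} \<inter> {z. Im z = 0}"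
    by (auto simp: complex_nonneg_Reals_iff)
  then show ?thesis
    by (auto intro!: closed_Int closed_Collect_le closed_Collect_eq continuous_intros)
qed

lemma ProbD:
  assumes "M \<in> Prob"
  shows "prob_space M" "finite_measure M" "sets M = sets borel"
  using assms by (auto simp: Prob_def prob_space.finite_measure)

section \<open>States and measures\<close>

lemma norm_state_of_le:
  assumes "M \<in> Prob"
  shows "norm (state_of M f) \<le> norm f"
proof -
  note M = ProbD[OF assms]
  interpret prob_space M by fact
  have int: "integrable M (apply_bcontfun f)"
    by (rule integrable_bcontfun[OF M(2,3)])
  have "norm (state_of M f) \<le> (\<integral>x. norm (apply_bcontfun f x) \<partial>M)"
    unfolding state_of_def by (rule integral_norm_bound)
  also have "\<dots> \<le> (\<integral>x. norm f \<partial>M)"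
    using int by (intro integral_mono integrable_norm) (auto simp: norm_bounded)
  also have "\<dots> = norm f" by (simp add: prob_space)
  finally show ?thesis .
qed

lemma state_of_add:
  assumes "M \<in> Prob"
  shows "state_of M (f + g) = state_of M f + state_of M g"
  using integrable_bcontfun[OF ProbD(2,3)[OF assms], of f] integrable_bcontfun[OF ProbD(2,3)[OF assms], of g]
  by (simp add: state_of_def)

lemma state_of_const_mult: "state_of M (const_mult c f) = c * state_of M f"
  by (simp add: state_of_def const_mult.rep_eq)

lemma state_of_one: "M \<in> Prob \<Longrightarrow> state_of M (const_bcontfun 1) = 1"
  using ProbD(1)[of M] by (simp add: state_of_def const_bcontfun.rep_eq prob_space.prob_space)

lemma state_of_of_real_fun: "state_of M (of_real_fun f) = of_real (\<integral>x. apply_bcontfun f x \<partial>M)"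
  by (simp add: state_of_def of_real_fun.rep_eq integral_complex_of_real)

lemma state_of_nonneg:
  assumes "\<And>x. apply_bcontfun f x \<in> \<real>\<^sub>\<ge>\<^sub>0"
  shows "state_of M f \<in> \<real>\<^sub>\<ge>\<^sub>0"
  unfolding state_of_def by (rule integral_nonneg_Reals) (rule assms)

lemma cnj_mult_nonneg: "cnj z * z \<in> \<real>\<^sub>\<ge>\<^sub>0"
  by (simp add: complex_nonneg_Reals_iff)

lemma state_of_in_states: "M \<in> Prob \<Longrightarrow> state_of M \<in> states"
  by (auto simp: states_def state_of_add state_of_const_mult state_of_one cmult.rep_eq conj_fun.rep_eq
      intro!: state_of_nonneg cnj_mult_nonneg)

lemma of_real_fun_add: "of_real_fun (f + g) = of_real_fun f + of_real_fun g"
  by (rule bcontfun_eqI) (simp add: of_real_fun.rep_eq)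

lemma of_real_fun_scaleR: "of_real_fun (r *\<^sub>R f) = const_mult (of_real r) (of_real_fun f)"
  by (rule bcontfun_eqI) (simp add: of_real_fun.rep_eq const_mult.rep_eq)

lemma of_real_fun_const: "of_real_fun (const_bcontfun r) = const_mult (of_real r) (const_bcontfun 1)"
  by (rule bcontfun_eqI) (simp add: of_real_fun.rep_eq const_mult.rep_eq const_bcontfun.rep_eq)

text \<open>Positivity of states and of completely positive maps is defined through squares; the
  square root of a nonnegative continuous function connects this with the pointwise order.\<close>

lemma of_real_fun_eq_square:
  fixes f :: "'a::metric_space \<Rightarrow>\<^sub>C real"
  assumes "compact (UNIV :: 'a set)" "\<And>x. 0 \<le> apply_bcontfun f x"
  obtains b where "of_real_fun f = cmult (conj_fun b) b"
proof -
  have app: "apply_bcontfun (Bcontfun (\<lambda>x. sqrt (apply_bcontfun f x))) = (\<lambda>x. sqrt (apply_bcontfun f x))"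
    by (intro apply_bcontfun_Bcontfun assms continuous_on_real_sqrt) simp
  have "of_real_fun f = cmult (conj_fun (of_real_fun (Bcontfun (\<lambda>x. sqrt (apply_bcontfun f x)))))
    (of_real_fun (Bcontfun (\<lambda>x. sqrt (apply_bcontfun f x))))"
    by (rule bcontfun_eqI)
       (simp add: of_real_fun.rep_eq cmult.rep_eq conj_fun.rep_eq app assms(2) flip: of_real_mult)
  then show ?thesis by (rule that)
qed

definition real_state :: "'a::topological_space functional \<Rightarrow> ('a \<Rightarrow>\<^sub>C real) \<Rightarrow> real" where
  "real_state \<phi> f = Re (\<phi> (of_real_fun f))"

context
  fixes \<phi> :: "'a::metric_space functional"
  assumes compact: "compact (UNIV :: 'a set)" and \<phi>: "\<phi> \<in> states"
begin

lemma state_add: "\<phi> (f + g) = \<phi> f + \<phi> g"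
  and state_const_mult: "\<phi> (const_mult c f) = c * \<phi> f"
  and state_square: "\<phi> (cmult (conj_fun f) f) \<in> \<real>\<^sub>\<ge>\<^sub>0"
  and state_one: "\<phi> (const_bcontfun 1) = 1"
  using \<phi> by (auto simp: states_def)

lemma linear_real_state: "linear (real_state \<phi>)"
  by (rule linearI) (simp_all add: real_state_def of_real_fun_add of_real_fun_scaleR state_add state_const_mult)

lemma state_of_real_fun_nonneg:
  assumes "\<And>x. 0 \<le> apply_bcontfun f x"
  shows "\<phi> (of_real_fun f) \<in> \<real>\<^sub>\<ge>\<^sub>0"
  by (metis of_real_fun_eq_square[OF compact assms] state_square)

lemma real_state_const: "real_state \<phi> (const_bcontfun r) = r"
  by (simp add: real_state_def of_real_fun_const state_const_mult state_one)

lemma real_state_mono: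
  assumes "\<And>x. apply_bcontfun f x \<le> apply_bcontfun g x"
  shows "real_state \<phi> f \<le> real_state \<phi> g"
proof -
  have "0 \<le> real_state \<phi> (g - f)"
    using state_of_real_fun_nonneg[of "g - f"] assms by (simp add: real_state_def complex_nonneg_Reals_iff)
  then show ?thesis by (simp add: linear_diff[OF linear_real_state])
qed

lemma abs_real_state_le: "\<bar>real_state \<phi> f\<bar> \<le> norm f"
  using real_state_mono[of f "const_bcontfun (norm f)"] real_state_mono[of "const_bcontfun (- norm f)" f]
    abs_apply_bcontfun_le[of f]
  by (simp add: real_state_const const_bcontfun.rep_eq abs_le_iff minus_le_iff)

text \<open>Positive elements have real values, and \<open>f\<close> raised by its norm is
  positive.\<close>

lemma state_of_real_fun: "\<phi> (of_real_fun f) = of_real (real_state \<phi> f)"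
proof -
  have "\<phi> (of_real_fun (f + const_bcontfun (norm f))) \<in> \<real>\<^sub>\<ge>\<^sub>0"
  proof (rule state_of_real_fun_nonneg)
    show "0 \<le> apply_bcontfun (f + const_bcontfun (norm f)) x" for x
      using abs_apply_bcontfun_le[of f x] by (simp add: const_bcontfun.rep_eq)
  qed
  then have "Im (\<phi> (of_real_fun f)) = 0"
    by (simp add: of_real_fun_add of_real_fun_const state_add state_const_mult state_one complex_nonneg_Reals_iff)
  then show ?thesis by (simp add: real_state_def complex_eq_iff)
qed

text \<open>Riesz representation of the real part, extended by complex linearity.\<close>

lemma state_eq_state_of:
  obtains M where "M \<in> Prob" "\<phi> = state_of M"
proof -
  have "0 \<le> real_state \<phi> f" if "\<And>x. 0 \<le> apply_bcontfun f x" for f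
    using state_of_real_fun_nonneg[OF that] by (simp add: real_state_def complex_nonneg_Reals_iff)
  from riesz_representation[OF compact linear_real_state this]
  obtain M where M: "finite_measure M" "sets M = sets borel" "\<And>f. (\<integral>x. apply_bcontfun f x \<partial>M) = real_state \<phi> f"
    by blast
  have "measure M (space M) = 1"
    using M(3)[of "const_bcontfun 1"] sets_eq_imp_space_eq[OF M(2)] by (simp add: const_bcontfun.rep_eq real_state_const)
  then have "prob_space M"
    using finite_measure.emeasure_eq_measure[OF M(1)] by (intro prob_spaceI) simp
  then have P: "M \<in> Prob" using M(2) by (simp add: Prob_def)
  have "\<phi> f = state_of M f" for f
  proof -
    have app: "apply_bcontfun (Bcontfun (\<lambda>x. Re (apply_bcontfun f x))) = (\<lambda>x. Re (apply_bcontfun f x))"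
      "apply_bcontfun (Bcontfun (\<lambda>x. Im (apply_bcontfun f x))) = (\<lambda>x. Im (apply_bcontfun f x))"
      by (intro apply_bcontfun_Bcontfun compact continuous_intros, simp)+
    have f: "f = of_real_fun (Bcontfun (\<lambda>x. Re (apply_bcontfun f x))) + const_mult \<i> (of_real_fun (Bcontfun (\<lambda>x. Im (apply_bcontfun f x))))"
      by (rule bcontfun_eqI) (simp add: of_real_fun.rep_eq const_mult.rep_eq app complex_eq_iff)
    show ?thesis
      by (subst f, subst (2) f)
        (simp add: state_add state_const_mult state_of_add[OF P] state_of_const_mult state_of_real_fun state_of_of_real_fun M(3))
  qed
  with P that show ?thesis by blast
qed

end

section \<open>Dilations\<close>

context borel_prob
begin

lemma hinner_add_left:
  assumes "P \<in> hcarrier H" "Q \<in> hcarrier H" "R \<in> hcarrier H"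
  shows "hinner H (hadd H P Q) R = hinner H P R + hinner H Q R"
proof -
  obtain u v w where uvw: "cauchy u" "P = cls u" "cauchy v" "Q = cls v" "cauchy w" "R = cls w"
    using assms by (auto elim!: hcarrierE)
  have ip_eq: "ip (fn (u n + v n)) (fn (w n)) = ip (fn (u n)) (fn (w n)) + ip (fn (v n)) (fn (w n))" for n
    unfolding ip_def plus_bcontfun.rep_eq distrib_right
    by (intro Bochner_Integration.integral_add bm_integrable bm_mult bm_cnj bm_apply)
  show ?thesis
    using LIMSEQ_unique[OF hinner_cls[OF cauchy_add[OF uvw(1,3)] uvw(5)]
        tendsto_add[OF hinner_cls[OF uvw(1,5)] hinner_cls[OF uvw(3,5)], folded ip_eq]]
    by (simp add: uvw hadd_cls)
qed

lemma hinner_gns_rep_map: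
  assumes "P \<in> hcarrier H" "Q \<in> hcarrier H"
  shows "hinner H (gns_rep_map \<phi> f P) Q = hinner H P (gns_rep_map \<phi> (conj_fun f) Q)"
proof -
  obtain u v where uv: "cauchy u" "P = cls u" "cauchy v" "Q = cls v"
    using assms by (auto elim!: hcarrierE)
  have "ip (fn (cmult f (u n))) (fn (v n)) = ip (fn (u n)) (fn (cmult (conj_fun f) (v n)))" for n
    by (simp add: ip_def algebra_simps)
  then show ?thesis
    using LIMSEQ_unique[OF hinner_cls[OF cauchy_cmult[OF uv(1)] uv(3)]]
      hinner_cls[OF uv(1) cauchy_cmult[OF uv(3)]]
    by (simp only: uv gns_rep_map_cls)
qed

lemma hinner_gns_rep_map_const:
  "hinner H (gns_rep_map \<phi> f (cls (\<lambda>n. g))) (cls (\<lambda>n. h)) = (\<integral>x. fn f x * fn g x * cnj (fn h x) \<partial>\<mu>)"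
  unfolding mult_op_fn[symmetric] by (rule hinner_mult_op_const) simp

lemma dilation_map_state:
  assumes "dilation_map S \<phi> \<psi> \<Phi>" "s \<in> S"
  shows "\<psi> s = \<phi> s"
proof -
  have "\<phi> s = (\<integral>x. fn s x \<partial>\<mu>)" by (simp add: state_of_def)
  then show ?thesis
    using assms hinner_gns_rep_map_const[of s "const_bcontfun 1" "const_bcontfun 1"]
    by (simp add: dilation_map_def gns_cyclic_cls)
qed

text \<open>Multiplication by \<open>k a\<close> is linear and unital in \<open>a\<close> because
  each \<open>\<Lambda> x\<close> is a probability measure, and agrees with the representation on
  \<open>S\<close> by the barycentre equation. For complete positivity, a positive matrix of
  functions is a Gram matrix at each point; averaging over \<open>\<Lambda> x\<close> and then over
  \<mu> keeps the quadratic form nonnegative. The assumptions on the kernel do not mention \<mu>, so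
  the lemma also serves for every other measure.\<close>

lemma strong_dilation_of_kernel:
  fixes \<Lambda> :: "'a \<Rightarrow> 'a measure"
  assumes \<Lambda>: "\<And>x. \<Lambda> x \<in> Prob"
    and meas: "\<And>f :: 'a \<Rightarrow>\<^sub>C complex. (\<lambda>x. state_of (\<Lambda> x) f) \<in> borel_measurable borel"
    and bary: "\<And>x s. s \<in> S \<Longrightarrow> state_of (\<Lambda> x) s = fn s x"
  shows "strong_dilation_le S \<phi> (\<lambda>a. \<integral>x. state_of (\<Lambda> x) a \<partial>\<mu>)"
proof -
  define k where "k a x = state_of (\<Lambda> x) a" for a x
  define \<Phi> where "\<Phi> a = mult_op (k a)" for a
  have k_bm [simp, intro]: "k a \<in> bm" for a
    unfolding k_def using norm_state_of_le[OF \<Lambda>] meas sets_eq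
    by (intro bmI[of _ "norm a"]) (auto cong: measurable_cong_sets)
  have k_add: "k (f + g) = (\<lambda>x. k f x + k g x)" for f g
    by (auto simp: k_def state_of_add[OF \<Lambda>])
  have k_scale: "k (const_mult c f) = (\<lambda>x. c * k f x)" for c f
    by (auto simp: k_def state_of_const_mult)
  have k_S: "k s = fn s" if "s \<in> S" for s
    using bary[OF that] by (auto simp: k_def)
  have k_one: "k (const_bcontfun 1) = fn (const_bcontfun 1)"
    by (auto simp: k_def state_of_one[OF \<Lambda>])
  have pos: "positive_op_matrix H n (\<lambda>i j. \<Phi> (a i j))" if a: "positive_fun_matrix n a" for n a
    unfolding positive_op_matrix_def
  proof (intro allI impI)
    fix h assume "\<forall>i<n. h i \<in> hcarrier H"
    then have "\<forall>i. \<exists>u. i < n \<longrightarrow> cauchy u \<and> h i = cls u" by (auto elim!: hcarrierE)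
    then obtain u where u: "\<And>i. i < n \<Longrightarrow> cauchy (u i)" "\<And>i. i < n \<Longrightarrow> h i = cls (u i)" by metis
    obtain b where b: "\<And>i j. i < n \<Longrightarrow> j < n \<Longrightarrow> a i j = (\<Sum>l<n. cmult (conj_fun (b l i)) (b l j))"
      using a by (auto simp: positive_fun_matrix_def)
    \<comment> \<open>The quadratic form is computed on representing sequences; nonnegativity
      survives the limit because the nonnegative reals are closed.\<close>
    have conv: "(\<lambda>m. \<Sum>i<n. \<Sum>j<n. ip (\<lambda>x. k (a i j) x * fn (u j m) x) (fn (u i m)))
        \<longlonglongrightarrow> (\<Sum>i<n. \<Sum>j<n. hinner H (\<Phi> (a i j) (h j)) (h i))"
      unfolding \<Phi>_def by (intro tendsto_sum) (simp add: u hinner_mult_op)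
    have mem: "(\<Sum>i<n. \<Sum>j<n. ip (\<lambda>x. k (a i j) x * fn (u j m) x) (fn (u i m))) \<in> \<real>\<^sub>\<ge>\<^sub>0" for m
    proof -
      have "(\<Sum>i<n. \<Sum>j<n. ip (\<lambda>x. k (a i j) x * fn (u j m) x) (fn (u i m)))
        = (\<integral>x. (\<Sum>i<n. \<Sum>j<n. k (a i j) x * fn (u j m) x * cnj (fn (u i m) x)) \<partial>\<mu>)"
      proof -
        have "integrable \<mu> (\<lambda>x. k (a i j) x * fn (u j m) x * cnj (fn (u i m) x))" for i j
          by (intro bm_integrable bm_mult bm_cnj k_bm bm_apply)
        then show ?thesis by (simp add: ip_def)
      qed
      also have "\<dots> \<in> \<real>\<^sub>\<ge>\<^sub>0"
      proof (rule integral_nonneg_Reals)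
        fix x
        define c where "c j = fn (u j m) x" for j
        have int: "integrable (\<Lambda> x) (fn f)" for f
          by (rule integrable_bcontfun[OF ProbD(2,3)[OF \<Lambda>]])
        have "(\<Sum>i<n. \<Sum>j<n. k (a i j) x * c j * cnj (c i))
          = (\<integral>y. (\<Sum>i<n. \<Sum>j<n. fn (a i j) y * c j * cnj (c i)) \<partial>\<Lambda> x)"
          using int by (simp add: k_def state_of_def)
        also have "\<dots> \<in> \<real>\<^sub>\<ge>\<^sub>0"
        proof (rule integral_nonneg_Reals)
          fix y
          \<comment> \<open>At a fixed point \<open>y\<close> the form is the sum over
            \<open>l\<close> of the squared moduli of the components of the matrix \<open>b\<close>
            applied to \<open>c\<close>.\<close>
          have "(\<Sum>i<n. \<Sum>j<n. fn (a i j) y * c j * cnj (c i))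
            = (\<Sum>i<n. \<Sum>j<n. \<Sum>l<n. cnj (fn (b l i) y * c i) * (fn (b l j) y * c j))"
            by (intro sum.cong) (auto simp: b apply_bcontfun_sum sum_distrib_left sum_distrib_right algebra_simps)
          also have "\<dots> = (\<Sum>l<n. \<Sum>i<n. \<Sum>j<n. cnj (fn (b l i) y * c i) * (fn (b l j) y * c j))"
            by (subst sum.swap[of _ "{..<n}" "{..<n}"], subst sum.swap) (rule refl)
          also have "\<dots> = (\<Sum>l<n. cnj (\<Sum>i<n. fn (b l i) y * c i) * (\<Sum>j<n. fn (b l j) y * c j))"
            by (simp add: cnj_sum sum_product)
          also have "\<dots> \<in> \<real>\<^sub>\<ge>\<^sub>0" by (intro sum_nonneg_Reals cnj_mult_nonneg)
          finally show "(\<Sum>i<n. \<Sum>j<n. fn (a i j) y * c j * cnj (c i)) \<in> \<real>\<^sub>\<ge>\<^sub>0" .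
        qed
        finally show "(\<Sum>i<n. \<Sum>j<n. k (a i j) x * fn (u j m) x * cnj (fn (u i m) x)) \<in> \<real>\<^sub>\<ge>\<^sub>0"
          by (simp add: c_def)
      qed
      finally show ?thesis .
    qed
    show "(\<Sum>i<n. \<Sum>j<n. hinner H (\<Phi> (a i j) (h j)) (h i)) \<in> \<real>\<^sub>\<ge>\<^sub>0"
      by (rule closed_sequentially[OF closed_nonneg_Reals_complex mem conv])
  qed
  have one: "\<Phi> (const_bcontfun 1) h = h" if h: "h \<in> hcarrier H" for h
  proof -
    obtain u where u: "cauchy u" "h = cls u" using h by (rule hcarrierE)
    have "(\<lambda>n. cmult (const_bcontfun 1) (u n)) = u" by (auto intro!: bcontfun_eqI)
    then show ?thesis
      unfolding \<Phi>_def k_one mult_op_fn u(2) gns_rep_map_cls[OF u(1)] by (rule arg_cong)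
  qed
  have "ucp_map H \<Phi>"
    unfolding ucp_map_def using pos one
    by (auto simp: \<Phi>_def mult_op_bounded k_add k_scale mult_op_add mult_op_scale)
  moreover have "\<forall>s\<in>S. \<Phi> s = gns_rep_map \<phi> s"
    by (simp add: \<Phi>_def k_S mult_op_fn)
  moreover have "(\<integral>x. state_of (\<Lambda> x) a \<partial>\<mu>) = hinner H (\<Phi> a (gns_cyclic \<phi>)) (gns_cyclic \<phi>)" for a
    using hinner_mult_op_const[OF k_bm, of a "const_bcontfun 1" "const_bcontfun 1"]
    by (simp add: gns_cyclic_cls \<Phi>_def k_def)
  ultimately have "dilation_map S \<phi> (\<lambda>a. \<integral>x. state_of (\<Lambda> x) a \<partial>\<mu>) \<Phi>"
    by (simp add: dilation_map_def)
  moreover have "range \<Phi> \<subseteq> commutant H (commutant H (range (gns_rep_map \<phi>)))"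
    by (auto simp: \<Phi>_def mult_op_bicommutant)
  ultimately show ?thesis unfolding strong_dilation_le_def by blast
qed

end

section \<open>The Choquet order\<close>

lemma max_le_of_choquet:
  fixes S :: "('a::metric_space \<Rightarrow>\<^sub>C complex) set"
  assumes compact: "compact (UNIV :: 'a set)" and le: "choquet_le S \<mu> \<nu>"
    and F: "finite F" "F \<noteq> {}" "F \<subseteq> self_adjoint_part S"
  shows "(\<integral>x. Max ((\<lambda>s. apply_bcontfun s x) ` F) \<partial>\<mu>) \<le> (\<integral>x. Max ((\<lambda>s. apply_bcontfun s x) ` F) \<partial>\<nu>)"
proof -
  define f where "f = Bcontfun (\<lambda>x. Max ((\<lambda>s. apply_bcontfun s x) ` F))"
  have f: "apply_bcontfun f = (\<lambda>x. Max ((\<lambda>s. apply_bcontfun s x) ` F))"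
    unfolding f_def using F by (intro apply_bcontfun_Bcontfun compact continuous_on_Max_image) auto
  have "f \<in> max_stable_cone S"
    unfolding max_stable_cone_def
    by (intro subsetD[OF closure_subset] hull_inc CollectI exI[of _ F]) (simp add: F f)
  with le have "(\<integral>x. apply_bcontfun f x \<partial>\<mu>) \<le> (\<integral>x. apply_bcontfun f x \<partial>\<nu>)"
    by (simp add: choquet_le_def)
  then show ?thesis by (simp add: f)
qed

text \<open>The functions that satisfy the integral inequality form a convex cone, closed because
  integration against a probability measure is norm continuous; so the generators decide.\<close>

lemma choquet_of_max_le:
  fixes S :: "('a::topological_space \<Rightarrow>\<^sub>C complex) set"
  assumes \<mu>: "\<mu> \<in> Prob" and \<nu>: "\<nu> \<in> Prob"
    and le: "\<And>F f. finite F \<Longrightarrow> F \<noteq> {} \<Longrightarrow> F \<subseteq> self_adjoint_part S \<Longrightarrow>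
      (\<And>x. apply_bcontfun f x = Max ((\<lambda>s. apply_bcontfun s x) ` F)) \<Longrightarrow>
      (\<integral>x. apply_bcontfun f x \<partial>\<mu>) \<le> (\<integral>x. apply_bcontfun f x \<partial>\<nu>)"
  shows "choquet_le S \<mu> \<nu>"
proof -
  let ?C = "{f :: 'a \<Rightarrow>\<^sub>C real. (\<integral>x. apply_bcontfun f x \<partial>\<mu>) \<le> (\<integral>x. apply_bcontfun f x \<partial>\<nu>)}"
  have int: "integrable M (apply_bcontfun f)" if "M \<in> Prob" for M and f :: "'a \<Rightarrow>\<^sub>C real"
    by (rule integrable_bcontfun[OF ProbD(2,3)[OF that]])
  have cont: "continuous_on UNIV (\<lambda>f :: 'a \<Rightarrow>\<^sub>C real. \<integral>x. apply_bcontfun f x \<partial>M)" if "M \<in> Prob" for M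
  proof (rule continuous_onI)
    fix f :: "'a \<Rightarrow>\<^sub>C real" and e :: real assume "0 < e"
    then show "\<exists>d>0. \<forall>g\<in>UNIV. dist g f < d \<longrightarrow> dist (\<integral>x. apply_bcontfun g x \<partial>M) (\<integral>x. apply_bcontfun f x \<partial>M) \<le> e"
      by (intro exI[of _ e])
        (auto simp: dist_real_def intro!: order_trans[OF dist_integral_bcontfun_le[OF ProbD(1,3)[OF that]] less_imp_le])
  qed
  have "convex_cone ?C"
    unfolding convex_cone_iff
    using int[OF \<mu>] int[OF \<nu>] by (auto intro: add_mono mult_left_mono)
  then have "convex_cone hull {f. \<exists>F. finite F \<and> F \<noteq> {} \<and> F \<subseteq> self_adjoint_part S \<and>
      (\<forall>x. apply_bcontfun f x = Max ((\<lambda>s. apply_bcontfun s x) ` F))} \<subseteq> ?C"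
    by (intro hull_minimal) (use le in blast)+
  moreover have "closed ?C" by (intro closed_Collect_le cont \<mu> \<nu>)
  ultimately have "max_stable_cone S \<subseteq> ?C"
    unfolding max_stable_cone_def by (rule closure_minimal)
  then show ?thesis unfolding choquet_le_def by blast
qed

context borel_prob
begin

lemma strong_dilation_max_le:
  assumes sd: "strong_dilation_le S \<phi> \<psi>"
    and F: "finite F" "F \<noteq> {}" "F \<subseteq> self_adjoint_part S"
    and f: "\<And>x. apply_bcontfun f x = Max ((\<lambda>s. apply_bcontfun s x) ` F)"
  shows "(\<integral>x. apply_bcontfun f x \<partial>\<mu>) \<le> Re (\<psi> (of_real_fun f))"
proof (rule field_le_epsilon)
  fix e :: real assume e: "0 < e"
  obtain \<Phi> where \<Phi>: "dilation_map S \<phi> \<psi> \<Phi>"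
    and bicomm: "range \<Phi> \<subseteq> commutant H (commutant H (range (gns_rep_map \<phi>)))"
    using sd by (auto simp: strong_dilation_le_def)
  have ucp: "ucp_map H \<Phi>" and \<Phi>_S: "\<And>s. s \<in> S \<Longrightarrow> \<Phi> s = gns_rep_map \<phi> s"
    and \<psi>: "\<And>a. \<psi> a = hinner H (\<Phi> a (gns_cyclic \<phi>)) (gns_cyclic \<phi>)"
    using \<Phi> by (auto simp: dilation_map_def)
  have \<Phi>_op: "\<Phi> a \<in> bounded_operators H"
    and \<Phi>_add: "\<And>h. h \<in> hcarrier H \<Longrightarrow> \<Phi> (a + b) h = hadd H (\<Phi> a h) (\<Phi> b h)" for a b
    using ucp by (auto simp: ucp_map_def)
  have \<Phi>_in: "\<Phi> a h \<in> hcarrier H" if "h \<in> hcarrier H" for a h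
    using \<Phi>_op[of a] that by (auto simp: bounded_operators_def)
  define K where "K g = cls (\<lambda>n. g)" for g
  have K_in [simp]: "K g \<in> hcarrier H" for g by (simp add: K_def)
  have rep_K: "gns_rep_map \<phi> a (K g) = K (cmult a g)" for a g
    by (simp add: K_def gns_rep_map_cls del: fn_simps)
  \<comment> \<open>The algebra is commutative, so the representation lies in its own commutant and
    every \<open>\<Phi> a\<close> commutes with it.\<close>
  have rep_comm: "gns_rep_map \<phi> b \<in> commutant H (range (gns_rep_map \<phi>))" for b
  proof -
    have "gns_rep_map \<phi> b (gns_rep_map \<phi> a P) = gns_rep_map \<phi> a (gns_rep_map \<phi> b P)"
      if P: "P \<in> hcarrier H" for a P
    proof -
      obtain u where u: "cauchy u" "P = cls u" using P by (rule hcarrierE)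
      have "cmult b (cmult a (u n)) = cmult a (cmult b (u n))" for n
        by (rule bcontfun_eqI) simp
      then show ?thesis
        by (simp add: u(2) gns_rep_map_cls u(1) cauchy_cmult del: fn_simps)
    qed
    then show ?thesis
      unfolding commutant_def using gns_rep_map_bounded
      by (auto simp: compose_def intro!: restrict_ext)
  qed
  have comm: "\<Phi> a (gns_rep_map \<phi> b h) = gns_rep_map \<phi> b (\<Phi> a h)" if "h \<in> hcarrier H" for a b h
  proof -
    have "compose (hcarrier H) (\<Phi> a) (gns_rep_map \<phi> b) = compose (hcarrier H) (gns_rep_map \<phi> b) (\<Phi> a)"
      using bicomm rep_comm[of b] by (auto simp: commutant_def[of H "commutant H (range (gns_rep_map \<phi>))"])
    from fun_cong[OF this, of h] that show ?thesis by (simp add: compose_def)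
  qed
  have pos: "0 \<le> Re (hinner H (\<Phi> (of_real_fun g) h) h)"
    if g: "\<And>x. 0 \<le> apply_bcontfun g x" and h: "h \<in> hcarrier H" for g h
  proof -
    obtain b where "of_real_fun g = cmult (conj_fun b) b"
      using of_real_fun_eq_square[OF compact g] .
    then have "positive_fun_matrix 1 (\<lambda>_ _. of_real_fun g)"
      unfolding positive_fun_matrix_def by (intro exI[of _ "\<lambda>_ _. b"]) simp
    then have "positive_op_matrix H 1 (\<lambda>_ _. \<Phi> (of_real_fun g))"
      using ucp unfolding ucp_map_def by blast
    then show ?thesis
      using h unfolding positive_op_matrix_def by (auto dest!: spec[of _ "\<lambda>_. h"] simp: complex_nonneg_Reals_iff)
  qed
  \<comment> \<open>An explicit partition of unity by squares: \<open>w s\<close> is positive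
    exactly where \<open>s > f - e\<close>, some \<open>w s\<close> is positive at each point
    because the maximum is attained, and dividing by the root of \<open>W\<close> makes the squares
    add up to 1.\<close>
  define w where "w s x = max 0 (apply_bcontfun s x - apply_bcontfun f x + e)" for s x
  define W where "W x = (\<Sum>s\<in>F. (w s x)\<^sup>2)" for x
  have W_pos: "0 < W x" for x
  proof -
    have "Max ((\<lambda>s. apply_bcontfun s x) ` F) \<in> (\<lambda>s. apply_bcontfun s x) ` F"
      using F by (intro Max_in) auto
    then obtain s where s: "s \<in> F" "apply_bcontfun s x = apply_bcontfun f x"
      using f[of x] by auto
    then have "0 < (w s x)\<^sup>2" using e by (simp add: w_def)
    also have "\<dots> \<le> W x" unfolding W_def using F s by (intro member_le_sum) auto
    finally show ?thesis .
  qed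
  define p where "p s = Bcontfun (\<lambda>x. w s x / sqrt (W x))" for s
  have p: "apply_bcontfun (p s) = (\<lambda>x. w s x / sqrt (W x))" for s
    unfolding p_def
  proof (rule apply_bcontfun_Bcontfun[OF compact])
    have w_cont: "continuous_on UNIV (w s)" for s
      unfolding w_def by (intro continuous_intros) auto
    show "continuous_on UNIV (\<lambda>x. w s x / sqrt (W x))"
      using W_pos unfolding W_def by (intro continuous_intros w_cont) (auto simp: less_le)
  qed
  have p_sum: "(\<Sum>s\<in>F. (apply_bcontfun (p s) x)\<^sup>2) = 1" for x
    using W_pos[of x] by (simp add: p power_divide flip: sum_divide_distrib W_def)
  have p_f: "(apply_bcontfun f x - e) * (apply_bcontfun (p s) x)\<^sup>2 \<le> apply_bcontfun s x * (apply_bcontfun (p s) x)\<^sup>2" for s x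
  proof (cases "apply_bcontfun f x - e \<le> apply_bcontfun s x")
    case True then show ?thesis by (intro mult_right_mono) auto
  next
    case False then show ?thesis by (simp add: p w_def)
  qed
  define h where "h s = of_real_fun (p s)" for s
  have h: "fn (h s) x = of_real (apply_bcontfun (p s) x)" for s x
    by (simp add: h_def of_real_fun.rep_eq)
  have h_conj: "conj_fun (h s) = h s" for s by (rule bcontfun_eqI) (simp add: h)
  have K_add: "K (a + b) = hadd H (K a) (K b)" for a b
    by (simp add: K_def hadd_cls)
  \<comment> \<open>With the right vector kept cyclic, \<open>\<theta>\<close> is additive and can
    be summed over the partition. By commutation \<open>\<theta> (cmult (h s) (h s))\<close> equals
    the quadratic form of \<open>\<Phi> (of_real_fun f)\<close> at \<open>K (h s)\<close>, where
    positivity of \<open>f - s\<close> can be used.\<close>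
  define \<theta> where "\<theta> g = hinner H (\<Phi> (of_real_fun f) (K g)) (K (const_bcontfun 1))" for g
  have \<theta>_add: "\<theta> (a + b) = \<theta> a + \<theta> b" for a b
  proof -
    have "\<Phi> (of_real_fun f) (K (a + b)) = hadd H (\<Phi> (of_real_fun f) (K a)) (\<Phi> (of_real_fun f) (K b))"
      unfolding K_add using \<Phi>_op[of "of_real_fun f"] K_in unfolding bounded_operators_def by blast
    then show ?thesis by (simp add: \<theta>_def hinner_add_left \<Phi>_in)
  qed
  then interpret \<theta>: additive \<theta> by unfold_locales
  have \<theta>_h: "(\<integral>x. apply_bcontfun s x * (apply_bcontfun (p s) x)\<^sup>2 \<partial>\<mu>) \<le> Re (\<theta> (cmult (h s) (h s)))"
    if s: "s \<in> F" for s
  proof -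
    have mult_one: "cmult (h s) (const_bcontfun 1) = h s" by (rule bcontfun_eqI) simp
    have "\<theta> (cmult (h s) (h s)) = hinner H (gns_rep_map \<phi> (h s) (\<Phi> (of_real_fun f) (K (h s)))) (K (const_bcontfun 1))"
      unfolding \<theta>_def rep_K[symmetric] by (simp add: comm)
    also have "\<dots> = hinner H (\<Phi> (of_real_fun f) (K (h s))) (K (h s))"
      by (simp add: hinner_gns_rep_map \<Phi>_in h_conj rep_K mult_one)
    \<comment> \<open>On \<open>S\<close> the map is the representation, so the first summand yields
      an integral; positivity handles the second.\<close>
    also have "of_real_fun f = of_real_fun s + of_real_fun (f - s)"
      by (rule bcontfun_eqI) (simp add: of_real_fun.rep_eq)
    also have "hinner H (\<Phi> (of_real_fun s + of_real_fun (f - s)) (K (h s))) (K (h s))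
      = hinner H (gns_rep_map \<phi> (of_real_fun s) (K (h s))) (K (h s)) + hinner H (\<Phi> (of_real_fun (f - s)) (K (h s))) (K (h s))"
      using F(3) s by (simp add: \<Phi>_add hinner_add_left \<Phi>_in \<Phi>_S[of "of_real_fun s", symmetric] self_adjoint_part_def subset_eq)
    also have "hinner H (gns_rep_map \<phi> (of_real_fun s) (K (h s))) (K (h s))
      = of_real (\<integral>x. apply_bcontfun s x * (apply_bcontfun (p s) x)\<^sup>2 \<partial>\<mu>)"
      unfolding K_def hinner_gns_rep_map_const integral_complex_of_real[symmetric]
      by (rule Bochner_Integration.integral_cong) (simp_all add: h of_real_fun.rep_eq power2_eq_square)
    finally have eq: "\<theta> (cmult (h s) (h s)) = of_real (\<integral>x. apply_bcontfun s x * (apply_bcontfun (p s) x)\<^sup>2 \<partial>\<mu>)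
      + hinner H (\<Phi> (of_real_fun (f - s)) (K (h s))) (K (h s))" .
    have "0 \<le> apply_bcontfun (f - s) x" for x
      using F s f[of x] by (auto intro!: Max_ge)
    from pos[OF this, of "K (h s)"] show ?thesis by (simp add: eq)
  qed
  have int: "integrable \<mu> (\<lambda>x. apply_bcontfun s x * (apply_bcontfun (p s) x)\<^sup>2)" for s
  proof -
    have "(\<lambda>x. apply_bcontfun s x * (apply_bcontfun (p s) x)\<^sup>2) = apply_bcontfun (Bcontfun (\<lambda>x. apply_bcontfun s x * (apply_bcontfun (p s) x)\<^sup>2))"
      by (rule apply_bcontfun_Bcontfun[symmetric]) (auto intro!: continuous_intros compact)
    then show ?thesis using integrable_bcontfun[OF finite_measure_axioms sets_eq] by metis
  qed
  have int_f: "integrable \<mu> (apply_bcontfun f)"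
    by (rule integrable_bcontfun[OF finite_measure_axioms sets_eq])
  have "(\<integral>x. apply_bcontfun f x \<partial>\<mu>) - e = (\<integral>x. apply_bcontfun f x - e \<partial>\<mu>)"
    using int_f prob_space by simp
  also have "\<dots> \<le> (\<integral>x. (\<Sum>s\<in>F. apply_bcontfun s x * (apply_bcontfun (p s) x)\<^sup>2) \<partial>\<mu>)"
  proof (rule integral_mono)
    fix x
    have "apply_bcontfun f x - e = (\<Sum>s\<in>F. (apply_bcontfun f x - e) * (apply_bcontfun (p s) x)\<^sup>2)"
      by (simp add: p_sum flip: sum_distrib_left)
    also have "\<dots> \<le> (\<Sum>s\<in>F. apply_bcontfun s x * (apply_bcontfun (p s) x)\<^sup>2)"
      by (intro sum_mono p_f)
    finally show "apply_bcontfun f x - e \<le> (\<Sum>s\<in>F. apply_bcontfun s x * (apply_bcontfun (p s) x)\<^sup>2)" .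
  qed (use int int_f in auto)
  also have "\<dots> = (\<Sum>s\<in>F. \<integral>x. apply_bcontfun s x * (apply_bcontfun (p s) x)\<^sup>2 \<partial>\<mu>)"
    using int by (intro Bochner_Integration.integral_sum) auto
  also have "\<dots> \<le> (\<Sum>s\<in>F. Re (\<theta> (cmult (h s) (h s))))"
    by (intro sum_mono \<theta>_h)
  also have "\<dots> = Re (\<theta> (\<Sum>s\<in>F. cmult (h s) (h s)))"
    by (simp add: \<theta>.sum)
  also have "(\<Sum>s\<in>F. cmult (h s) (h s)) = const_bcontfun 1"
    using p_sum by (intro bcontfun_eqI) (simp add: apply_bcontfun_sum h power2_eq_square flip: of_real_mult of_real_sum)
  also have "\<theta> (const_bcontfun 1) = \<psi> (of_real_fun f)"
    by (simp add: \<theta>_def \<psi> K_def gns_cyclic_cls)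
  finally show "(\<integral>x. apply_bcontfun f x \<partial>\<mu>) \<le> Re (\<psi> (of_real_fun f)) + e" by simp
qed

end

text \<open>Shared by (3) and (4). Where the state \<open>\<theta> w\<close> takes the values
  \<open>E s w\<close> on \<open>F\<close>, monotonicity bounds each of them by the value at
  \<open>f\<close>, hence also their maximum; it remains to integrate. The bound on \<open>E\<close>
  provides integrability.\<close>

lemma max_le_of_state_field:
  fixes \<theta> :: "'w \<Rightarrow> 'a::metric_space functional"
  assumes compact: "compact (UNIV :: 'a set)" and N: "prob_space N"
    and \<theta>: "\<And>w. w \<in> space N \<Longrightarrow> \<theta> w \<in> states"
    and meas: "\<And>a. (\<lambda>w. \<theta> w a) \<in> borel_measurable (completion N)"
    and \<psi>: "\<And>a. \<psi> a = (\<integral>w. \<theta> w a \<partial>completion N)"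
    and F: "finite F" "F \<noteq> {}" and f: "\<And>x. apply_bcontfun f x = Max ((\<lambda>s. apply_bcontfun s x) ` F)"
    and E: "\<And>s. s \<in> F \<Longrightarrow> E s \<in> borel_measurable N" "\<And>s w. s \<in> F \<Longrightarrow> w \<in> space N \<Longrightarrow> \<bar>E s w\<bar> \<le> norm s"
    and AE: "AE w in completion N. \<forall>s\<in>F. \<theta> w (of_real_fun s) = of_real (E s w)"
  shows "(\<integral>w. Max ((\<lambda>s. E s w) ` F) \<partial>N) \<le> Re (\<psi> (of_real_fun f))"
proof -
  interpret N: prob_space N by fact
  interpret C: prob_space "completion N" by (rule N.prob_space_completion)
  have meas_Max: "(\<lambda>w. Max ((\<lambda>s. E s w) ` F)) \<in> borel_measurable N"
    using F(1) E(1) by (intro borel_measurable_Max) auto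
  have int1: "integrable (completion N) (\<lambda>w. Max ((\<lambda>s. E s w) ` F))"
  proof (rule C.integrable_const_bound[where B="\<Sum>s\<in>F. norm s"])
    have "norm (Max ((\<lambda>s. E s w) ` F)) \<le> (\<Sum>s\<in>F. norm s)" if "w \<in> space N" for w
    proof -
      have "Max ((\<lambda>s. E s w) ` F) \<in> (\<lambda>s. E s w) ` F" using F by (intro Max_in) auto
      then obtain s where "s \<in> F" "Max ((\<lambda>s. E s w) ` F) = E s w" by auto
      then show ?thesis
        using E(2)[of s w] that member_le_sum[of s F norm] F(1) by simp
    qed
    then show "AE w in completion N. norm (Max ((\<lambda>s. E s w) ` F)) \<le> (\<Sum>s\<in>F. norm s)"
      by (intro AE_I2) simp
  qed (rule measurable_completion[OF meas_Max])
  have re_meas: "(\<lambda>w. Re (\<theta> w (of_real_fun f))) \<in> borel_measurable (completion N)"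
    using meas by measurable
  have int2: "integrable (completion N) (\<lambda>w. Re (\<theta> w (of_real_fun f)))"
    using abs_real_state_le[OF compact \<theta>, of _ f] re_meas
    by (intro C.integrable_const_bound[where B="norm f"] AE_I2) (auto simp: real_state_def)
  have "(\<integral>w. Max ((\<lambda>s. E s w) ` F) \<partial>N) = (\<integral>w. Max ((\<lambda>s. E s w) ` F) \<partial>completion N)"
    by (rule integral_completion[symmetric]) (rule meas_Max)
  also have "\<dots> \<le> (\<integral>w. Re (\<theta> w (of_real_fun f)) \<partial>completion N)"
  proof (rule integral_mono_AE[OF int1 int2])
    show "AE w in completion N. Max ((\<lambda>s. E s w) ` F) \<le> Re (\<theta> w (of_real_fun f))"
      using AE AE_space
    proof eventually_elim
      case (elim w)
      then have w: "\<theta> w \<in> states" by (intro \<theta>) simp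
      have "E s w \<le> Re (\<theta> w (of_real_fun f))" if s: "s \<in> F" for s
      proof -
        have "real_state (\<theta> w) s \<le> real_state (\<theta> w) f"
          using F(1) s by (intro real_state_mono[OF compact w]) (auto simp: f intro!: Max_ge)
        moreover have "real_state (\<theta> w) s = E s w" using elim s by (simp add: real_state_def)
        ultimately show ?thesis by (simp add: real_state_def)
      qed
      then show ?case using F by simp
    qed
  qed
  also have "\<dots> = Re (\<psi> (of_real_fun f))"
  proof -
    have "\<psi> (of_real_fun f) = (\<integral>w. complex_of_real (Re (\<theta> w (of_real_fun f))) \<partial>completion N)"
      unfolding \<psi>
      by (rule Bochner_Integration.integral_cong)
         (use state_of_real_fun[OF compact \<theta>, of _ f] in \<open>auto simp: real_state_def\<close>)
    then show ?thesis by (simp add: integral_complex_of_real)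
  qed
  finally show ?thesis .
qed

section \<open>Integral subdivisions\<close>

lemma measurable_eval_state [measurable]: "(\<lambda>\<alpha>. \<alpha> a) \<in> borel_measurable state_borel"
  unfolding state_borel_def
  by (intro measurable_restrict_space1 borel_measurable_continuous_onI continuous_on_product_coordinates)

lemma space_state_borel [simp]: "space state_borel = states"
  by (simp add: state_borel_def space_restrict_space)

lemma Re_state_of_eq:
  "Re (state_of M (of_real_fun f)) = (\<integral>x. apply_bcontfun f x \<partial>M)"
  by (simp add: state_of_of_real_fun)

section \<open>Measurable dependence of representing measures on states\<close>

definition state_measure :: "'a::metric_space functional \<Rightarrow> 'a measure" where
  "state_measure \<alpha> = (SOME M. M \<in> Prob \<and> \<alpha> = state_of M)"

lemma state_measure:
  assumes "compact (UNIV :: 'a::metric_space set)" and "\<alpha> \<in> states"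
  shows "state_measure \<alpha> \<in> (Prob :: 'a measure set)" "state_of (state_measure \<alpha>) = \<alpha>"
proof -
  have "\<exists>M. M \<in> Prob \<and> \<alpha> = state_of M" using state_eq_state_of[OF assms] by metis
  then have "state_measure \<alpha> \<in> Prob \<and> \<alpha> = state_of (state_measure \<alpha>)"
    unfolding state_measure_def by (rule someI_ex)
  then show "state_measure \<alpha> \<in> (Prob :: 'a measure set)" "state_of (state_measure \<alpha>) = \<alpha>" by auto
qed

text \<open>Evaluations at functions are measurable on the state space. The mass of a closed set is
  a limit of evaluations at continuous functions, and closed sets generate the Borel sets.\<close>

lemma measurable_state_measure:
  assumes compact: "compact (UNIV :: 'a::metric_space set)" and m: "sets m = sets state_borel"
  shows "state_measure \<in> m \<rightarrow>\<^sub>M subprob_algebra (borel :: 'a measure)"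
proof (rule measurable_subprob_algebra_generated[OF sets_borel_sigma_closed Int_stable_closed])
  have space: "space m = states" using sets_eq_imp_space_eq[OF m] by simp
  fix \<alpha> assume "\<alpha> \<in> space m"
  then have P: "state_measure \<alpha> \<in> Prob" using state_measure[OF compact] by (simp add: space)
  show "subprob_space (state_measure \<alpha>)" "sets (state_measure \<alpha>) = sets borel"
    using ProbD[OF P] by (auto intro: prob_space_imp_subprob_space)
next
  have space: "space m = states" using sets_eq_imp_space_eq[OF m] by simp
  have P: "state_measure \<alpha> \<in> Prob" if "\<alpha> \<in> space m" for \<alpha> :: "'a functional"
    using that state_measure[OF compact] by (simp add: space)
  have eval: "(\<lambda>\<alpha>. \<alpha> a) \<in> borel_measurable m" for a :: "'a \<Rightarrow>\<^sub>C complex"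
    using measurable_eval_state m by (simp cong: measurable_cong_sets)
  show meas: "(\<lambda>\<alpha>. emeasure (state_measure \<alpha>) K) \<in> borel_measurable m" if K: "K \<in> {K. closed K}" for K :: "'a set"
  proof -
    obtain g :: "nat \<Rightarrow> 'a \<Rightarrow> real"
      where g: "\<And>n. continuous_on UNIV (g n)" "\<And>n x. 0 \<le> g n x" "\<And>n x. g n x \<le> 1"
        "\<And>x. (\<lambda>n. g n x) \<longlonglongrightarrow> indicator K x"
      using indicator_closed_limit[of K] K by auto
    have "(\<lambda>\<alpha>. measure (state_measure \<alpha>) K) \<in> borel_measurable m"
    proof (rule borel_measurable_LIMSEQ_real)
      fix \<alpha> assume \<alpha>: "\<alpha> \<in> space m"
      show "(\<lambda>n. Re (\<alpha> (of_real_fun (Bcontfun (g n))))) \<longlonglongrightarrow> measure (state_measure \<alpha>) K"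
      proof -
        have "Re (\<alpha> (of_real_fun (Bcontfun (g n)))) = (\<integral>x. g n x \<partial>state_measure \<alpha>)" for n
          using Re_state_of_eq[of "state_measure \<alpha>" "Bcontfun (g n)"] state_measure(2)[OF compact, of \<alpha>] \<alpha>
          by (simp add: space apply_bcontfun_Bcontfun[OF compact] g(1))
        then show ?thesis
          using integral_indicator_closed_limit[OF ProbD(2,3)[OF P[OF \<alpha>]] _ g] K by simp
      qed
    qed (use eval in measurable)
    then have "(\<lambda>\<alpha>. ennreal (measure (state_measure \<alpha>) K)) \<in> borel_measurable m" by measurable
    then show ?thesis
      by (rule measurable_cong[THEN iffD1, rotated])
         (use finite_measure.emeasure_eq_measure[OF ProbD(2)[OF P]] in auto)
  qed
  show "(\<lambda>\<alpha>. emeasure (state_measure \<alpha>) UNIV) \<in> borel_measurable m"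
    by (rule meas) simp
qed auto

text \<open>The barycentre condition read as a disintegration: averaging the representing measures
  of the states over \<open>m\<close> gives \<mu>. Both sides are compared on continuous functions,
  where the left one is a value of the barycentre.\<close>

lemma bind_state_measure:
  fixes \<mu> :: "'a::metric_space measure"
  assumes compact: "compact (UNIV :: 'a set)" and \<mu>: "\<mu> \<in> Prob"
    and m: "prob_space m" "sets m = sets state_borel" and bary: "barycenter m = state_of \<mu>"
  shows "m \<bind> state_measure = \<mu>"
proof (rule measure_eqI_continuous)
  interpret m: prob_space m by fact
  have space: "space m = states" using sets_eq_imp_space_eq[OF m(2)] by simp
  note K = measurable_state_measure[OF compact m(2)]
  have P: "state_measure \<alpha> \<in> Prob" if "\<alpha> \<in> space m" for \<alpha> :: "'a functional"
    using that state_measure[OF compact] by (simp add: space)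
  show "sets (m \<bind> state_measure) = sets borel"
    by (rule sets_bind[OF _ m.not_empty]) (rule ProbD(3)[OF P])
  have "subprob_space (m \<bind> state_measure)"
    by (rule subprob_space_bind[OF prob_space_imp_subprob_space[OF m(1)] K])
  then show "finite_measure (m \<bind> state_measure)" by (simp add: subprob_space_def)
  fix f :: "'a \<Rightarrow> real" assume f: "continuous_on UNIV f" "\<And>x. 0 \<le> f x" "\<And>x. f x \<le> 1"
  define F where "F = Bcontfun f"
  have F: "apply_bcontfun F = f" unfolding F_def by (rule apply_bcontfun_Bcontfun[OF compact f(1)])
  have "(\<integral>x. f x \<partial>(m \<bind> state_measure)) = (\<integral>\<alpha>. \<integral>x. f x \<partial>state_measure \<alpha> \<partial>m)"
  proof (rule integral_bind[OF _ _ K, where B=1 and B'=1])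
    show "AE \<alpha> in m. emeasure (state_measure \<alpha>) (space (state_measure \<alpha>)) \<le> ennreal 1"
      using prob_space.emeasure_space_1[OF ProbD(1)[OF P]] by (intro AE_I2) auto
  qed (use f m.finite_measure_axioms in \<open>auto intro: borel_measurable_continuous_onI\<close>)
  also have "\<dots> = (\<integral>\<alpha>. Re (\<alpha> (of_real_fun F)) \<partial>m)"
  proof (rule Bochner_Integration.integral_cong[OF refl])
    fix \<alpha> :: "'a functional" assume "\<alpha> \<in> space m"
    then show "(\<integral>x. f x \<partial>state_measure \<alpha>) = Re (\<alpha> (of_real_fun F))"
      using Re_state_of_eq[of "state_measure \<alpha>" F] state_measure(2)[OF compact, of \<alpha>] by (simp add: space F)
  qed
  also have "\<dots> = Re (barycenter m (of_real_fun F))"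
  proof -
    have "barycenter m (of_real_fun F) = (\<integral>\<alpha>. complex_of_real (Re (\<alpha> (of_real_fun F))) \<partial>m)"
      unfolding barycenter_def
      by (rule Bochner_Integration.integral_cong)
        (use state_of_real_fun[OF compact, of _ F] in \<open>auto simp: real_state_def space\<close>)
    then show ?thesis by (simp add: integral_complex_of_real)
  qed
  also have "\<dots> = (\<integral>x. f x \<partial>\<mu>)" by (simp add: bary Re_state_of_eq F)
  finally show "(\<integral>x. f x \<partial>(m \<bind> state_measure)) = (\<integral>x. f x \<partial>\<mu>)" .
qed (use ProbD[OF \<mu>] in auto)

section \<open>The subdivision relation and kernels compared with the Choquet order\<close>

lemma borel_probI: "compact (UNIV :: 'a::metric_space set) \<Longrightarrow> M \<in> Prob \<Longrightarrow> borel_prob (M :: 'a measure)"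
  using ProbD[of M] by (simp add: borel_prob_def borel_prob_axioms_def)

lemma integral_complex_Re_Im:
  fixes f :: "'w \<Rightarrow> complex"
  assumes "integrable M f"
  shows "(\<integral>x. f x \<partial>M) = Complex (\<integral>x. Re (f x) \<partial>M) (\<integral>x. Im (f x) \<partial>M)"
  using assms by (simp add: complex_eq_iff)

text \<open>\<open>\<Psi> \<alpha>\<close> is the kernel averaged over the measure representing
  \<alpha>. It dilates \<alpha> by \<open>strong_dilation_of_kernel\<close>, for every \<alpha>; it
  is measurable because \<open>state_measure\<close> is; and averaging over \<open>m\<close> turns
  it into the average over \<mu>, by \<open>bind_state_measure\<close>.\<close>

lemma isd_of_kernel:
  fixes S :: "('a::metric_space \<Rightarrow>\<^sub>C complex) set" and \<Lambda> :: "'a \<Rightarrow> 'a measure"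
  assumes compact: "compact (UNIV :: 'a set)" and \<mu>: "\<mu> \<in> Prob"
    and \<Lambda>: "\<And>x. \<Lambda> x \<in> Prob"
    and meas: "\<And>f :: 'a \<Rightarrow>\<^sub>C complex. (\<lambda>x. state_of (\<Lambda> x) f) \<in> borel_measurable borel"
    and bary: "\<And>x s. s \<in> S \<Longrightarrow> state_of (\<Lambda> x) s = apply_bcontfun s x"
    and \<nu>: "\<And>f :: 'a \<Rightarrow>\<^sub>C complex. state_of \<nu> f = (\<integral>x. state_of (\<Lambda> x) f \<partial>\<mu>)"
  shows "isd_le S (state_of \<mu>) (state_of \<nu>)"
  unfolding isd_le_def
proof (intro allI impI, elim conjE)
  fix m :: "'a functional measure"
  assume m: "prob_space m" "sets m = sets state_borel" "barycenter m = state_of \<mu>"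
  interpret m: prob_space m by fact
  have space: "space m = states" using sets_eq_imp_space_eq[OF m(2)] by simp
  note K = measurable_state_measure[OF compact m(2)]
  note P = state_measure(1)[OF compact] and P_eq = state_measure(2)[OF compact]
  define k where "k a x = state_of (\<Lambda> x) a" for a x
  have k_meas [measurable]: "k a \<in> borel_measurable borel" for a
    unfolding k_def by (rule meas)
  have k_add: "k (f + g) x = k f x + k g x" for f g x
    by (simp add: k_def state_of_add[OF \<Lambda>])
  have k_bound: "norm (k a x) \<le> norm a" for a x
    unfolding k_def by (rule norm_state_of_le[OF \<Lambda>])
  define \<Psi> where "\<Psi> \<alpha> a = (\<integral>x. k a x \<partial>state_measure \<alpha>)" for \<alpha> a
  have k_meas': "k a \<in> borel_measurable M" if "M \<in> Prob" for a M
    using k_meas ProbD(3)[OF that] by (simp cong: measurable_cong_sets)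
  have k_int: "integrable M (k a)" if "M \<in> Prob" for a M
  proof -
    interpret prob_space M by (rule ProbD(1)[OF that])
    show ?thesis using k_bound k_meas'[OF that] by (intro integrable_const_bound[where B="norm a"]) auto
  qed
  have \<Psi>_states: "\<Psi> \<alpha> \<in> states" if "\<alpha> \<in> states" for \<alpha>
    unfolding states_def
  proof (intro CollectI conjI allI)
    note P\<alpha> = P[OF that]
    interpret prob_space "state_measure \<alpha>" by (rule ProbD(1)[OF P\<alpha>])
    show "\<Psi> \<alpha> (f + g) = \<Psi> \<alpha> f + \<Psi> \<alpha> g" for f g
      using k_int[OF P\<alpha>] by (simp add: \<Psi>_def k_add)
    show "\<Psi> \<alpha> (const_mult c f) = c * \<Psi> \<alpha> f" for c f
      by (simp add: \<Psi>_def k_def state_of_const_mult)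
    show "\<Psi> \<alpha> (cmult (conj_fun f) f) \<in> \<real>\<^sub>\<ge>\<^sub>0" for f
      unfolding \<Psi>_def k_def
      by (intro integral_nonneg_Reals state_of_nonneg) (simp add: cmult.rep_eq conj_fun.rep_eq cnj_mult_nonneg)
    show "\<Psi> \<alpha> (const_bcontfun 1) = 1"
      by (simp add: \<Psi>_def k_def state_of_one[OF \<Lambda>] prob_space)
  qed
  have \<Psi>_meas: "(\<lambda>\<alpha>. \<Psi> \<alpha> a) \<in> borel_measurable m" for a
    unfolding \<Psi>_def by (rule measurable_compose[OF K integral_measurable_subprob_algebra]) simp
  have dil: "dilation_le S \<alpha> (\<Psi> \<alpha>)" if "\<alpha> \<in> states" for \<alpha>
  proof -
    interpret A: borel_prob "state_measure \<alpha>" by (rule borel_probI[OF compact P[OF that]])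
    have "strong_dilation_le S (state_of (state_measure \<alpha>)) (\<lambda>a. \<integral>x. state_of (\<Lambda> x) a \<partial>state_measure \<alpha>)"
      by (rule A.strong_dilation_of_kernel[OF \<Lambda> meas bary])
    then show ?thesis
      unfolding P_eq[OF that] by (auto simp: strong_dilation_le_def dilation_le_def \<Psi>_def[abs_def] k_def[abs_def])
  qed
  \<comment> \<open>The averaging identity is stated for real functions; complex ones are split into
    real and imaginary parts below.\<close>
  have real: "(\<integral>\<alpha>. \<integral>x. g x \<partial>state_measure \<alpha> \<partial>m) = (\<integral>x. g x \<partial>\<mu>)"
    if g: "g \<in> borel_measurable borel" "\<And>x. \<bar>g x\<bar> \<le> B" for g :: "'a \<Rightarrow> real" and B
    unfolding bind_state_measure[OF compact \<mu> m, symmetric]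
  proof (rule integral_bind[OF _ _ K, where B=B and B'=1, symmetric])
    show "AE \<alpha> in m. emeasure (state_measure \<alpha>) (space (state_measure \<alpha>)) \<le> ennreal 1"
      using prob_space.emeasure_space_1[OF ProbD(1)[OF P]] by (intro AE_I2) (auto simp: space)
  qed (use g m.finite_measure_axioms in auto)
  have int_\<Psi>: "(\<integral>\<alpha>. \<Psi> \<alpha> a \<partial>m) = (\<integral>x. k a x \<partial>\<mu>)" for a
  proof -
    have \<Psi>_bound: "norm (\<Psi> \<alpha> a) \<le> norm a" if "\<alpha> \<in> states" for \<alpha>
    proof -
      interpret prob_space "state_measure \<alpha>" by (rule ProbD(1)[OF P[OF that]])
      have "norm (\<Psi> \<alpha> a) \<le> (\<integral>x. norm (k a x) \<partial>state_measure \<alpha>)"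
        unfolding \<Psi>_def by (rule integral_norm_bound)
      also have "\<dots> \<le> (\<integral>x. norm a \<partial>state_measure \<alpha>)"
        by (intro integral_mono integrable_norm k_int[OF P[OF that]] k_bound) simp
      finally show ?thesis by (simp add: prob_space)
    qed
    have "integrable m (\<lambda>\<alpha>. \<Psi> \<alpha> a)"
      using \<Psi>_meas \<Psi>_bound by (intro m.integrable_const_bound[where B="norm a"] AE_I2) (auto simp: space)
    then have "(\<integral>\<alpha>. \<Psi> \<alpha> a \<partial>m) = Complex (\<integral>\<alpha>. Re (\<Psi> \<alpha> a) \<partial>m) (\<integral>\<alpha>. Im (\<Psi> \<alpha> a) \<partial>m)"
      by (rule integral_complex_Re_Im)
    also have "(\<integral>\<alpha>. Re (\<Psi> \<alpha> a) \<partial>m) = (\<integral>\<alpha>. \<integral>x. Re (k a x) \<partial>state_measure \<alpha> \<partial>m)"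
      by (rule Bochner_Integration.integral_cong) (auto simp: \<Psi>_def space k_int[OF P])
    also have "\<dots> = (\<integral>x. Re (k a x) \<partial>\<mu>)"
      by (rule real[of "\<lambda>x. Re (k a x)" "norm a"]) (auto intro: order_trans[OF abs_Re_le_cmod k_bound])
    also have "(\<integral>\<alpha>. Im (\<Psi> \<alpha> a) \<partial>m) = (\<integral>\<alpha>. \<integral>x. Im (k a x) \<partial>state_measure \<alpha> \<partial>m)"
      by (rule Bochner_Integration.integral_cong) (auto simp: \<Psi>_def space k_int[OF P])
    also have "\<dots> = (\<integral>x. Im (k a x) \<partial>\<mu>)"
      by (rule real[of "\<lambda>x. Im (k a x)" "norm a"]) (auto intro: order_trans[OF abs_Im_le_cmod k_bound])
    finally show ?thesis using integral_complex_Re_Im[OF k_int[OF \<mu>]] by simp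
  qed
  show "\<exists>\<Psi>. (\<forall>\<alpha>\<in>states. \<Psi> \<alpha> \<in> states) \<and>
      (\<forall>a. (\<lambda>\<alpha>. \<Psi> \<alpha> a) \<in> borel_measurable (completion m)) \<and>
      (AE \<alpha> in completion m. dilation_le S \<alpha> (\<Psi> \<alpha>)) \<and>
      (\<forall>a. state_of \<nu> a = (\<integral>\<alpha>. \<Psi> \<alpha> a \<partial>completion m))"
  proof (intro exI[of _ \<Psi>] conjI allI ballI \<Psi>_states)
    show "(\<lambda>\<alpha>. \<Psi> \<alpha> a) \<in> borel_measurable (completion m)" for a
      by (rule measurable_completion[OF \<Psi>_meas])
    show "AE \<alpha> in completion m. dilation_le S \<alpha> (\<Psi> \<alpha>)"
      using dil by (intro AE_I2) (simp add: space)
    show "state_of \<nu> a = (\<integral>\<alpha>. \<Psi> \<alpha> a \<partial>completion m)" for a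
      by (simp add: integral_completion[OF \<Psi>_meas] int_\<Psi> \<nu> k_def)
  qed
qed

text \<open>Dirac states are the right subdivision: there the maximum of the values on
  \<open>F\<close> is the value of \<open>f\<close> at the point, so the left side of
  \<open>max_le_of_state_field\<close> becomes the full integral of \<open>f\<close>. A dilation
  does not change values on \<open>S\<close>, which supplies the almost sure hypothesis.\<close>

lemma isd_max_le:
  fixes S :: "('a::metric_space \<Rightarrow>\<^sub>C complex) set"
  assumes compact: "compact (UNIV :: 'a set)" and \<mu>: "\<mu> \<in> Prob"
    and isd: "isd_le S (state_of \<mu>) \<psi>"
    and F: "finite F" "F \<noteq> {}" "F \<subseteq> self_adjoint_part S"
    and f: "\<And>x. apply_bcontfun f x = Max ((\<lambda>s. apply_bcontfun s x) ` F)"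
  shows "(\<integral>x. apply_bcontfun f x \<partial>\<mu>) \<le> Re (\<psi> (of_real_fun f))"
proof -
  interpret \<mu>: borel_prob \<mu> by (rule borel_probI[OF compact \<mu>])
  define \<delta> :: "'a \<Rightarrow> 'a functional" where "\<delta> x = (\<lambda>a. apply_bcontfun a x)" for x
  have \<delta>_states: "\<delta> x \<in> states" for x
    by (auto simp: \<delta>_def states_def cmult.rep_eq const_mult.rep_eq conj_fun.rep_eq const_bcontfun.rep_eq cnj_mult_nonneg)
  have \<delta>_meas: "\<delta> \<in> measurable \<mu> state_borel"
    unfolding state_borel_def
  proof (rule measurable_restrict_space2)
    show "\<delta> \<in> borel_measurable \<mu>"
      unfolding \<delta>_def
      by (intro borel_measurable_continuous_on_UNIV[OF \<mu>.sets_eq] continuous_on_coordinatewise_then_product) simp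
  qed (use \<delta>_states in auto)
  define m where "m = distr \<mu> state_borel \<delta>"
  have m: "prob_space m" "sets m = sets state_borel"
    using \<mu>.prob_space_distr[OF \<delta>_meas] by (auto simp: m_def)
  have space: "space m = states" by (simp add: m_def)
  have eval: "(\<lambda>\<alpha>. \<alpha> a) \<in> borel_measurable m" for a :: "'a \<Rightarrow>\<^sub>C complex"
    using measurable_eval_state m by (simp cong: measurable_cong_sets)
  have bary: "barycenter m = state_of \<mu>"
    unfolding barycenter_def m_def state_of_def
    by (rule ext, subst integral_distr[OF \<delta>_meas]) (auto simp: \<delta>_def)
  from isd[unfolded isd_le_def, THEN spec, of m, THEN mp, OF conjI[OF m(1) conjI[OF m(2) bary]]]
  obtain \<Psi> where "\<forall>\<alpha>\<in>states. \<Psi> \<alpha> \<in> states"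
    "\<forall>a. (\<lambda>\<alpha>. \<Psi> \<alpha> a) \<in> borel_measurable (completion m)"
    "AE \<alpha> in completion m. dilation_le S \<alpha> (\<Psi> \<alpha>)"
    "\<forall>a. \<psi> a = (\<integral>\<alpha>. \<Psi> \<alpha> a \<partial>completion m)"
    by (elim exE conjE)
  note \<Psi> = this(1)[rule_format] this(2)[rule_format] this(3) this(4)[rule_format]
  have "(\<integral>\<alpha>. Max ((\<lambda>s. real_state \<alpha> s) ` F) \<partial>m) \<le> Re (\<psi> (of_real_fun f))"
  proof (rule max_le_of_state_field[OF compact m(1) _ \<Psi>(2,4) F(1,2) f, where E="\<lambda>s \<alpha>. real_state \<alpha> s"])
    show "(\<lambda>\<alpha>. real_state \<alpha> s) \<in> borel_measurable m" for s :: "'a \<Rightarrow>\<^sub>C real"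
      unfolding real_state_def using eval by measurable
    show "\<bar>real_state \<alpha> s\<bar> \<le> norm s" if "\<alpha> \<in> space m" for \<alpha> and s :: "'a \<Rightarrow>\<^sub>C real"
      using that abs_real_state_le[OF compact] by (simp add: space)
    show "AE \<alpha> in completion m. \<forall>s\<in>F. \<Psi> \<alpha> (of_real_fun s) = of_real (real_state \<alpha> s)"
      using \<Psi>(3) AE_space
    proof eventually_elim
      case (elim \<alpha>)
      then have \<alpha>: "\<alpha> \<in> states" by (simp add: space)
      interpret A: borel_prob "state_measure \<alpha>" by (rule borel_probI[OF compact state_measure(1)[OF compact \<alpha>]])
      have "\<Psi> \<alpha> s = \<alpha> s" if "s \<in> S" for s
        using A.dilation_map_state[OF _ that] elim(1) by (auto simp: state_measure(2)[OF compact \<alpha>] dilation_le_def)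
      then show ?case
        using F(3) state_of_real_fun[OF compact \<alpha>] by (auto simp: self_adjoint_part_def)
    qed
  qed (use \<Psi>(1) space in auto)
  also have "(\<integral>\<alpha>. Max ((\<lambda>s. real_state \<alpha> s) ` F) \<partial>m) = (\<integral>x. apply_bcontfun f x \<partial>\<mu>)"
  proof -
    have "(\<lambda>\<alpha>. Max ((\<lambda>s. real_state \<alpha> s) ` F)) \<in> borel_measurable state_borel"
      unfolding real_state_def using F(1) by (intro borel_measurable_Max) auto
    then show ?thesis
      unfolding m_def by (subst integral_distr[OF \<delta>_meas]) (auto simp: \<delta>_def real_state_def of_real_fun.rep_eq simp flip: f)
  qed
  finally show ?thesis .
qed

lemma kernel_max_le:
  fixes S :: "('a::metric_space \<Rightarrow>\<^sub>C complex) set" and \<Lambda> :: "'a \<Rightarrow> 'a measure"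
  assumes compact: "compact (UNIV :: 'a set)" and \<mu>: "\<mu> \<in> Prob"
    and \<Lambda>: "\<And>x. \<Lambda> x \<in> Prob"
    and meas: "\<And>f :: 'a \<Rightarrow>\<^sub>C complex. (\<lambda>x. state_of (\<Lambda> x) f) \<in> borel_measurable (completion \<mu>)"
    and bary: "AE x in completion \<mu>. \<forall>s\<in>S. state_of (\<Lambda> x) s = apply_bcontfun s x"
    and \<psi>: "\<And>f :: 'a \<Rightarrow>\<^sub>C complex. \<psi> f = (\<integral>x. state_of (\<Lambda> x) f \<partial>completion \<mu>)"
    and F: "finite F" "F \<noteq> {}" "F \<subseteq> self_adjoint_part S"
    and f: "\<And>x. apply_bcontfun f x = Max ((\<lambda>s. apply_bcontfun s x) ` F)"
  shows "(\<integral>x. apply_bcontfun f x \<partial>\<mu>) \<le> Re (\<psi> (of_real_fun f))"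
  unfolding f
proof (rule max_le_of_state_field[OF compact ProbD(1)[OF \<mu>] _ meas \<psi> F(1,2) f, where E=apply_bcontfun])
  show "apply_bcontfun s \<in> borel_measurable \<mu>" for s :: "'a \<Rightarrow>\<^sub>C real"
    by (rule borel_measurable_continuous_on_UNIV[OF ProbD(3)[OF \<mu>]]) simp
  show "AE x in completion \<mu>. \<forall>s\<in>F. state_of (\<Lambda> x) (of_real_fun s) = of_real (apply_bcontfun s x)"
    using bary by eventually_elim (use F(3) in \<open>auto simp: self_adjoint_part_def of_real_fun.rep_eq subset_eq\<close>)
qed (auto simp: state_of_in_states[OF \<Lambda>] abs_apply_bcontfun_le)

text \<open>The complex form of \<open>barycentric_kernel\<close>. A function system is closed under
  conjugation, so real and imaginary parts of its elements lie in the self-adjoint part, where the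
  real kernel reproduces them.\<close>

lemma kernel_of_choquet:
  fixes S :: "('a::metric_space \<Rightarrow>\<^sub>C complex) set"
  assumes compact: "compact (UNIV :: 'a set)" and S: "function_system S"
    and \<mu>: "\<mu> \<in> Prob" and \<nu>: "\<nu> \<in> Prob" and le: "choquet_le S \<mu> \<nu>"
  obtains \<Lambda> :: "'a \<Rightarrow> 'a measure" where "\<And>x. \<Lambda> x \<in> Prob"
    "\<And>f :: 'a \<Rightarrow>\<^sub>C complex. (\<lambda>x. state_of (\<Lambda> x) f) \<in> borel_measurable borel"
    "\<And>x s. s \<in> S \<Longrightarrow> state_of (\<Lambda> x) s = apply_bcontfun s x"
    "\<And>f :: 'a \<Rightarrow>\<^sub>C complex. state_of \<nu> f = (\<integral>x. state_of (\<Lambda> x) f \<partial>\<mu>)"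
proof -
  have S_add: "f + g \<in> S" if "f \<in> S" "g \<in> S" for f g using S that by (simp add: function_system_def)
  have S_mult: "const_mult c f \<in> S" if "f \<in> S" for c f using S that by (simp add: function_system_def)
  have S_conj: "conj_fun f \<in> S" if "f \<in> S" for f using S that by (simp add: function_system_def)
  have S_one: "const_bcontfun 1 \<in> S" using S by (simp add: function_system_def)
  have sub: "subspace (self_adjoint_part S)"
  proof (rule subspaceI)
    have "of_real_fun (0 :: 'a \<Rightarrow>\<^sub>C real) = const_mult 0 (const_bcontfun 1)"
      by (rule bcontfun_eqI) (simp add: of_real_fun.rep_eq const_mult.rep_eq)
    then show "0 \<in> self_adjoint_part S"
      using S_mult[OF S_one, of 0] by (simp only: self_adjoint_part_def mem_Collect_eq)
  qed (auto simp: self_adjoint_part_def of_real_fun_add of_real_fun_scaleR S_add S_mult)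
  have one: "const_bcontfun 1 \<in> self_adjoint_part S"
    using S_mult[OF S_one, of 1] by (simp add: self_adjoint_part_def of_real_fun_const)
  interpret max_dominated "self_adjoint_part S" \<mu> \<nu>
    by (rule max_dominated.intro[OF compact ProbD(1)[OF \<mu>] ProbD(1)[OF \<nu>] ProbD(3)[OF \<mu>] ProbD(3)[OF \<nu>] sub one
          max_le_of_choquet[OF compact le]])
  obtain \<Lambda> where \<Lambda>: "\<And>x. prob_space (\<Lambda> x)" "\<And>x. sets (\<Lambda> x) = sets borel"
    and meas: "\<And>f :: 'a \<Rightarrow>\<^sub>C real. (\<lambda>x. \<integral>y. apply_bcontfun f y \<partial>\<Lambda> x) \<in> borel_measurable borel"
    and bary: "\<And>x s. s \<in> self_adjoint_part S \<Longrightarrow> (\<integral>y. apply_bcontfun s y \<partial>\<Lambda> x) = apply_bcontfun s x"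
    and int: "\<And>f :: 'a \<Rightarrow>\<^sub>C real. (\<integral>x. \<integral>y. apply_bcontfun f y \<partial>\<Lambda> x \<partial>\<mu>) = (\<integral>y. apply_bcontfun f y \<partial>\<nu>)"
    using barycentric_kernel by blast
  have P: "\<Lambda> x \<in> Prob" for x using \<Lambda> by (simp add: Prob_def)
  define re where "re f = Bcontfun (\<lambda>x. Re (apply_bcontfun f x))" for f :: "'a \<Rightarrow>\<^sub>C complex"
  define im where "im f = Bcontfun (\<lambda>x. Im (apply_bcontfun f x))" for f :: "'a \<Rightarrow>\<^sub>C complex"
  have app: "apply_bcontfun (re f) = (\<lambda>x. Re (apply_bcontfun f x))" "apply_bcontfun (im f) = (\<lambda>x. Im (apply_bcontfun f x))" for f
    unfolding re_def im_def by (intro apply_bcontfun_Bcontfun compact continuous_intros, simp)+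
  have split: "state_of M f = Complex (\<integral>x. apply_bcontfun (re f) x \<partial>M) (\<integral>x. apply_bcontfun (im f) x \<partial>M)"
    if "M \<in> Prob" for M f
    unfolding state_of_def app by (rule integral_complex_Re_Im, rule integrable_bcontfun[OF ProbD(2,3)[OF that]])
  have S_re: "re s \<in> self_adjoint_part S" and S_im: "im s \<in> self_adjoint_part S" if "s \<in> S" for s
  proof -
    have "of_real_fun (re s) = const_mult (1/2) (s + conj_fun s)"
      by (rule bcontfun_eqI) (simp add: of_real_fun.rep_eq const_mult.rep_eq conj_fun.rep_eq app complex_eq_iff)
    then show "re s \<in> self_adjoint_part S" by (simp add: self_adjoint_part_def S_mult S_add S_conj that)
    have "of_real_fun (im s) = const_mult (- \<i> / 2) (s + const_mult (- 1) (conj_fun s))"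
      by (rule bcontfun_eqI) (simp add: of_real_fun.rep_eq const_mult.rep_eq conj_fun.rep_eq app complex_eq_iff)
    then show "im s \<in> self_adjoint_part S" by (simp add: self_adjoint_part_def S_mult S_add S_conj that)
  qed
  have meas': "(\<lambda>x. state_of (\<Lambda> x) f) \<in> borel_measurable borel" for f
    unfolding split[OF P] Complex_eq using meas by measurable
  show ?thesis
  proof (rule that[OF P meas'])
    fix x s assume "s \<in> S"
    then show "state_of (\<Lambda> x) s = apply_bcontfun s x"
      by (simp only: split[OF P] bary S_re S_im) (simp add: app complex_eq_iff)
  next
    fix f :: "'a \<Rightarrow>\<^sub>C complex"
    interpret \<mu>: prob_space \<mu> by (rule ProbD(1)[OF \<mu>])
    have "integrable \<mu> (\<lambda>x. state_of (\<Lambda> x) f)"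
      using meas'[of f] norm_state_of_le[OF P, of _ f] ProbD(3)[OF \<mu>]
      by (intro \<mu>.integrable_const_bound[where B="norm f"]) (auto cong: measurable_cong_sets)
    from integral_complex_Re_Im[OF this] show "state_of \<nu> f = (\<integral>x. state_of (\<Lambda> x) f \<partial>\<mu>)"
      by (simp add: split[OF P] split[OF \<nu>] int)
  qed
qed

theorem theorem5p7:
  fixes S :: "('a::metric_space \<Rightarrow>\<^sub>C complex) set" and \<mu> \<nu> :: "'a measure"
  assumes "compact (UNIV :: 'a set)"
    and "function_system S"
    and "separates_points S"
    and "\<mu> \<in> Prob" and "\<nu> \<in> Prob"
  shows "(choquet_le S \<mu> \<nu> \<longleftrightarrow> strong_dilation_le S (state_of \<mu>) (state_of \<nu>)) \<and>
    (strong_dilation_le S (state_of \<mu>) (state_of \<nu>) \<longleftrightarrow> isd_le S (state_of \<mu>) (state_of \<nu>)) \<and>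
    (isd_le S (state_of \<mu>) (state_of \<nu>) \<longleftrightarrow>
      (\<exists>\<Lambda> :: 'a \<Rightarrow> 'a measure.
        (\<forall>x. \<Lambda> x \<in> Prob) \<and>
        (\<forall>f :: 'a \<Rightarrow>\<^sub>C complex. (\<lambda>x. state_of (\<Lambda> x) f) \<in> borel_measurable (completion \<mu>)) \<and>
        (AE x in completion \<mu>. \<forall>s\<in>S. state_of (\<Lambda> x) s = apply_bcontfun s x) \<and>
        (\<forall>f :: 'a \<Rightarrow>\<^sub>C complex.
          (\<integral>x. apply_bcontfun f x \<partial>\<nu>) = (\<integral>x. state_of (\<Lambda> x) f \<partial>completion \<mu>))))"
    (is "(?C \<longleftrightarrow> ?SD) \<and> (?SD \<longleftrightarrow> ?ISD) \<and> (?ISD \<longleftrightarrow> ?K)")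
proof -
  note compact = assms(1) and \<mu> = assms(4) and \<nu> = assms(5)
  interpret \<mu>: borel_prob \<mu> by (rule borel_probI[OF compact \<mu>])
  \<comment> \<open>The three converse implications are reduced to maxima in one common form, with
    the \<nu>-integral written as a value of the state.\<close>
  have choquetI: ?C
    if "\<And>F f. finite F \<Longrightarrow> F \<noteq> {} \<Longrightarrow> F \<subseteq> self_adjoint_part S \<Longrightarrow>
      (\<And>x. apply_bcontfun f x = Max ((\<lambda>s. apply_bcontfun s x) ` F)) \<Longrightarrow>
      (\<integral>x. apply_bcontfun f x \<partial>\<mu>) \<le> Re (state_of \<nu> (of_real_fun f))"
    by (rule choquet_of_max_le[OF \<mu> \<nu>]) (rule that[unfolded Re_state_of_eq])
  have "?SD \<Longrightarrow> ?C"
    by (rule choquetI) (rule \<mu>.strong_dilation_max_le)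
  moreover have "?ISD \<Longrightarrow> ?C"
    by (rule choquetI) (rule isd_max_le[OF compact \<mu>])
  moreover have "?K \<Longrightarrow> ?C"
    by (elim exE conjE, rule choquetI, rule kernel_max_le[OF compact \<mu>]) (auto simp: state_of_def)
  \<comment> \<open>One Borel kernel serves all three conditions; integrals of Borel functions are
    the same over \<mu> and its completion.\<close>
  moreover have "?SD \<and> ?ISD \<and> ?K" if C: ?C
  proof -
    obtain \<Lambda> :: "'a \<Rightarrow> 'a measure" where \<Lambda>: "\<And>x. \<Lambda> x \<in> Prob"
      "\<And>f :: 'a \<Rightarrow>\<^sub>C complex. (\<lambda>x. state_of (\<Lambda> x) f) \<in> borel_measurable borel"
      "\<And>x s. s \<in> S \<Longrightarrow> state_of (\<Lambda> x) s = apply_bcontfun s x"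
      and \<nu>_eq: "\<And>f :: 'a \<Rightarrow>\<^sub>C complex. state_of \<nu> f = (\<integral>x. state_of (\<Lambda> x) f \<partial>\<mu>)"
      using kernel_of_choquet[OF compact assms(2) \<mu> \<nu> C] by blast
    have meas: "(\<lambda>x. state_of (\<Lambda> x) f) \<in> borel_measurable \<mu>" for f :: "'a \<Rightarrow>\<^sub>C complex"
      using \<Lambda>(2) \<mu>.sets_eq by (simp cong: measurable_cong_sets)
    have ?SD
      using \<mu>.strong_dilation_of_kernel[OF \<Lambda>] by (simp add: \<nu>_eq[abs_def])
    moreover have ?ISD by (rule isd_of_kernel[OF compact \<mu> \<Lambda> \<nu>_eq])
    moreover have ?K
    proof (intro exI[of _ \<Lambda>] conjI allI)
      show "(\<lambda>x. state_of (\<Lambda> x) f) \<in> borel_measurable (completion \<mu>)" for f :: "'a \<Rightarrow>\<^sub>C complex"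
        by (rule measurable_completion[OF meas])
      show "(\<integral>x. apply_bcontfun f x \<partial>\<nu>) = (\<integral>x. state_of (\<Lambda> x) f \<partial>completion \<mu>)" for f :: "'a \<Rightarrow>\<^sub>C complex"
        using \<nu>_eq[of f] by (simp add: integral_completion[OF meas] state_of_def[of \<nu>])
    qed (use \<Lambda> in auto)
    ultimately show ?thesis by blast
  qed
  ultimately show ?thesis by blast
qed

end
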